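(* Let $\ell_1,\ell_2$ be positive integers, $k_1=2\ell_1$, $k_2=2\ell_2$, $k=k_1+k_2$. Let $E_{p,q}$ denote the $k\times k$ matrix units. Let $R^{\dagger}_{[k_1,k_2]}=(R^{\dagger}_{[k_1,k_2]})_0+(R^{\dagger}_{[k_1,k_2]})_1$ be the conformal superalgebra (with $\partial$, $Y^+(\cdot,z)$ as in the context) whose even part $(R^{\dagger}_{[k_1,k_2]})_0$ is the span of the elements $$(E_{p_1,q_1})_{[0,0]}(m,n)+(E_{\ell_1+q_1,\ell_1+p_1})_{[0,0]}(n,m),\quad (E_{p_1,\ell_1+q_1})_{[0,0]}(m,n)-(E_{q_1,\ell_1+p_1})_{[0,0]}(n,m),$$ $$(E_{\ell_1+p_1,q_1})_{[0,0]}(m,n)-(E_{\ell_1+q_1,p_1})_{[0,0]}(n,m),$$ $$(E_{k_1+p_2,k_1+q_2})_{[1,1]}(m,n)-(E_{k_1+\ell_2+q_2,k_1+\ell_2+p_2})_{[1,1]}(n,m),$$ $$(E_{k_1+p_2,k_1+\ell_2+q_2})_{[1,1]}(m,n)+(E_{k_1+q_2,k_1+\ell_2+p_2})_{[1,1]}(n,m),$$ $$(E_{k_1+\ell_2+p_2,k_1+q_2})_{[1,1]}(m,n)+(E_{k_1+\ell_2+q_2,k_1+p_2})_{[1,1]}(n,m)$$ for $1\le p_1,q_1\le\ell_1$, $1\le p_2,q_2\le\ell_2$, $m,n\in\mathbb{N}$, and whose odd part $(R^{\dagger}_{[k_1,k_2]})_1$ is the span of the elements $$(E_{p_1,k_1+p_2})_{[0,1]}(m,n)+(E_{k_1+\ell_2+p_2,\ell_1+p_1})_{[1,0]}(n,m),\quad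 (E_{p_1,k_1+\ell_2+p_2})_{[0,1]}(m,n)-(E_{k_1+p_2,\ell_1+p_1})_{[1,0]}(n,m),$$ $$(E_{\ell_1+p_1,k_1+p_2})_{[0,1]}(m,n)-(E_{k_1+\ell_2+p_2,p_1})_{[1,0]}(n,m),\quad (E_{\ell_1+p_1,k_1+\ell_2+p_2})_{[0,1]}(m,n)+(E_{k_1+p_2,p_1})_{[1,0]}(n,m)$$ for $1\le p_1\le\ell_1$, $1\le p_2\le\ell_2$, $m,n\in\mathbb{N}$. Then the conformal superalgebra $R^{\dagger}_{[k_1,k_2]}$ is simple. Moreover, writing $u_{[i,j]}=u_{[i,j]}(0,0)$, it is generated by its subspace of weight $3/2$, $$(R^{\dagger}_{[k_1,k_2]})^{(3/2)}=\mathrm{span}\{(E_{p_1,k_1+p_2})_{[0,1]}+(E_{k_1+\ell_2+p_2,\ell_1+p_1})_{[1,0]},\ (E_{p_1,k_1+\ell_2+p_2})_{[0,1]}-(E_{k_1+p_2,\ell_1+p_1})_{[1,0]},$$ $$(E_{\ell_1+p_1,k_1+p_2})_{[0,1]}-(E_{k_1+\ell_2+p_2,p_1})_{[1,0]},\ (E_{\ell_1+p_1,k_1+\ell_2+p_2})_{[0,1]}+(E_{k_1+p_2,p_1})_{[1,0]}\mid 1\le p_1\le\ell_1,\ 1\le p_2\le\ell_2\},$$ if $k>4$, and by $$(R^{\dagger}_{[k_1,k_2]})^{(3/2)}+\mathbb{F}\bigl[(E_{3,3})_{[1,1]}(0,1)-(E_{4,4})_{[1,1]}(1,0)\bigr]$$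 if $k=4$.
   Context: Conventions. $\mathbb{F}$ is an arbitrary field of characteristic $0$; $\mathbb{N}=\{0,1,2,\dots\}$; $\binom{a}{n}=a(a-1)\cdots(a-n+1)/n!$ for $a\in\mathbb{Z}$, $n\in\mathbb{N}$; elements of $\mathbb{Z}_2$ are written $0,1$. $\mathrm{Res}_x$ takes the coefficient of $x^{-1}$. All binomials such as $(z-x)^{-1}$ are expanded in nonnegative powers of the second variable. $LM(V_1,V_2)$ is the space of linear maps $V_1\to V_2$. Conformal superalgebra. A conformal superalgebra $(R,\partial,Y^+(\cdot,z))$ is a $\mathbb{Z}_2$-graded $\mathbb{F}[\partial]$-module $R=R_0\oplus R_1$ with a $\mathbb{Z}_2$-graded linear map $Y^+(\cdot,z):R\to LM(R,R[z^{-1}]z^{-1})$ such that, for $u\in R_i$, $v\in R_j$: $Y^+(\partial u,z)=\frac{d}{dz}Y^+(u,z)$; $Y^+(u,z)v=(-1)^{ij}\mathrm{Res}_x\frac{e^{x\partial}Y^+(v,-x)u}{z-x}$; $Y^+(u,z_1)Y^+(v,z_2)-(-1)^{ij}Y^+(v,z_2)Y^+(u,z_1)=\mathrm{Res}_x\frac{Y^+(Y^+(u,z_1-x)v,x)}{z_2-x}$. Write $Y^+(u,z)=\sum_{n\ge 0}u_nz^{-n-1}$. An ideal is a subspace $\mathcal{I}\subset R$ with $\partial(\mathcal{I})\subset\mathcal{I}$ and $Y^+(u,z)\mathcal{I}\subset\mathcal{I}[z^{-1}]$ for all $u\in R$. $R$ is simple if its only ideals are $\{0\}$ and $R$. A (sub-)superalgebra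 $R'$ is generated by a subset $S$ if $R'=\mathrm{span}\{u^1_{m_1}\cdots u^p_{m_p}v\mid u^1,\dots,u^p,v\in S,\ p,m_1,\dots,m_p\in\mathbb{N}\}$ (for $p=0$ the expression is $v$). Construction. Let $\mathcal{A}=M_{k\times k}(\mathbb{F})$, $k=k_1+k_2$, with the $\mathbb{Z}_2$-grading $\mathcal{A}=\mathcal{A}_0\oplus\mathcal{A}_1$ in which $\mathcal{A}_0$ consists of the block-diagonal matrices (diagonal blocks of sizes $k_1\times k_1$ and $k_2\times k_2$) and $\mathcal{A}_1$ of the block-off-diagonal ones. Let $R(\mathcal{A})=\bigoplus_{i,j\in\mathbb{Z}_2}\mathcal{A}_{i+j}\otimes\mathbb{F}[t_1,t_2]$, and denote by $u_{[i,j]}(m,n)$ the element $u\otimes t_1^mt_2^n$ of the $(i,j)$-summand ($u\in\mathcal{A}_{i+j}$, $m,n\in\mathbb{N}$); it has parity $i+j$. Define $$\partial u_{[i,j]}(m,n)=(m+1)u_{[i,j]}(m+1,n)+(n+1)u_{[i,j]}(m,n+1),$$ $$Y^+(u_{[i_1,i_2]}(m_1,m_2),z)v_{[j_1,j_2]}(n_1,n_2)=\delta_{i_2,j_1}(n_1\delta_{i_2,0}+1)\binom{-n_1-1-\delta_{i_2,0}}{m_2}\sum_{p=0}^{m_1+m_2+n_1+\delta_{i_2,0}}\binom{p}{m_1}(uv)_{[i_1,j_2]}(p,n_2)z^{p-m_1-m_2-n_1-1-\delta_{i_2,0}}$$ $$-(-1)^{(i_1+i_2)(j_1+j_2)}\delta_{i_1,j_2}\bigl(\delta_{i_1,1}-(n_2+1)\delta_{i_1,0}\bigr)\binom{-n_2-1-\delta_{i_1,0}}{m_1}\sum_{q=0}^{m_1+m_2+n_2+\delta_{i_1,0}}\binom{q}{m_2}(vu)_{[j_1,i_2]}(n_1,q)z^{q-m_1-m_2-n_2-1-\delta_{i_1,0}}.$$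 Then $(R(\mathcal{A}),\partial,Y^+(\cdot,z))$ is a conformal superalgebra, and the subspace $R^{\dagger}_{[k_1,k_2]}$ of the claim is closed under $\partial$ and $Y^+$, hence a conformal superalgebra with the restricted structure. The weight of $u_{[i,j]}(m,n)$ is $m+n+\delta_{i,0}+\delta_{j,0}+(\delta_{i,1}+\delta_{j,1})/2$; a superscript $(w)$ denotes the subspace of elements of weight $w$. *)

theory Defs
  imports
    "HOL.Vector_Spaces"
    "HOL-Library.Z2"
    "HOL-Library.Function_Algebras"
    "HOL-Library.Poly_Mapping"
    Complex_Main
begin

abbreviation "lookup \<equiv> Poly_Mapping.lookup"
abbreviation "keys \<equiv> Poly_Mapping.keys"

section \<open>Conformal superalgebras\<close>

text \<open>
  The group Z_2 is the type \<^typ>\<open>bit\<close>. A Z_2-graded space is given by its homogeneous parts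
  \<open>G 0\<close> and \<open>G 1\<close>, two subspaces of an ambient vector space, and \<open>whole G\<close> is their sum.
\<close>

definition whole :: "(bit \<Rightarrow> 'v::ab_group_add set) \<Rightarrow> 'v set" where
  "whole G = {x + y | x y. x \<in> G 0 \<and> y \<in> G 1}"

definition koszul :: "bit \<Rightarrow> bit \<Rightarrow> 'a::ring_1" where
  "koszul i j = (if i * j = 1 then - 1 else 1)"

text \<open>
  A Laurent polynomial in \<open>z\<close> with coefficients in \<open>'v\<close> is an element of \<^typ>\<open>int \<Rightarrow>\<^sub>0 'v\<close>:
  \<open>lookup F e\<close> is the coefficient of \<open>z^e\<close>. Thus \<open>Y u v\<close> below is \<open>Y\<^sup>+(u,z)v\<close>, and \<open>nprod Y u n v\<close>
  is \<open>u\<^sub>n v\<close> in \<open>Y\<^sup>+(u,z) = (\<Sum>n\<ge>0. u\<^sub>n z^(-n-1))\<close>.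
\<close>

definition nprod :: "('v \<Rightarrow> 'v \<Rightarrow> (int \<Rightarrow>\<^sub>0 'v::zero)) \<Rightarrow> 'v \<Rightarrow> nat \<Rightarrow> 'v \<Rightarrow> 'v" where
  "nprod Y u n v = lookup (Y u v) (- int n - 1)"

text \<open>
  The three identities of a conformal superalgebra are written out coefficientwise.

  \<^item> \<open>Y_deriv\<close> compares the coefficients of \<open>z^e\<close> in \<open>Y\<^sup>+(\<partial>u,z) = d/dz Y\<^sup>+(u,z)\<close>.
  \<^item> \<open>Y_skew\<close> compares the coefficients of \<open>z^(-m-1)\<close> in
    \<open>Y\<^sup>+(u,z)v = (-1)^(ij) Res\<^sub>x e^(x\<partial>) Y\<^sup>+(v,-x)u / (z-x)\<close>: by \<open>1/(z-x) = (\<Sum>m. x^m z^(-m-1))\<close>, the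
    residue selects the terms \<open>x^k \<partial>^k/k! v\<^sub>n u (-x)^(-n-1)\<close> with \<open>n = m + k\<close>. The sum runs over
    the finitely many \<open>k\<close> with \<open>v\<^sub>m\<^sub>+\<^sub>k u \<noteq> 0\<close>.
  \<^item> \<open>Y_commutator\<close> compares the coefficients of \<open>z\<^sub>1^(-m-1) z\<^sub>2^(-n-1)\<close> in
    \<open>Y\<^sup>+(u,z\<^sub>1)Y\<^sup>+(v,z\<^sub>2) - (-1)^(ij) Y\<^sup>+(v,z\<^sub>2)Y\<^sup>+(u,z\<^sub>1) = Res\<^sub>x Y\<^sup>+(Y\<^sup>+(u,z\<^sub>1-x)v,x) / (z\<^sub>2-x)\<close>: the factor
    \<open>(z\<^sub>1-x)^(-l-1)\<close> that accompanies \<open>u\<^sub>l v\<close> contributes \<open>z\<^sub>1^(-m-1)\<close> through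
    \<open>binom(-l-1, m-l) (-x)^(m-l)\<close> if \<open>l \<le> m\<close>, and the residue then selects \<open>(u\<^sub>l v)\<^sub>r\<close> with
    \<open>r = m - l + n\<close>.
\<close>

locale conformal_superalgebra = vector_space scale
  for scale :: "'a::field_char_0 \<Rightarrow> 'v::ab_group_add \<Rightarrow> 'v" +
  fixes G :: "bit \<Rightarrow> 'v set"
    and D :: "'v \<Rightarrow> 'v"
    and Y :: "'v \<Rightarrow> 'v \<Rightarrow> (int \<Rightarrow>\<^sub>0 'v)"
  assumes subspace_part: "subspace (G i)"
    and direct_sum: "G 0 \<inter> G 1 = {0}"
    and D_graded: "u \<in> G i \<Longrightarrow> D u \<in> G i"
    and D_add: "\<lbrakk>u \<in> whole G; v \<in> whole G\<rbrakk> \<Longrightarrow> D (u + v) = D u + D v"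
    and D_scale: "u \<in> whole G \<Longrightarrow> D (scale c u) = scale c (D u)"
    and Y_add_left: "\<lbrakk>u \<in> whole G; u' \<in> whole G; v \<in> whole G\<rbrakk> \<Longrightarrow> Y (u + u') v = Y u v + Y u' v"
    and Y_scale_left: "\<lbrakk>u \<in> whole G; v \<in> whole G\<rbrakk> \<Longrightarrow>
          lookup (Y (scale c u) v) e = scale c (lookup (Y u v) e)"
    and Y_add_right: "\<lbrakk>u \<in> whole G; v \<in> whole G; v' \<in> whole G\<rbrakk> \<Longrightarrow> Y u (v + v') = Y u v + Y u v'"
    and Y_scale_right: "\<lbrakk>u \<in> whole G; v \<in> whole G\<rbrakk> \<Longrightarrow>
          lookup (Y u (scale c v)) e = scale c (lookup (Y u v) e)"
    and Y_polar: "\<lbrakk>u \<in> whole G; v \<in> whole G; e \<ge> 0\<rbrakk> \<Longrightarrow> lookup (Y u v) e = 0"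
    and Y_graded: "\<lbrakk>u \<in> G i; v \<in> G j\<rbrakk> \<Longrightarrow> lookup (Y u v) e \<in> G (i + j)"
    and Y_deriv: "\<lbrakk>u \<in> whole G; v \<in> whole G\<rbrakk> \<Longrightarrow>
          lookup (Y (D u) v) e = scale (of_int (e + 1)) (lookup (Y u v) (e + 1))"
    and Y_skew: "\<lbrakk>u \<in> G i; v \<in> G j\<rbrakk> \<Longrightarrow>
          nprod Y u m v = scale (koszul i j)
            (\<Sum>k | nprod Y v (m + k) u \<noteq> 0.
               scale ((- 1) ^ (m + k + 1) / fact k) ((D ^^ k) (nprod Y v (m + k) u)))"
    and Y_commutator: "\<lbrakk>u \<in> G i; v \<in> G j; w \<in> whole G\<rbrakk> \<Longrightarrow>
          nprod Y u m (nprod Y v n w) - scale (koszul i j) (nprod Y v n (nprod Y u m w)) =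
            (\<Sum>l\<le>m. scale (((- of_nat l - 1) gchoose (m - l)) * (- 1) ^ (m - l))
                     (nprod Y (nprod Y u l v) (m - l + n) w))"
begin

definition ideal :: "'v set \<Rightarrow> bool" where
  "ideal I \<longleftrightarrow> subspace I \<and> I \<subseteq> whole G \<and> (\<forall>v\<in>I. D v \<in> I) \<and>
     (\<forall>u\<in>whole G. \<forall>v\<in>I. \<forall>e. lookup (Y u v) e \<in> I)"

end

locale simple_conformal_superalgebra = conformal_superalgebra +
  assumes simple: "ideal I \<Longrightarrow> I = {0} \<or> I = whole G"

text \<open>The elements \<open>u\<^sup>1\<^sub>m\<^sub>1 (\<dots> (u\<^sup>p\<^sub>m\<^sub>p v))\<close> with \<open>u\<^sup>1, \<dots>, u\<^sup>p, v \<in> S\<close> and \<open>p \<ge> 0\<close>:\<close>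

inductive_set nested_products :: "('v \<Rightarrow> 'v \<Rightarrow> (int \<Rightarrow>\<^sub>0 'v::zero)) \<Rightarrow> 'v set \<Rightarrow> 'v set"
  for Y :: "'v \<Rightarrow> 'v \<Rightarrow> (int \<Rightarrow>\<^sub>0 'v)" and S :: "'v set" where
  base: "v \<in> S \<Longrightarrow> v \<in> nested_products Y S"
| step: "u \<in> S \<Longrightarrow> w \<in> nested_products Y S \<Longrightarrow> nprod Y u m w \<in> nested_products Y S"

definition generated ::
  "('a::field \<Rightarrow> 'v::ab_group_add \<Rightarrow> 'v) \<Rightarrow> ('v \<Rightarrow> 'v \<Rightarrow> (int \<Rightarrow>\<^sub>0 'v)) \<Rightarrow> 'v set \<Rightarrow> 'v set" where
  "generated scale Y S = module.span scale (nested_products Y S)"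


section \<open>The algebra of k by k matrices\<close>

text \<open>
  Matrices are functions of a row and a column index. The k by k matrices are those supported on
  \<open>{1..k} \<times> {1..k}\<close>. Addition and zero are pointwise (from \<^theory>\<open>HOL-Library.Function_Algebras\<close>);
  the matrix product is \<open>mmul k\<close>, not \<open>*\<close>.
\<close>

type_synonym 'a mtx = "nat \<Rightarrow> nat \<Rightarrow> 'a"

definition mmul :: "nat \<Rightarrow> 'a::comm_ring_1 mtx \<Rightarrow> 'a mtx \<Rightarrow> 'a mtx" where
  "mmul k u v = (\<lambda>p q. \<Sum>r = 1..k. u p r * v r q)"

definition E :: "nat \<Rightarrow> nat \<Rightarrow> 'a::comm_ring_1 mtx" where
  "E p q = (\<lambda>r s. of_bool (r = p \<and> s = q))"

text \<open>\<open>mat_part k\<^sub>1 k\<^sub>2 0\<close> and \<open>mat_part k\<^sub>1 k\<^sub>2 1\<close> are the spaces of block-diagonal and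
  block-off-diagonal matrices.\<close>

definition mat_part :: "nat \<Rightarrow> nat \<Rightarrow> bit \<Rightarrow> 'a::comm_ring_1 mtx set" where
  "mat_part k1 k2 i = {u. \<forall>p q. u p q \<noteq> 0 \<longrightarrow>
     p \<in> {1..k1 + k2} \<and> q \<in> {1..k1 + k2} \<and> ((p \<le> k1 \<longleftrightarrow> q \<le> k1) \<longleftrightarrow> i = 0)}"


section \<open>The conformal superalgebra of a matrix superalgebra\<close>

text \<open>
  \<open>lookup f (i, j, m, n)\<close> is the coefficient of \<open>t\<^sub>1^m t\<^sub>2^n\<close> in the (i,j)-summand of \<open>f\<close>. The space
  \<open>R(\<A>)\<close> consists of those \<open>f\<close> all of whose coefficients satisfy
  \<open>lookup f (i, j, m, n) \<in> mat_part k\<^sub>1 k\<^sub>2 (i + j)\<close>. The operations are defined on the whole type.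
\<close>

type_synonym 'a RA = "(bit \<times> bit \<times> nat \<times> nat) \<Rightarrow>\<^sub>0 'a mtx"

definition smul :: "'a::field_char_0 \<Rightarrow> 'a RA \<Rightarrow> 'a RA" where
  "smul c f = Poly_Mapping.map (\<lambda>u p q. c * u p q) f"

lemma lookup_smul: "lookup (smul c f) x = (\<lambda>p q. c * lookup f x p q)"
  by (auto simp: smul_def map.rep_eq when_def fun_eq_iff)

global_interpretation RA: vector_space smul
  by standard
    (auto intro!: poly_mapping_eqI simp: lookup_smul lookup_add fun_eq_iff algebra_simps)

text \<open>\<open>elt u i j m n\<close> is the element \<open>u\<^bsub>[i,j]\<^esub>(m,n)\<close>.\<close>

definition elt :: "'a::field_char_0 mtx \<Rightarrow> bit \<Rightarrow> bit \<Rightarrow> nat \<Rightarrow> nat \<Rightarrow> 'a RA" where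
  "elt u i j m n = Poly_Mapping.single (i, j, m, n) u"

abbreviation kd :: "bit \<Rightarrow> bit \<Rightarrow> 'b::zero_neq_one" where
  "kd i j \<equiv> of_bool (i = j)"

definition der :: "'a::field_char_0 RA \<Rightarrow> 'a RA" where
  "der f = (\<Sum>(i, j, m, n)\<in>keys f. let u = lookup f (i, j, m, n) in
     smul (of_nat (m + 1)) (elt u i j (m + 1) n) + smul (of_nat (n + 1)) (elt u i j m (n + 1)))"

definition Yplus_elt :: "nat \<Rightarrow>
    'a::field_char_0 mtx \<Rightarrow> bit \<Rightarrow> bit \<Rightarrow> nat \<Rightarrow> nat \<Rightarrow>
    'a mtx \<Rightarrow> bit \<Rightarrow> bit \<Rightarrow> nat \<Rightarrow> nat \<Rightarrow> (int \<Rightarrow>\<^sub>0 'a RA)" where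
  "Yplus_elt k u i1 i2 m1 m2 v j1 j2 n1 n2 =
     (\<Sum>p = 0..m1 + m2 + n1 + kd i2 0.
        Poly_Mapping.single (int p - int m1 - int m2 - int n1 - 1 - kd i2 0)
          (smul (kd i2 j1 * (of_nat n1 * kd i2 0 + 1)
                 * ((- of_nat n1 - 1 - kd i2 0) gchoose m2) * of_nat (p choose m1))
             (elt (mmul k u v) i1 j2 p n2)))
   - (\<Sum>q = 0..m1 + m2 + n2 + kd i1 0.
        Poly_Mapping.single (int q - int m1 - int m2 - int n2 - 1 - kd i1 0)
          (smul (koszul (i1 + i2) (j1 + j2) * kd i1 j2 * (kd i1 1 - (of_nat n2 + 1) * kd i1 0)
                 * ((- of_nat n2 - 1 - kd i1 0) gchoose m1) * of_nat (q choose m2))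
             (elt (mmul k v u) j1 i2 n1 q)))"

definition Yplus :: "nat \<Rightarrow> 'a::field_char_0 RA \<Rightarrow> 'a RA \<Rightarrow> (int \<Rightarrow>\<^sub>0 'a RA)" where
  "Yplus k f g = (\<Sum>(i1, i2, m1, m2)\<in>keys f. \<Sum>(j1, j2, n1, n2)\<in>keys g.
     Yplus_elt k (lookup f (i1, i2, m1, m2)) i1 i2 m1 m2 (lookup g (j1, j2, n1, n2)) j1 j2 n1 n2)"

definition weight :: "bit \<Rightarrow> bit \<Rightarrow> nat \<Rightarrow> nat \<Rightarrow> rat" where
  "weight i j m n = of_nat m + of_nat n + kd i 0 + kd j 0 + (kd i 1 + kd j 1) / 2"

definition weight_space :: "nat \<Rightarrow> nat \<Rightarrow> rat \<Rightarrow> 'a::field_char_0 RA set" where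
  "weight_space k1 k2 w =
     RA.span {elt u i j m n | u i j m n. u \<in> mat_part k1 k2 (i + j) \<and> weight i j m n = w}"


section \<open>The subalgebra \<open>R\<^sup>\<dagger>\<close>\<close>

definition even_gens :: "nat \<Rightarrow> nat \<Rightarrow> nat \<Rightarrow> nat \<Rightarrow> 'a::field_char_0 RA set" where
  "even_gens l1 l2 m n = (let k1 = 2 * l1 in
     {elt (E p q) 0 0 m n + elt (E (l1 + q) (l1 + p)) 0 0 n m | p q. p \<in> {1..l1} \<and> q \<in> {1..l1}}
   \<union> {elt (E p (l1 + q)) 0 0 m n - elt (E q (l1 + p)) 0 0 n m | p q. p \<in> {1..l1} \<and> q \<in> {1..l1}}
   \<union> {elt (E (l1 + p) q) 0 0 m n - elt (E (l1 + q) p) 0 0 n m | p q. p \<in> {1..l1} \<and> q \<in> {1..l1}}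
   \<union> {elt (E (k1 + p) (k1 + q)) 1 1 m n - elt (E (k1 + l2 + q) (k1 + l2 + p)) 1 1 n m | p q.
        p \<in> {1..l2} \<and> q \<in> {1..l2}}
   \<union> {elt (E (k1 + p) (k1 + l2 + q)) 1 1 m n + elt (E (k1 + q) (k1 + l2 + p)) 1 1 n m | p q.
        p \<in> {1..l2} \<and> q \<in> {1..l2}}
   \<union> {elt (E (k1 + l2 + p) (k1 + q)) 1 1 m n + elt (E (k1 + l2 + q) (k1 + p)) 1 1 n m | p q.
        p \<in> {1..l2} \<and> q \<in> {1..l2}})"

definition odd_gens :: "nat \<Rightarrow> nat \<Rightarrow> nat \<Rightarrow> nat \<Rightarrow> 'a::field_char_0 RA set" where
  "odd_gens l1 l2 m n = (let k1 = 2 * l1 in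
     {elt (E p (k1 + q)) 0 1 m n + elt (E (k1 + l2 + q) (l1 + p)) 1 0 n m | p q.
        p \<in> {1..l1} \<and> q \<in> {1..l2}}
   \<union> {elt (E p (k1 + l2 + q)) 0 1 m n - elt (E (k1 + q) (l1 + p)) 1 0 n m | p q.
        p \<in> {1..l1} \<and> q \<in> {1..l2}}
   \<union> {elt (E (l1 + p) (k1 + q)) 0 1 m n - elt (E (k1 + l2 + q) p) 1 0 n m | p q.
        p \<in> {1..l1} \<and> q \<in> {1..l2}}
   \<union> {elt (E (l1 + p) (k1 + l2 + q)) 0 1 m n + elt (E (k1 + q) p) 1 0 n m | p q.
        p \<in> {1..l1} \<and> q \<in> {1..l2}})"

definition Rdagger :: "nat \<Rightarrow> nat \<Rightarrow> bit \<Rightarrow> 'a::field_char_0 RA set" where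
  "Rdagger l1 l2 i =
     (if i = 0 then RA.span (\<Union>m n. even_gens l1 l2 m n) else RA.span (\<Union>m n. odd_gens l1 l2 m n))"

definition Rdagger_weight :: "nat \<Rightarrow> nat \<Rightarrow> rat \<Rightarrow> 'a::field_char_0 RA set" where
  "Rdagger_weight l1 l2 w = whole (Rdagger l1 l2) \<inter> weight_space (2 * l1) (2 * l2) w"

end

theory Submission
  imports Defs "HOL-Computational_Algebra.Polynomial"
begin

text \<open>
  Replace u[i,j](m,n) by the polynomial function u x^m y^n / (m! n!). Then \<open>\<partial>\<close> becomes
  multiplication by x + y, and the generating function of the products u_n v is
  \<open>a(x, -t-x) c(t+x) b(t+x, y)\<close> minus its super-commuted counterpart, where \<open>c(s) = s\<close> on the first
  block of matrix indices and \<open>c(s) = 1\<close> on the second. So the identities of a conformal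
  superalgebra follow from the associativity of this product, after comparing coefficients.

  The generators of \<open>R\<^sup>\<dagger>\<close> are the symmetrised elements T p q m n, whose products are sums over the
  four contractions of a leg of one factor with a leg of the other. Contractions between generic
  indices have a single term, which raises or replaces exponents one at a time and yields the
  generation statement. For simplicity, a nonzero element of an ideal is moved by contractions to
  one with a nonzero entry at (b, b'), from which contracting twice with the current T b' b 0 0
  extracts T b' b 0 0 itself by looking at the top total degree.
\<close>

section \<open>Bilinearity of the products\<close>

text \<open>The generators of R^dagger put the matrix unit at (p, q) only into the summand given by
  the blocks of p and q. On the span of these units a matrix position therefore determines its
  summand, and one function of two scalars per position loses nothing. A field of characteristic 0
  is infinite, so such a function determines its coefficients. The weights 1/(m! n!) turn the
  binomials of the product formula into the binomial theorem, and c(s) = s records the shift of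
  exponents by one in the first block.

  Products of odd elements of weight 3/2 yield the diagonal even elements only as sums T b b 1 0 + T
  a a 0 0. Raising an exponent takes either a detour through a third index of a block or one of the
  two summands alone, when the other one annihilates the element acted upon. Both need an index
  outside {p, dual p} in some block. With two indices per block there is none, which is why k = 4
  has an additional generator.

  The generated superalgebra is a span of products whose left factors are generators. Its closure
  under all products is a separate argument, based on the commutator formula.\<close>

lemma sum_keys_superset:
  assumes "finite A" "keys f \<subseteq> A" "\<And>x. h x 0 = 0"
  shows "(\<Sum>x\<in>keys f. h x (lookup f x)) = (\<Sum>x\<in>A. h x (lookup f x))"
  by (rule sum.mono_neutral_left) (use assms in \<open>auto simp: in_keys_iff\<close>)

lemma sum_keys_add:
  assumes "\<And>x. h x 0 = 0" "\<And>x u v. h x (u + v) = h x u + h x v"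
  shows "(\<Sum>x\<in>keys (f + g). h x (lookup (f + g) x)) =
    (\<Sum>x\<in>keys f. h x (lookup f x)) + (\<Sum>x\<in>keys g. h x (lookup g x))"
  using Poly_Mapping.setsum_keys_plus_distrib[where f = h] assms by blast

lemma smul_single: "smul c (elt u i j m n) = elt (\<lambda>p q. c * u p q) i j m n"
  by (rule poly_mapping_eqI) (auto simp: lookup_smul elt_def lookup_single when_def fun_eq_iff)

lemma elt_zero [simp]: "elt 0 i j m n = 0"
  by (simp add: elt_def)

lemma elt_add: "elt (u + v) i j m n = elt u i j m n + elt v i j m n"
  by (simp add: elt_def single_add)

text \<open>The coefficient produced by contracting the second leg of the left factor (exponents m1, m2) with
  the first leg of the right factor (exponent n1) in the n-th product; \<open>d\<close> is 1 for the first block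
  of indices and 0 for the second.\<close>

definition contraction_coeff :: "nat \<Rightarrow> nat \<Rightarrow> nat \<Rightarrow> nat \<Rightarrow> nat \<Rightarrow> 'a::field_char_0" where
  "contraction_coeff d m1 m2 n1 n = (if n \<le> m1 + m2 + n1 + d
     then (of_nat n1 * of_nat d + 1) * ((- of_nat n1 - 1 - of_nat d) gchoose m2)
        * of_nat ((m1 + m2 + n1 + d - n) choose m1) else 0)"

definition even_degree :: "bit \<Rightarrow> nat" where "even_degree i = (if i = 0 then 1 else 0)"

lemma kd_even_degree: "kd i 0 = (of_nat (even_degree i) :: 'b::semiring_1)"
  by (simp add: even_degree_def)

lemma sum_single_collapse:
  fixes e :: int
  shows "(\<Sum>p = 0..N. lookup (Poly_Mapping.single (int p - int N - 1) (F p)) e) =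
    (if - int N - 1 \<le> e \<and> e < 0 then F (nat (e + int N + 1)) else 0)"
proof -
  have "(\<Sum>p = 0..N. lookup (Poly_Mapping.single (int p - int N - 1) (F p)) e) =
      (\<Sum>p = 0..N. if p = nat (e + int N + 1) \<and> - int N - 1 \<le> e then F p else 0)"
    by (rule sum.cong) (auto simp: lookup_single when_def)
  also have "\<dots> = (if - int N - 1 \<le> e \<and> e < 0 then F (nat (e + int N + 1)) else 0)"
  proof (cases "- int N - 1 \<le> e \<and> e < 0")
    case True
    then have "nat (e + int N + 1) \<in> {0..N}" by auto
    then show ?thesis using True by (simp add: sum.delta)
  next
    case False
    then show ?thesis by (intro trans[OF sum.neutral]) auto
  qed
  finally show ?thesis .
qed

lemma lookup_Yplus_elt:
  "lookup (Yplus_elt k u i1 i2 m1 m2 v j1 j2 n1 n2) e =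
   (if e < 0 then
      smul (kd i2 j1 * contraction_coeff (even_degree i2) m1 m2 n1 (nat (- e - 1)))
        (elt (mmul k u v) i1 j2 (m1 + m2 + n1 + even_degree i2 - nat (- e - 1)) n2)
    - smul (koszul (i1 + i2) (j1 + j2) * kd i1 j2 * (- 1) ^ even_degree i1 * contraction_coeff (even_degree i1) m2 m1 n2 (nat (- e - 1)))
        (elt (mmul k v u) j1 i2 n1 (m1 + m2 + n2 + even_degree i1 - nat (- e - 1)))
    else 0)"
proof -
  let ?N = "m1 + m2 + n1 + even_degree i2" and ?M = "m1 + m2 + n2 + even_degree i1"
  have 1: "int p - int m1 - int m2 - int n1 - 1 - kd i2 0 = int p - int ?N - 1" for p
    by (simp add: kd_even_degree)
  have 2: "int p - int m1 - int m2 - int n2 - 1 - kd i1 0 = int p - int ?M - 1" for p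
    by (simp add: kd_even_degree)
  \<comment> \<open>Up to the sign (-1)^d the numerical factor of the second half equals that of the
    first, so that both halves become instances of \<open>contraction_coeff\<close>.\<close>
  have 3: "kd i1 1 - (of_nat n2 + 1) * kd i1 0 = (- 1) ^ even_degree i1 * (of_nat n2 * of_nat (even_degree i1) + 1 :: 'a)"
    by (cases i1) (auto simp: even_degree_def)
  have c: "m2 + m1 + n2 + even_degree i1 = ?M" by simp
  show ?thesis
  proof (cases "e < 0")
    case False
    then show ?thesis
      unfolding Yplus_elt_def lookup_minus lookup_sum 1 2
      unfolding kd_even_degree of_nat_id sum_single_collapse by simp
  next
    case True
    define n where "n = nat (- e - 1)"
    have e: "e = - int n - 1" using True by (simp add: n_def)
    have n: "nat (e + int N + 1) = N - n" "(- int N - 1 \<le> e \<and> e < 0) = (n \<le> N)" for N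
      unfolding e by linarith+
    have "e < 0" using True .
    then show ?thesis
      unfolding Yplus_elt_def lookup_minus lookup_sum 1 2
      unfolding 3 unfolding kd_even_degree of_nat_id sum_single_collapse n contraction_coeff_def c n_def[symmetric]
      by (simp add: mult.assoc)
  qed
qed

lemma mmul_zero [simp]: "mmul k 0 v = 0" "mmul k u 0 = 0"
  by (simp_all add: mmul_def fun_eq_iff)

lemma mmul_add: "mmul k (u + u') v = mmul k u v + mmul k u' v" "mmul k u (v + v') = mmul k u v + mmul k u v'"
  by (simp_all add: mmul_def fun_eq_iff algebra_simps sum.distrib)

lemma mmul_scale: "mmul k (\<lambda>p q. c * u p q) v = (\<lambda>p q. c * mmul k u v p q)"
   "mmul k u (\<lambda>p q. c * v p q) = (\<lambda>p q. c * mmul k u v p q)"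
  by (simp_all add: mmul_def fun_eq_iff sum_distrib_left algebra_simps)

definition Y_coeff :: "nat \<Rightarrow> (bit \<times> bit \<times> nat \<times> nat) \<Rightarrow> 'a::field_char_0 mtx \<Rightarrow>
    (bit \<times> bit \<times> nat \<times> nat) \<Rightarrow> 'a mtx \<Rightarrow> int \<Rightarrow> 'a RA" where
  "Y_coeff k x u y v e = (case x of (i1, i2, m1, m2) \<Rightarrow> case y of (j1, j2, n1, n2) \<Rightarrow>
     lookup (Yplus_elt k u i1 i2 m1 m2 v j1 j2 n1 n2) e)"

lemma Y_coeff_zero [simp]: "Y_coeff k x 0 y v e = 0" "Y_coeff k x u y 0 e = 0"
  by (auto simp: Y_coeff_def lookup_Yplus_elt split: prod.splits)

lemma Y_coeff_add: "Y_coeff k x (u + u') y v e = Y_coeff k x u y v e + Y_coeff k x u' y v e"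
  "Y_coeff k x u y (v + v') e = Y_coeff k x u y v e + Y_coeff k x u y v' e"
  by (auto simp: Y_coeff_def lookup_Yplus_elt mmul_add elt_add RA.scale_right_distrib split: prod.splits)

lemma Y_coeff_scale: "Y_coeff k x (\<lambda>p q. c * u p q) y v e = smul c (Y_coeff k x u y v e)"
  "Y_coeff k x u y (\<lambda>p q. c * v p q) e = smul c (Y_coeff k x u y v e)"
  by (auto simp: Y_coeff_def lookup_Yplus_elt mmul_scale smul_single[symmetric] RA.scale_right_diff_distrib
     mult.commute mult.left_commute split: prod.splits)

lemma lookup_Yplus: "lookup (Yplus k f g) e =
    (\<Sum>x\<in>keys f. \<Sum>y\<in>keys g. Y_coeff k x (lookup f x) y (lookup g y) e)"
  by (simp add: Yplus_def lookup_sum Y_coeff_def split_def)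

text \<open>Sums and scalar multiples change the set of keys. Linearity becomes termwise once all
  sums run over one common finite set, which is allowed because \<open>Y_coeff\<close> vanishes at
  the zero matrix.\<close>

lemma lookup_Yplus_superset:
  assumes "finite A" "keys f \<subseteq> A" "finite B" "keys g \<subseteq> B"
  shows "lookup (Yplus k f g) e = (\<Sum>x\<in>A. \<Sum>y\<in>B. Y_coeff k x (lookup f x) y (lookup g y) e)"
proof -
  have "(\<Sum>y\<in>keys g. Y_coeff k x (lookup f x) y (lookup g y) e) =
     (\<Sum>y\<in>B. Y_coeff k x (lookup f x) y (lookup g y) e)" for x
    by (rule sum_keys_superset[OF assms(3,4), where h = "\<lambda>y v. Y_coeff k x (lookup f x) y v e"]) simp
  moreover have "(\<Sum>x\<in>keys f. \<Sum>y\<in>B. Y_coeff k x (lookup f x) y (lookup g y) e) =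
     (\<Sum>x\<in>A. \<Sum>y\<in>B. Y_coeff k x (lookup f x) y (lookup g y) e)"
    by (rule sum_keys_superset[OF assms(1,2), where h = "\<lambda>x u. \<Sum>y\<in>B. Y_coeff k x u y (lookup g y) e"]) simp
  ultimately show ?thesis by (simp add: lookup_Yplus)
qed

lemma Yplus_add_left: "Yplus k (f + f') g = Yplus k f g + Yplus k f' g"
proof (rule poly_mapping_eqI)
  fix e
  show "lookup (Yplus k (f + f') g) e = lookup (Yplus k f g + Yplus k f' g) e"
    unfolding lookup_add
    by (subst (1 2 3) lookup_Yplus_superset[where A = "keys f \<union> keys f'" and B = "keys g"])
      (use keys_add[of f f'] in \<open>auto simp: lookup_add Y_coeff_add sum.distrib\<close>)
qed

lemma Yplus_add_right: "Yplus k f (g + g') = Yplus k f g + Yplus k f g'"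
proof (rule poly_mapping_eqI)
  fix e
  show "lookup (Yplus k f (g + g')) e = lookup (Yplus k f g + Yplus k f g') e"
    unfolding lookup_add
    by (subst (1 2 3) lookup_Yplus_superset[where A = "keys f" and B = "keys g \<union> keys g'"])
      (use keys_add[of g g'] in \<open>auto simp: lookup_add Y_coeff_add sum.distrib\<close>)
qed

lemma keys_smul: "keys (smul c f) \<subseteq> keys f"
  by (auto simp: in_keys_iff lookup_smul fun_eq_iff)

lemma lookup_Yplus_smul_left: "lookup (Yplus k (smul c f) g) e = smul c (lookup (Yplus k f g) e)"
  by (subst (1 2) lookup_Yplus_superset[where A = "keys f" and B = "keys g"])
    (use keys_smul[of c f] in \<open>auto simp: lookup_smul Y_coeff_scale RA.scale_sum_right\<close>)

lemma lookup_Yplus_smul_right: "lookup (Yplus k f (smul c g)) e = smul c (lookup (Yplus k f g) e)"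
  by (subst (1 2) lookup_Yplus_superset[where A = "keys f" and B = "keys g"])
    (use keys_smul[of c g] in \<open>auto simp: lookup_smul Y_coeff_scale RA.scale_sum_right\<close>)

lemma Yplus_zero [simp]: "Yplus k 0 g = 0" "Yplus k f 0 = 0"
  by (simp_all add: Yplus_def)

lemma lookup_Yplus_polar: "e \<ge> 0 \<Longrightarrow> lookup (Yplus k f g) e = 0"
  by (auto simp: lookup_Yplus Y_coeff_def lookup_Yplus_elt intro!: sum.neutral split: prod.splits)

lemma Yplus_elt_elt:
  "lookup (Yplus k (elt u i1 i2 m1 m2) (elt v j1 j2 n1 n2)) e =
     lookup (Yplus_elt k u i1 i2 m1 m2 v j1 j2 n1 n2) e"
  by (subst lookup_Yplus_superset[where A = "{(i1, i2, m1, m2)}" and B = "{(j1, j2, n1, n2)}"])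
    (auto simp: elt_def Y_coeff_def)

abbreviation "nY k \<equiv> nprod (Yplus k)"

lemma nY_add_left: "nY k (f + f') n g = nY k f n g + nY k f' n g"
  and nY_add_right: "nY k f n (g + g') = nY k f n g + nY k f n g'"
  and nY_smul_left: "nY k (smul c f) n g = smul c (nY k f n g)"
  and nY_smul_right: "nY k f n (smul c g) = smul c (nY k f n g)"
  and nY_zero [simp]: "nY k 0 n g = 0" "nY k f n 0 = 0"
  by (simp_all add: nprod_def Yplus_add_left Yplus_add_right lookup_add
     lookup_Yplus_smul_left lookup_Yplus_smul_right)

lemma nY_elt: "nY k (elt u i1 i2 m1 m2) n (elt v j1 j2 n1 n2) =
   smul (kd i2 j1 * contraction_coeff (even_degree i2) m1 m2 n1 n)
        (elt (mmul k u v) i1 j2 (m1 + m2 + n1 + even_degree i2 - n) n2)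
    - smul (koszul (i1 + i2) (j1 + j2) * kd i1 j2 * (- 1) ^ even_degree i1 * contraction_coeff (even_degree i1) m2 m1 n2 n)
        (elt (mmul k v u) j1 i2 n1 (m1 + m2 + n2 + even_degree i1 - n))"
  by (simp add: nprod_def Yplus_elt_elt lookup_Yplus_elt)

definition der_term :: "(bit \<times> bit \<times> nat \<times> nat) \<Rightarrow> 'a::field_char_0 mtx \<Rightarrow> 'a RA" where
  "der_term x u = (case x of (i, j, m, n) \<Rightarrow>
     smul (of_nat (m + 1)) (elt u i j (m + 1) n) + smul (of_nat (n + 1)) (elt u i j m (n + 1)))"

lemma der_eq: "der f = (\<Sum>x\<in>keys f. der_term x (lookup f x))"
  by (simp add: der_def der_term_def Let_def split_def)

lemma der_term_zero [simp]: "der_term x 0 = 0"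
  by (simp add: der_term_def split: prod.splits)

lemma der_term_add: "der_term x (u + v) = der_term x u + der_term x v"
  by (simp add: der_term_def elt_add RA.scale_right_distrib split: prod.splits)

lemma der_term_scale: "der_term x (\<lambda>p q. c * u p q) = smul c (der_term x u)"
  by (simp add: der_term_def smul_single[symmetric] RA.scale_right_distrib mult.commute split: prod.splits)

lemma der_add: "der (f + g) = der f + der g"
  unfolding der_eq by (rule sum_keys_add, rule der_term_zero, rule der_term_add)

lemma der_zero [simp]: "der 0 = 0" by (simp add: der_def)

lemma der_smul: "der (smul c f) = smul c (der f)"
  unfolding der_eq
  by (subst sum_keys_superset[where A = "keys f"])
    (use keys_smul[of c f] in \<open>auto simp: lookup_smul der_term_scale RA.scale_sum_right\<close>)

lemma der_elt: "der (elt u i j m n) =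
    smul (of_nat (m + 1)) (elt u i j (m + 1) n) + smul (of_nat (n + 1)) (elt u i j m (n + 1))"
  unfolding der_eq
  by (subst sum_keys_superset[where A = "{(i, j, m, n)}"]) (auto simp: elt_def der_term_def)

section \<open>The symmetrised generators\<close>

lemma mmul_E:
  assumes "q \<in> {1..k}"
  shows "mmul k (E p q) (E r s) = (if q = r then E p s else (0 :: 'a::comm_ring_1 mtx))"
proof (intro ext)
  fix x y
  have "mmul k (E p q) (E r s) x y = (\<Sum>t = 1..k. if t = q then of_bool (x = p \<and> q = r \<and> y = s) else 0)"
    unfolding mmul_def E_def by (rule sum.cong) auto
  also have "\<dots> = of_bool (x = p \<and> q = r \<and> y = s)" using assms by simp
  finally show "mmul k (E p q) (E r s) x y = (if q = r then E p s else 0) x y"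
    by (auto simp: E_def)
qed

lemma koszul_bit: "koszul i j = (if i = 1 \<and> j = 1 then - 1 else 1)"
  by (cases i; cases j) (auto simp: koszul_def)

lemma bit_add_cases: "(i::bit) + j = (if i = j then 0 else 1)"
  by (cases i; cases j) auto

text \<open>\<open>F\<close> only fixes the type of scalars.\<close>

locale orthosymplectic =
  fixes l1 l2 :: nat and F :: "'a::field_char_0 itself"
  assumes l1_pos: "l1 > 0" and l2_pos: "l2 > 0"
begin

abbreviation K where "K \<equiv> 2 * l1 + 2 * l2"

definition block :: "nat \<Rightarrow> bit" where "block p = (if p \<le> 2 * l1 then 0 else 1)"

definition dual :: "nat \<Rightarrow> nat" where
  "dual p = (if p \<le> l1 then l1 + p else if p \<le> 2 * l1 then p - l1
     else if p \<le> 2 * l1 + l2 then l2 + p else p - l2)"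

definition eps :: "nat \<Rightarrow> 'a" where
  "eps p = (if p \<le> l1 \<or> 2 * l1 < p \<and> p \<le> 2 * l1 + l2 then 1 else - 1)"

text \<open>The signs in the generators of \<open>R\<^sup>\<dagger>\<close>: \<open>eps\<close> is \<open>-1\<close> on the upper half of each block, and one further
  sign appears when both indices lie in the second block.\<close>

definition sigma :: "nat \<Rightarrow> nat \<Rightarrow> 'a" where
  "sigma p q = koszul (block p) (block q) * eps p * eps q"

abbreviation block_degree :: "nat \<Rightarrow> nat" where "block_degree p \<equiv> even_degree (block p)"

definition unit_elt :: "nat \<Rightarrow> nat \<Rightarrow> nat \<Rightarrow> nat \<Rightarrow> 'a RA" where
  "unit_elt p q m n = elt (E p q) (block p) (block q) m n"

text \<open>Sending \<open>unit_elt p q m n\<close> to \<open>sigma p q\<close> times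
  \<open>unit_elt (dual q) (dual p) n m\<close> is an involution, and \<open>T\<close> is a unit
  plus its image. As 2 is invertible, R^dagger is the space of fixed points, and all ten families of
  generators take this one form.\<close>

definition T :: "nat \<Rightarrow> nat \<Rightarrow> nat \<Rightarrow> nat \<Rightarrow> 'a RA" where
  "T p q m n = unit_elt p q m n + smul (sigma p q) (unit_elt (dual q) (dual p) n m)"

lemma dual_in [simp]: "p \<in> {1..K} \<Longrightarrow> dual p \<in> {1..K}"
  by (auto simp: dual_def)

lemma dual_dual [simp]: "p \<in> {1..K} \<Longrightarrow> dual (dual p) = p"
  by (auto simp: dual_def)

lemma dual_neq: "p \<in> {1..K} \<Longrightarrow> dual p \<noteq> p"
  using l1_pos l2_pos by (auto simp: dual_def)

lemma dual_eq_iff: "p \<in> {1..K} \<Longrightarrow> q \<in> {1..K} \<Longrightarrow> dual p = q \<longleftrightarrow> p = dual q"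
  by auto

lemma dual_inj: "p \<in> {1..K} \<Longrightarrow> q \<in> {1..K} \<Longrightarrow> dual p = dual q \<longleftrightarrow> p = q"
  by (metis dual_dual)

lemma block_dual [simp]: "p \<in> {1..K} \<Longrightarrow> block (dual p) = block p"
  by (auto simp: dual_def block_def)

lemma eps_dual [simp]: "p \<in> {1..K} \<Longrightarrow> eps (dual p) = - eps p"
  by (auto simp: dual_def eps_def)

lemma eps_eps [simp]: "eps p * eps p = 1" "eps p * (eps p * x) = x"
  by (auto simp: eps_def)

lemma sigma_sigma: "sigma p q * sigma p q = 1"
  by (auto simp: sigma_def koszul_def eps_def)

lemma sigma_dual: "p \<in> {1..K} \<Longrightarrow> q \<in> {1..K} \<Longrightarrow> sigma (dual q) (dual p) = sigma p q"
  by (auto simp: sigma_def koszul_bit)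

lemma T_sym:
  assumes "p \<in> {1..K}" "q \<in> {1..K}"
  shows "T (dual q) (dual p) n m = smul (sigma p q) (T p q m n)"
  using assms by (simp add: T_def sigma_dual RA.scale_right_distrib sigma_sigma)

lemma nY_unit_elt:
  assumes "p \<in> {1..K}" "q \<in> {1..K}" "r \<in> {1..K}" "s \<in> {1..K}"
  shows "nY K (unit_elt p q m1 m2) n (unit_elt r s n1 n2) =
     (if q = r then smul (contraction_coeff (block_degree q) m1 m2 n1 n) (unit_elt p s (m1 + m2 + n1 + block_degree q - n) n2) else 0)
   - (if p = s then smul (koszul (block p + block q) (block r + block s) * (- 1) ^ block_degree p * contraction_coeff (block_degree p) m2 m1 n2 n)
         (unit_elt r q n1 (m1 + m2 + n2 + block_degree p - n)) else 0)"
  using assms unfolding unit_elt_def nY_elt by (simp add: mmul_E)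

lemma nY_T:
  \<comment> \<open>By bilinearity there are four products of units with two terms each. The
    involution exchanges a direct term of one product with a commuted term of another, for instance
    (p, s) with (dual s, dual p), and the eight terms combine to four elements
    \<open>T\<close>.\<close>
  assumes I: "p \<in> {1..K}" "q \<in> {1..K}" "r \<in> {1..K}" "s \<in> {1..K}"
  shows "nY K (T p q m1 m2) n (T r s n1 n2 :: 'a RA) =
     (if q = r then smul (contraction_coeff (block_degree q) m1 m2 n1 n) (T p s (m1 + m2 + n1 + block_degree q - n) n2) else 0)
   + (if q = dual s then smul (sigma r s * contraction_coeff (block_degree q) m1 m2 n2 n) (T p (dual r) (m1 + m2 + n2 + block_degree q - n) n1) else 0)
   + (if dual p = r then smul (sigma p q * contraction_coeff (block_degree p) m2 m1 n1 n) (T (dual q) s (m1 + m2 + n1 + block_degree p - n) n2) else 0)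
   + (if p = s then smul (sigma p q * sigma r s * contraction_coeff (block_degree p) m2 m1 n2 n)
        (T (dual q) (dual r) (m1 + m2 + n2 + block_degree p - n) n1) else 0)"
proof -
  let ?k = "koszul (block p + block q) (block r + block s) :: 'a"
  have k: "?k = koszul (block q + block p) (block r + block s)" "?k = koszul (block p + block q) (block s + block r)"
    "?k = koszul (block q + block p) (block s + block r)"
    by (metis add.commute)+
  \<comment> \<open>Each of \<open>s1\<close> to \<open>s4\<close> says that the two terms to be
    combined carry the relative sign required by \<open>T\<close>. The contracted legs lie in one
    block, so all signs depend on three blocks only.\<close>
  have s1: "q = r \<longrightarrow> sigma p s = - (sigma p q * sigma r s * (?k * (- 1) ^ block_degree q))"
    using I by (auto simp: sigma_def bit_add_cases koszul_bit even_degree_def)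
  have s2: "q = dual s \<longrightarrow> sigma r s * sigma p (dual r) = - (sigma p q * (?k * (- 1) ^ block_degree q))"
    using I by (auto simp: sigma_def bit_add_cases koszul_bit even_degree_def)
  have s3: "dual p = r \<longrightarrow> sigma p q * sigma (dual q) s = - (sigma r s * (?k * (- 1) ^ block_degree p))"
    using I by (auto simp: sigma_def bit_add_cases koszul_bit even_degree_def)
  have s4: "p = s \<longrightarrow> sigma p q * sigma r s * sigma (dual q) (dual r) = - (?k * (- 1) ^ block_degree p)"
    using I by (auto simp: sigma_def bit_add_cases koszul_bit even_degree_def mult_ac)
  have main: "(if P then smul (c * a) (T x y i j) else 0) =
      smul c (if P then smul a (unit_elt x y i j) else 0) - smul c'' (if P then smul (b * a) (unit_elt (dual y) (dual x) j i) else 0)"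
    if "P \<longrightarrow> c * sigma x y = - (c'' * b)" for a b c c'' :: 'a and P x y i j
  proof (cases P)
    case True
    have "c * a * sigma x y = - (c'' * (b * a))" using that True
      by (metis mult.assoc mult.commute mult_minus_left)
    then show ?thesis using True by (simp add: T_def RA.scale_right_distrib)
  qed simp
  note 1 = main[of "q = r" 1 p s "sigma p q * sigma r s" "?k * (- 1) ^ block_degree q", unfolded mult_1, OF s1]
  note 2 = main[of "q = dual s" "sigma r s" p "dual r" "sigma p q" "?k * (- 1) ^ block_degree q", OF s2]
  note 3 = main[of "dual p = r" "sigma p q" "dual q" s "sigma r s" "?k * (- 1) ^ block_degree p", OF s3]
  note 4 = main[of "p = s" "sigma p q * sigma r s" "dual q" "dual r" 1 "?k * (- 1) ^ block_degree p", unfolded mult_1, OF s4]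
  note ne = nY_unit_elt[OF I] nY_unit_elt[OF I(1,2) dual_in[OF I(4)] dual_in[OF I(3)]]
    nY_unit_elt[OF dual_in[OF I(2)] dual_in[OF I(1)] I(3,4)]
    nY_unit_elt[OF dual_in[OF I(2)] dual_in[OF I(1)] dual_in[OF I(4)] dual_in[OF I(3)]]
  have c: "dual q = dual r \<longleftrightarrow> q = r" "dual p = dual s \<longleftrightarrow> p = s" "p = dual r \<longleftrightarrow> dual p = r"
    "dual q = s \<longleftrightarrow> q = dual s"
    using I by (auto simp: dual_inj)
  have ac: "m2 + m1 + n + d = m1 + m2 + n + d" for n d by simp
  have "nY K (T p q m1 m2) n (T r s n1 n2 :: 'a RA) =
     nY K (unit_elt p q m1 m2) n (unit_elt r s n1 n2)
     + smul (sigma r s) (nY K (unit_elt p q m1 m2) n (unit_elt (dual s) (dual r) n2 n1))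
     + smul (sigma p q) (nY K (unit_elt (dual q) (dual p) m2 m1) n (unit_elt r s n1 n2))
     + smul (sigma p q * sigma r s) (nY K (unit_elt (dual q) (dual p) m2 m1) n (unit_elt (dual s) (dual r) n2 n1))"
    unfolding T_def[of p q] T_def[of r s]
    by (simp only: nY_add_left nY_add_right nY_smul_left nY_smul_right RA.scale_scale RA.scale_right_distrib add_ac
        mult.commute[of "sigma r s" "sigma p q"])
  also have "\<dots> = (if q = r then smul (contraction_coeff (block_degree q) m1 m2 n1 n) (T p s (m1 + m2 + n1 + block_degree q - n) n2) else 0)
   + (if q = dual s then smul (sigma r s * contraction_coeff (block_degree q) m1 m2 n2 n) (T p (dual r) (m1 + m2 + n2 + block_degree q - n) n1) else 0)
   + (if dual p = r then smul (sigma p q * contraction_coeff (block_degree p) m2 m1 n1 n) (T (dual q) s (m1 + m2 + n1 + block_degree p - n) n2) else 0)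
   + (if p = s then smul (sigma p q * sigma r s * contraction_coeff (block_degree p) m2 m1 n2 n)
        (T (dual q) (dual r) (m1 + m2 + n2 + block_degree p - n) n1) else 0)"
    unfolding 1 2 3 4 ne block_dual[OF I(1)] block_dual[OF I(2)] block_dual[OF I(3)] block_dual[OF I(4)] k[symmetric]
      dual_dual[OF I(1)] dual_dual[OF I(2)] dual_dual[OF I(3)] dual_dual[OF I(4)] c ac
      RA.scale_right_diff_distrib
    by (simp only: RA.scale_one algebra_simps)
  finally show ?thesis .
qed

definition Tset :: "bit \<Rightarrow> 'a RA set" where
  "Tset i = {T p q m n | p q m n. p \<in> {1..K} \<and> q \<in> {1..K} \<and> block p + block q = i}"

lemma T_in_Tset: "p \<in> {1..K} \<Longrightarrow> q \<in> {1..K} \<Longrightarrow> block p + block q = i \<Longrightarrow> T p q m n \<in> Tset i"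
  unfolding Tset_def by blast

lemma T_span_sym:
  assumes "p \<in> {1..K}" "q \<in> {1..K}" "T (dual q) (dual p) n m \<in> RA.span S"
  shows "T p q m n \<in> RA.span S"
proof -
  have "T p q m n = smul (sigma (dual q) (dual p)) (T (dual q) (dual p) n m)"
    using T_sym[OF dual_in[OF assms(2)] dual_in[OF assms(1)], of m n]
    by (simp only: dual_dual[OF assms(1)] dual_dual[OF assms(2)])
  then show ?thesis using RA.span_scale assms(3) by metis
qed

lemma block_cases:
  assumes "p \<in> {1..K}"
  obtains (a) a where "a \<in> {1..l1}" "p = a" "block p = 0"
  | (b) a where "a \<in> {1..l1}" "p = l1 + a" "block p = 0"
  | (c) a where "a \<in> {1..l2}" "p = 2 * l1 + a" "block p = 1"
  | (d) a where "a \<in> {1..l2}" "p = 2 * l1 + l2 + a" "block p = 1"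
proof -
  consider "p \<le> l1" | "l1 < p \<and> p \<le> 2 * l1" | "2 * l1 < p \<and> p \<le> 2 * l1 + l2" | "2 * l1 + l2 < p"
    by linarith
  then show thesis
  proof cases
    case 1
    then show ?thesis using assms by (intro a[of p]) (auto simp: block_def)
  next
    case 2
    then show ?thesis using assms by (intro b[of "p - l1"]) (auto simp: block_def)
  next
    case 3
    then show ?thesis using assms by (intro c[of "p - 2 * l1"]) (auto simp: block_def)
  next
    case 4
    then show ?thesis using assms by (intro d[of "p - 2 * l1 - l2"]) (auto simp: block_def)
  qed
qed

lemma block0_cases:
  assumes "p \<in> {1..K}" "block p = 0"
  obtains a where "a \<in> {1..l1}" "p = a" | a where "a \<in> {1..l1}" "p = l1 + a"
  using assms(2) by (cases rule: block_cases[OF assms(1)]) auto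

lemma block1_cases:
  assumes "p \<in> {1..K}" "block p = 1"
  obtains a where "a \<in> {1..l2}" "p = 2 * l1 + a" | a where "a \<in> {1..l2}" "p = 2 * l1 + l2 + a"
  using assms(2) by (cases rule: block_cases[OF assms(1)]) auto

lemma index_values:
  "a \<in> {1..l1} \<Longrightarrow> a \<in> {1..K}" "a \<in> {1..l1} \<Longrightarrow> l1 + a \<in> {1..K}"
  "a \<in> {1..l2} \<Longrightarrow> 2 * l1 + a \<in> {1..K}" "a \<in> {1..l2} \<Longrightarrow> 2 * l1 + l2 + a \<in> {1..K}"
  by auto

lemma eps_values [simp]:
  "a \<in> {1..l1} \<Longrightarrow> eps a = 1" "a \<in> {1..l1} \<Longrightarrow> eps (l1 + a) = - 1"
  "a \<in> {1..l2} \<Longrightarrow> eps (2 * l1 + a) = 1" "a \<in> {1..l2} \<Longrightarrow> eps (2 * l1 + l2 + a) = - 1"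
  using l1_pos l2_pos by (auto simp: eps_def)

lemma block_values [simp]:
  "a \<in> {1..l1} \<Longrightarrow> block a = 0" "a \<in> {1..l1} \<Longrightarrow> block (l1 + a) = 0"
  "a \<in> {1..l2} \<Longrightarrow> block (2 * l1 + a) = 1" "a \<in> {1..l2} \<Longrightarrow> block (2 * l1 + l2 + a) = 1"
  using l1_pos l2_pos by (auto simp: block_def)

lemma dual_values [simp]:
  "a \<in> {1..l1} \<Longrightarrow> dual a = l1 + a" "a \<in> {1..l1} \<Longrightarrow> dual (l1 + a) = a"
  "a \<in> {1..l2} \<Longrightarrow> dual (2 * l1 + a) = 2 * l1 + l2 + a" "a \<in> {1..l2} \<Longrightarrow> dual (2 * l1 + l2 + a) = 2 * l1 + a"
  using l1_pos l2_pos by (auto simp: dual_def)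

lemma Collect_pair_cong:
  assumes "\<And>a b. a \<in> A \<Longrightarrow> b \<in> B \<Longrightarrow> f a b = g a b"
  shows "{f a b | a b. a \<in> A \<and> b \<in> B} = {g a b | a b. a \<in> A \<and> b \<in> B}"
  using assms by (intro Collect_cong) metis

lemma even_gens_T: "even_gens l1 l2 m n =
     {T a b m n | a b. a \<in> {1..l1} \<and> b \<in> {1..l1}}
   \<union> {T a (l1 + b) m n | a b. a \<in> {1..l1} \<and> b \<in> {1..l1}}
   \<union> {T (l1 + a) b m n | a b. a \<in> {1..l1} \<and> b \<in> {1..l1}}
   \<union> {T (2 * l1 + a) (2 * l1 + b) m n | a b. a \<in> {1..l2} \<and> b \<in> {1..l2}}
   \<union> {T (2 * l1 + a) (2 * l1 + l2 + b) m n | a b. a \<in> {1..l2} \<and> b \<in> {1..l2}}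
   \<union> {T (2 * l1 + l2 + a) (2 * l1 + b) m n | a b. a \<in> {1..l2} \<and> b \<in> {1..l2}}"
  unfolding even_gens_def Let_def
  by (intro arg_cong2[where f = "(\<union>)"] Collect_pair_cong) (simp_all add: T_def unit_elt_def sigma_def koszul_bit)

lemma odd_gens_T: "odd_gens l1 l2 m n =
     {T a (2 * l1 + b) m n | a b. a \<in> {1..l1} \<and> b \<in> {1..l2}}
   \<union> {T a (2 * l1 + l2 + b) m n | a b. a \<in> {1..l1} \<and> b \<in> {1..l2}}
   \<union> {T (l1 + a) (2 * l1 + b) m n | a b. a \<in> {1..l1} \<and> b \<in> {1..l2}}
   \<union> {T (l1 + a) (2 * l1 + l2 + b) m n | a b. a \<in> {1..l1} \<and> b \<in> {1..l2}}"
  unfolding odd_gens_def Let_def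
  by (intro arg_cong2[where f = "(\<union>)"] Collect_pair_cong) (simp_all add: T_def unit_elt_def sigma_def koszul_bit)

lemma odd_gens_T': "odd_gens l1 l2 m n = {T p q m n | p q. p \<in> {1..K} \<and> q \<in> {1..K} \<and> block p = 0 \<and> block q = 1}"
  (is "_ = ?R")
proof
  have R: "T p q m n \<in> ?R" if "p \<in> {1..K}" "q \<in> {1..K}" "block p = 0" "block q = 1" for p q
    using that by blast
  show "odd_gens l1 l2 m n \<subseteq> ?R"
    unfolding odd_gens_T by (intro Un_least subsetI; elim CollectE exE conjE; hypsubst; rule R; (rule index_values block_values; assumption))
  show "?R \<subseteq> odd_gens l1 l2 m n"
  proof
    fix x assume "x \<in> ?R"
    then obtain p q where x: "x = T p q m n" and p: "p \<in> {1..K}" "block p = 0" and q: "q \<in> {1..K}" "block q = 1"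
      by blast
    show "x \<in> odd_gens l1 l2 m n"
      unfolding odd_gens_T x
      by (cases rule: block0_cases[OF p]; cases rule: block1_cases[OF q]; simp only:; blast)
  qed
qed

lemma odd_gensI: "p \<in> {1..K} \<Longrightarrow> q \<in> {1..K} \<Longrightarrow> block p = 0 \<Longrightarrow> block q = 1 \<Longrightarrow> T p q m n \<in> odd_gens l1 l2 m n"
  unfolding odd_gens_T' by blast

lemma even_gens_Tset: "even_gens l1 l2 m n \<subseteq> Tset 0"
proof -
  have R0: "T p q m n \<in> Tset 0" if "p \<in> {1..K}" "q \<in> {1..K}" "block p = 0" "block q = 0" for p q
    using that by (intro T_in_Tset) simp_all
  have R1: "T p q m n \<in> Tset 0" if "p \<in> {1..K}" "q \<in> {1..K}" "block p = 1" "block q = 1" for p q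
    using that by (intro T_in_Tset) simp_all
  note v = index_values block_values
  show ?thesis
    unfolding even_gens_T
    by (intro Un_least subsetI; elim CollectE exE conjE; hypsubst;
        (rule R0; (rule v; assumption) | rule R1; (rule v; assumption)))
qed

lemma even_gensI:
  "a \<in> {1..l1} \<Longrightarrow> b \<in> {1..l1} \<Longrightarrow> T a b m n \<in> even_gens l1 l2 m n"
  "a \<in> {1..l1} \<Longrightarrow> b \<in> {1..l1} \<Longrightarrow> T a (l1 + b) m n \<in> even_gens l1 l2 m n"
  "a \<in> {1..l1} \<Longrightarrow> b \<in> {1..l1} \<Longrightarrow> T (l1 + a) b m n \<in> even_gens l1 l2 m n"
  "a \<in> {1..l2} \<Longrightarrow> b \<in> {1..l2} \<Longrightarrow> T (2 * l1 + a) (2 * l1 + b) m n \<in> even_gens l1 l2 m n"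
  "a \<in> {1..l2} \<Longrightarrow> b \<in> {1..l2} \<Longrightarrow> T (2 * l1 + a) (2 * l1 + l2 + b) m n \<in> even_gens l1 l2 m n"
  "a \<in> {1..l2} \<Longrightarrow> b \<in> {1..l2} \<Longrightarrow> T (2 * l1 + l2 + a) (2 * l1 + b) m n \<in> even_gens l1 l2 m n"
  unfolding even_gens_T by blast+

text \<open>The list of generators covers three of the four quadrants of each block. The symmetry of
  \<open>T\<close> carries the missing one, with both indices in the upper half, to the
  first.\<close>

lemma even_T_gens:
  assumes p: "p \<in> {1..K}" and q: "q \<in> {1..K}" and b: "block p = block q"
  shows "(T p q m n :: 'a RA) \<in> RA.span (\<Union>m n. even_gens l1 l2 m n)"
proof -
  have B: "T p q m n \<in> RA.span (\<Union>m n. even_gens l1 l2 m n)"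
    if "(T p q m n :: 'a RA) \<in> even_gens l1 l2 m n" for p q m n
    by (rule RA.span_base, rule UN_I[of m], rule UNIV_I, rule UN_I[of n], rule UNIV_I, rule that)
  have "(T p q m n :: 'a RA) \<in> even_gens l1 l2 m n \<or> (T (dual q) (dual p) n m :: 'a RA) \<in> even_gens l1 l2 n m"
  proof (cases "block p = 0")
    case True
    then have "block q = 0" using b by simp
    show ?thesis
      by (cases rule: block0_cases[OF p True]; cases rule: block0_cases[OF q \<open>block q = 0\<close>];
          hypsubst; simp only: dual_values even_gensI simp_thms)
  next
    case False
    then have *: "block p = 1" "block q = 1" using b by simp_all
    show ?thesis
      by (cases rule: block1_cases[OF p *(1)]; cases rule: block1_cases[OF q *(2)];
          hypsubst; simp only: dual_values even_gensI simp_thms)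
  qed
  then show ?thesis
  proof
    assume "T p q m n \<in> even_gens l1 l2 m n"
    then show ?thesis by (rule B)
  next
    assume "T (dual q) (dual p) n m \<in> even_gens l1 l2 n m"
    then show ?thesis by (intro T_span_sym[OF p q] B)
  qed
qed

lemma Rdagger_eq: "Rdagger l1 l2 i = RA.span (Tset i)"
proof (cases "i = 0")
  case True
  have "(Tset 0 :: 'a RA set) \<subseteq> RA.span (\<Union>m n. even_gens l1 l2 m n)"
  proof
    fix x :: "'a RA" assume "x \<in> Tset 0"
    then obtain p q m n where x: "x = T p q m n" and I: "p \<in> {1..K}" "q \<in> {1..K}" and b: "block p + block q = 0"
      unfolding Tset_def by blast
    have "block p = block q" using b by (simp only: bit_add_cases split: if_splits) simp
    then show "x \<in> RA.span (\<Union>m n. even_gens l1 l2 m n)"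
      unfolding x by (rule even_T_gens[OF I])
  qed
  moreover have "(\<Union>m n. even_gens l1 l2 m n) \<subseteq> (RA.span (Tset 0) :: 'a RA set)"
    by (intro UN_least subset_trans[OF even_gens_Tset RA.span_superset])
  ultimately have "(RA.span (Tset 0) :: 'a RA set) = RA.span (\<Union>m n. even_gens l1 l2 m n)"
    by (simp add: RA.span_eq)
  then show ?thesis using True by (simp add: Rdagger_def)
next
  case False
  then have i: "i = 1" by simp
  have "odd_gens l1 l2 m n \<subseteq> (Tset 1 :: 'a RA set)" for m n
    unfolding odd_gens_T'
    by (intro subsetI; elim CollectE exE conjE; hypsubst; rule T_in_Tset) simp_all
  then have "(\<Union>m n. odd_gens l1 l2 m n) \<subseteq> (Tset 1 :: 'a RA set)" by (intro UN_least)
  note sub1 = subset_trans[OF this RA.span_superset]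
  have B: "T p q m n \<in> RA.span (\<Union>m n. odd_gens l1 l2 m n)"
    if "(T p q m n :: 'a RA) \<in> odd_gens l1 l2 m n" for p q m n
    by (rule RA.span_base, rule UN_I[of m], rule UNIV_I, rule UN_I[of n], rule UNIV_I, rule that)
  have "(T p q m n :: 'a RA) \<in> RA.span (\<Union>m n. odd_gens l1 l2 m n)"
    if p: "p \<in> {1..K}" and q: "q \<in> {1..K}" and b: "block p + block q = 1" for p q m n
  proof (cases "block p = 0")
    case True
    then have "block q = 1" using b by (auto simp: bit_add_cases split: if_splits)
    then have "(T p q m n :: 'a RA) \<in> odd_gens l1 l2 m n" using p q True by (intro odd_gensI)
    then show ?thesis by (rule B)
  next
    case False
    then have *: "block p = 1" "block q = 0" using b by (auto simp: bit_add_cases split: if_splits)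
    have "(T (dual q) (dual p) n m :: 'a RA) \<in> odd_gens l1 l2 n m"
      using * by (intro odd_gensI dual_in[OF p] dual_in[OF q]) (simp_all only: block_dual[OF p] block_dual[OF q])
    then show ?thesis by (intro T_span_sym[OF p q] B)
  qed
  then have "(Tset 1 :: 'a RA set) \<subseteq> RA.span (\<Union>m n. odd_gens l1 l2 m n)" unfolding Tset_def by blast
  with sub1 have "(RA.span (Tset 1) :: 'a RA set) = RA.span (\<Union>m n. odd_gens l1 l2 m n)"
    by (simp add: RA.span_eq)
  then show ?thesis using i by (simp add: Rdagger_def)
qed

end

section \<open>The lambda-bracket as a substitution of polynomial functions\<close>

text \<open>The scalars form an infinite field, so equality of polynomial functions is equality of
  polynomials. All comparisons of coefficients below go through this.\<close>

lemma exp_coeff_eq: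
  fixes a b :: "nat \<Rightarrow> 'a::field_char_0"
  assumes "\<And>t. (\<Sum>n<B. t ^ n / fact n * a n) = (\<Sum>n<B. t ^ n / fact n * b n)" "n < B"
  shows "a n = b n"
proof -
  have "poly (\<Sum>n<B. monom (a n / fact n) n) = poly (\<Sum>n<B. monom (b n / fact n) n)"
    using assms(1) by (auto simp: poly_sum poly_monom fun_eq_iff mult.commute)
  then have "coeff (\<Sum>n<B. monom (a n / fact n) n) n = coeff (\<Sum>n<B. monom (b n / fact n) n) n"
    by (simp add: poly_eq_poly_eq_iff)
  then show ?thesis using assms(2) by (simp add: coeff_sum)
qed

lemma exp_binomial:
  fixes x y :: "'a::field_char_0"
  shows "(\<Sum>n\<le>L. x ^ n / fact n * (y ^ (L - n) / fact (L - n))) = (x + y) ^ L / fact L"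
proof -
  have "(x + y) ^ L / fact L = (\<Sum>n\<le>L. of_nat (L choose n) * x ^ n * y ^ (L - n) / fact L)"
    by (simp add: binomial_ring sum_divide_distrib)
  also have "\<dots> = (\<Sum>n\<le>L. x ^ n / fact n * (y ^ (L - n) / fact (L - n)))"
    by (rule sum.cong) (auto simp: binomial_fact)
  finally show ?thesis by simp
qed

text \<open>Upper negation turns the binomial into a quotient of factorials, and for d at most 1 the
  factor n1 d + 1 is (n1 + d)! / n1!.\<close>

lemma contraction_coeff_leading:
  fixes d :: nat
  assumes "d \<le> 1"
  shows "(of_nat n1 * of_nat d + 1) * ((- of_nat n1 - 1 - of_nat d) gchoose m2) =
    (- 1) ^ m2 * fact (m2 + n1 + d) / (fact m2 * fact n1 :: 'a::field_char_0)"
proof -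
  have "((- of_nat n1 - 1 - of_nat d) gchoose m2) = (- 1) ^ m2 * (of_nat (m2 + n1 + d) gchoose m2 :: 'a)"
    by (subst gbinomial_negated_upper) (simp add: algebra_simps)
  also have "of_nat (m2 + n1 + d) gchoose m2 = (fact (m2 + n1 + d) / (fact m2 * fact (n1 + d)) :: 'a)"
    unfolding binomial_gbinomial[symmetric] by (subst binomial_fact) simp_all
  finally have *: "((- of_nat n1 - 1 - of_nat d) gchoose m2) =
     (- 1) ^ m2 * (fact (m2 + n1 + d) / (fact m2 * fact (n1 + d)) :: 'a)" .
  have "fact (n1 + d) = (of_nat n1 * of_nat d + 1) * (fact n1 :: 'a)"
  proof -
    have "d = 0 \<or> d = 1" using assms by auto
    then show ?thesis by (auto simp: algebra_simps)
  qed
  moreover have "(of_nat n1 * of_nat d + 1 :: 'a) \<noteq> 0"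
    by (metis of_nat_Suc of_nat_mult add.commute of_nat_neq_0)
  moreover have "k * ((- 1) ^ m2 * (a / (b * (k * c)))) = (- 1) ^ m2 * a / (b * c)"
    if "k \<noteq> 0" for k a b c :: 'a
    using that by simp
  ultimately show ?thesis unfolding * by metis
qed

lemma contraction_coeff_nonzero:
  assumes "d \<le> 1" "n \<le> m2 + n1 + d"
  shows "(contraction_coeff d m1 m2 n1 n :: 'a::field_char_0) \<noteq> 0"
proof -
  have "(m1 + m2 + n1 + d - n) choose m1 \<noteq> 0" using assms(2) by simp
  then show ?thesis using assms(2) unfolding contraction_coeff_def contraction_coeff_leading[OF assms(1)] by simp
qed

text \<open>This is the origin of the substitution a(x, -t-x) c(t+x) b(t+x, y). For n above m2 + n1
  + d the binomial over m1 vanishes. In the remaining terms x^m1 splits off, the rest is the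
  expansion of (t+x)^(m2+n1+d), and the sign (-1)^m2 turns one part of it into (-t-x)^m2.\<close>

lemma contraction_coeff_series:
  fixes t x :: "'a::field_char_0"
  assumes d: "d \<le> 1" and B: "m1 + m2 + n1 + d < B"
  shows "(\<Sum>n<B. t ^ n / fact n * (contraction_coeff d m1 m2 n1 n * (x ^ (m1 + m2 + n1 + d - n) / fact (m1 + m2 + n1 + d - n))))
     = x ^ m1 / fact m1 * ((- t - x) ^ m2 / fact m2) * ((t + x) ^ (n1 + d) / fact n1)"
proof -
  let ?N = "m1 + m2 + n1 + d" and ?L = "m2 + n1 + d"
  let ?c = "(- 1) ^ m2 * fact ?L / (fact m2 * fact n1) :: 'a"
  have "(\<Sum>n<B. t ^ n / fact n * (contraction_coeff d m1 m2 n1 n * (x ^ (?N - n) / fact (?N - n)))) =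
     (\<Sum>n\<le>?L. t ^ n / fact n * (contraction_coeff d m1 m2 n1 n * (x ^ (?N - n) / fact (?N - n))))"
    using B by (intro sum.mono_neutral_right) (auto simp: contraction_coeff_def)
  also have "\<dots> = (\<Sum>n\<le>?L. (x ^ m1 / fact m1 * ?c) * (t ^ n / fact n * (x ^ (?L - n) / fact (?L - n))))"
  proof (rule sum.cong)
    fix n assume "n \<in> {..?L}"
    then have n: "n \<le> ?L" by simp
    have e: "?N - n = m1 + (?L - n)" using n by simp
    have b: "of_nat ((m1 + (?L - n)) choose m1) = (fact (m1 + (?L - n)) / (fact m1 * fact (?L - n)) :: 'a)"
      by (subst binomial_fact) simp_all
    have "contraction_coeff d m1 m2 n1 n = ?c * (fact (m1 + (?L - n)) / (fact m1 * fact (?L - n)))"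
      using n unfolding contraction_coeff_def contraction_coeff_leading[OF d] e b by simp
    then show "t ^ n / fact n * (contraction_coeff d m1 m2 n1 n * (x ^ (?N - n) / fact (?N - n))) =
        (x ^ m1 / fact m1 * ?c) * (t ^ n / fact n * (x ^ (?L - n) / fact (?L - n)))"
      unfolding e by (simp add: power_add mult.commute mult.left_commute)
  qed simp
  also have "\<dots> = (x ^ m1 / fact m1 * ?c) * ((t + x) ^ ?L / fact ?L)"
    by (simp only: sum_distrib_left[symmetric] exp_binomial)
  also have "\<dots> = x ^ m1 / fact m1 * ((- 1) ^ m2 * (t + x) ^ m2 / fact m2) * ((t + x) ^ (n1 + d) / fact n1)"
    by (simp add: power_add mult.commute mult.left_commute)
  also have "(- 1) ^ m2 * (t + x) ^ m2 = (- t - x) ^ m2"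
    by (simp add: power_mult_distrib[symmetric])
  finally show ?thesis .
qed

lemma even_degree_le: "even_degree i \<le> 1" by (simp add: even_degree_def)

context orthosymplectic
begin

text \<open>Position (P, Q) is read only in the summand (\<open>block P\<close>,
  \<open>block Q\<close>); anything else is dropped. This is harmless on \<open>block_span\<close>,
  whose elements have no other entries.\<close>

definition symbol_term :: "nat \<Rightarrow> nat \<Rightarrow> 'a \<Rightarrow> 'a \<Rightarrow> (bit \<times> bit \<times> nat \<times> nat) \<Rightarrow> 'a mtx \<Rightarrow> 'a" where
  "symbol_term P Q x y z u = (case z of (i, j, m, n) \<Rightarrow>
     if i = block P \<and> j = block Q then u P Q * (x ^ m / fact m * (y ^ n / fact n)) else 0)"

definition symbol :: "'a RA \<Rightarrow> nat \<Rightarrow> nat \<Rightarrow> 'a \<Rightarrow> 'a \<Rightarrow> 'a" where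
  "symbol f P Q x y = (\<Sum>z\<in>keys f. symbol_term P Q x y z (lookup f z))"

lemma symbol_term_zero [simp]: "symbol_term P Q x y z 0 = 0"
  by (simp add: symbol_term_def split: prod.splits)

lemma symbol_term_add: "symbol_term P Q x y z (u + v) = symbol_term P Q x y z u + symbol_term P Q x y z v"
  by (cases z) (simp add: symbol_term_def algebra_simps add_divide_distrib)

lemma symbol_term_scale: "symbol_term P Q x y z (\<lambda>p q. c * u p q) = c * symbol_term P Q x y z u"
  by (simp add: symbol_term_def split: prod.splits)

lemma symbol_superset: "finite A \<Longrightarrow> keys f \<subseteq> A \<Longrightarrow> symbol f P Q x y = (\<Sum>z\<in>A. symbol_term P Q x y z (lookup f z))"
  unfolding symbol_def by (rule sum_keys_superset, assumption, assumption, rule symbol_term_zero)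

lemma symbol_add: "symbol (f + g) P Q x y = symbol f P Q x y + symbol g P Q x y"
  unfolding symbol_def by (rule sum_keys_add, rule symbol_term_zero, rule symbol_term_add)

lemma symbol_zero [simp]: "symbol 0 P Q x y = 0"
  by (simp add: symbol_def)

lemma symbol_smul: "symbol (smul c f) P Q x y = c * symbol f P Q x y"
  using keys_smul[of c f]
  by (simp add: symbol_superset[of "keys f"] lookup_smul symbol_term_scale sum_distrib_left)

lemma symbol_minus: "symbol (f - g) P Q x y = symbol f P Q x y - symbol g P Q x y"
  using symbol_add[of "f - g" g] by (simp add: algebra_simps)

lemma symbol_sum: "symbol (sum h A) P Q x y = (\<Sum>z\<in>A. symbol (h z) P Q x y)"
  by (induction A rule: infinite_finite_induct) (simp_all add: symbol_add)

lemma symbol_unit_elt: "symbol (unit_elt p q m n) P Q x y = (if P = p \<and> Q = q then x ^ m / fact m * (y ^ n / fact n) else 0)"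
  by (subst symbol_superset[of "{(block p, block q, m, n)}"]) (auto simp: unit_elt_def elt_def symbol_term_def E_def)

text \<open>The lambda-bracket with lambda = t, that is the sum of t^n/n! u_n v, read through
  \<open>symbol\<close>; the power z^(-n-1) carries u_n v. Summation over the keys avoids the choice
  of a bound for n.\<close>

definition lambda_series :: "'a \<Rightarrow> (int \<Rightarrow>\<^sub>0 'a RA) \<Rightarrow> nat \<Rightarrow> nat \<Rightarrow> 'a \<Rightarrow> 'a \<Rightarrow> 'a" where
  "lambda_series t G P Q x y = (\<Sum>z\<in>keys G. t ^ nat (- z - 1) / fact (nat (- z - 1)) * symbol (lookup G z) P Q x y)"

lemma lambda_series_add: "lambda_series t (G + H) P Q x y = lambda_series t G P Q x y + lambda_series t H P Q x y"
  unfolding lambda_series_def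
  by (rule sum_keys_add[where h = "\<lambda>z u. t ^ nat (- z - 1) / fact (nat (- z - 1)) * symbol u P Q x y"])
    (simp_all add: symbol_add algebra_simps)

lemma lambda_series_zero [simp]: "lambda_series t 0 P Q x y = 0"
  by (simp add: lambda_series_def)

lemma lambda_series_bound:
  assumes "\<And>z. z \<ge> 0 \<Longrightarrow> lookup G z = 0" "\<And>n. n \<ge> B \<Longrightarrow> lookup G (- int n - 1) = 0"
  shows "lambda_series t G P Q x y = (\<Sum>n<B. t ^ n / fact n * symbol (lookup G (- int n - 1)) P Q x y)"
proof -
  let ?A = "(\<lambda>n. - int n - 1) ` {..<B}"
  have "keys G \<subseteq> ?A"
  proof
    fix z assume z: "z \<in> keys G"
    then have neg: "z < 0" using assms(1)[of z] by (auto simp: in_keys_iff intro: ccontr)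
    then have e: "z = - int (nat (- z - 1)) - 1" by simp
    moreover have "nat (- z - 1) < B"
      using assms(2)[of "nat (- z - 1)"] z e by (metis in_keys_iff not_le)
    ultimately show "z \<in> ?A" by blast
  qed
  then have "lambda_series t G P Q x y = (\<Sum>z\<in>?A. t ^ nat (- z - 1) / fact (nat (- z - 1)) * symbol (lookup G z) P Q x y)"
    unfolding lambda_series_def
    by (intro sum_keys_superset[where h = "\<lambda>z u. t ^ nat (- z - 1) / fact (nat (- z - 1)) * symbol u P Q x y"]) simp_all
  also have "\<dots> = (\<Sum>n<B. t ^ n / fact n * symbol (lookup G (- int n - 1)) P Q x y)"
    by (subst sum.reindex) (auto simp: inj_on_def)
  finally show ?thesis .
qed

lemma lambda_series_nY:
  assumes "\<And>n. n \<ge> B \<Longrightarrow> nY K f n g = 0"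
  shows "lambda_series t (Yplus K f g) P Q x y = (\<Sum>n<B. t ^ n / fact n * symbol (nY K f n g) P Q x y)"
  unfolding nprod_def by (rule lambda_series_bound) (use assms in \<open>auto simp: lookup_Yplus_polar nprod_def\<close>)

lemma nY_bound: "\<exists>B. \<forall>n\<ge>B. nY k f n g = 0"
proof -
  have fin: "finite ((\<lambda>z. nat (- z - 1)) ` keys (Yplus k f g))" by simp
  then obtain B where B: "\<forall>m\<in>(\<lambda>z. nat (- z - 1)) ` keys (Yplus k f g). m < B"
    using finite_nat_set_iff_bounded by blast
  have "nY k f n g = 0" if "n \<ge> B" for n
  proof (rule ccontr)
    assume "nY k f n g \<noteq> 0"
    then have "- int n - 1 \<in> keys (Yplus k f g)" by (simp add: nprod_def in_keys_iff)
    then have "nat (- (- int n - 1) - 1) < B" using B by blast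
    then show False using that by simp
  qed
  then show ?thesis by blast
qed

text \<open>\<open>koszul_sign\<close> below is the sign of the super-commuted term read off from the indices, so that the
  formula for the bracket is bilinear and needs no homogeneity.\<close>

definition wprod :: "(nat \<Rightarrow> nat \<Rightarrow> nat \<Rightarrow> 'a) \<Rightarrow> 'a \<Rightarrow> (nat \<Rightarrow> nat \<Rightarrow> 'a \<Rightarrow> 'a \<Rightarrow> 'a) \<Rightarrow> (nat \<Rightarrow> nat \<Rightarrow> 'a \<Rightarrow> 'a \<Rightarrow> 'a)
    \<Rightarrow> nat \<Rightarrow> nat \<Rightarrow> 'a \<Rightarrow> 'a \<Rightarrow> 'a" where
  "wprod w t a b P Q x y = (\<Sum>S = 1..K. w P S Q * (a P S x (- t - x) * b S Q (t + x) y * (t + x) ^ block_degree S))"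

abbreviation "lprod \<equiv> wprod (\<lambda>_ _ _. 1)"

definition koszul_sign :: "nat \<Rightarrow> nat \<Rightarrow> nat \<Rightarrow> 'a" where
  "koszul_sign P S Q = koszul (block S + block Q) (block P + block S)"

definition block_span :: "'a RA set" where
  "block_span = RA.span {unit_elt p q m n | p q m n. p \<in> {1..K} \<and> q \<in> {1..K}}"

text \<open>In the second half of the product formula the factors are exchanged and the powers of y
  are produced. The first half with t replaced by -t-x-y does the same, as in skew-symmetry, where
  x+y stands for the derivation.\<close>

lemma lambda_series_unit_elt:
  assumes I: "p \<in> {1..K}" "q \<in> {1..K}" "r \<in> {1..K}" "s \<in> {1..K}"
  shows "lambda_series t (Yplus K (unit_elt p q m1 m2) (unit_elt r s n1 n2)) P Q x y =
    lprod t (symbol (unit_elt p q m1 m2)) (symbol (unit_elt r s n1 n2)) P Q x y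
    - wprod koszul_sign (- t - x - y) (symbol (unit_elt r s n1 n2)) (symbol (unit_elt p q m1 m2)) P Q x y"
proof -
  define B where "B = m1 + m2 + n1 + n2 + 3"
  let ?k = "koszul (block p + block q) (block r + block s) :: 'a"
  have B1: "m1 + m2 + n1 + block_degree q < B" "m2 + m1 + n2 + block_degree p < B"
    using even_degree_le[of "block q"] even_degree_le[of "block p"] by (auto simp: B_def)
  have "nY K (unit_elt p q m1 m2) n (unit_elt r s n1 n2) = 0" if "n \<ge> B" for n
  proof -
    have "contraction_coeff (block_degree q) m1 m2 n1 n = (0 :: 'a)" "contraction_coeff (block_degree p) m2 m1 n2 n = (0 :: 'a)"
      using B1 that by (simp_all add: contraction_coeff_def)
    then show ?thesis by (simp only: nY_unit_elt[OF I] mult_zero_right RA.scale_zero_left if_cancel diff_self)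
  qed
  note lambda_series_nY[OF this]
  moreover have 1: "(\<Sum>n<B. t ^ n / fact n * symbol (if q = r then smul (contraction_coeff (block_degree q) m1 m2 n1 n) (unit_elt p s (m1 + m2 + n1 + block_degree q - n) n2) else 0) P Q x y)
     = lprod t (symbol (unit_elt p q m1 m2)) (symbol (unit_elt r s n1 n2)) P Q x y"
  proof (cases "q = r \<and> P = p \<and> Q = s")
    case True
    have "lprod t (symbol (unit_elt p q m1 m2)) (symbol (unit_elt r s n1 n2)) P Q x y =
      (\<Sum>S = 1..K. if S = q then x ^ m1 / fact m1 * ((- t - x) ^ m2 / fact m2) * ((t + x) ^ (n1 + block_degree q) / fact n1) * (y ^ n2 / fact n2) else 0)"
      unfolding wprod_def
      by (rule sum.cong) (use True in \<open>auto simp: symbol_unit_elt power_add mult.commute mult.left_commute\<close>)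
    also have "\<dots> = x ^ m1 / fact m1 * ((- t - x) ^ m2 / fact m2) * ((t + x) ^ (n1 + block_degree q) / fact n1) * (y ^ n2 / fact n2)"
      using I(2) by simp
    finally have R: "lprod t (symbol (unit_elt p q m1 m2)) (symbol (unit_elt r s n1 n2)) P Q x y = \<dots>" .
    show ?thesis using True
      unfolding R contraction_coeff_series[OF even_degree_le B1(1), symmetric]
      by (simp only: symbol_smul symbol_unit_elt simp_thms if_True sum_distrib_right mult.assoc)
  next
    case False
    then have "lprod t (symbol (unit_elt p q m1 m2)) (symbol (unit_elt r s n1 n2)) P Q x y = 0"
      unfolding wprod_def by (intro sum.neutral) (auto simp: symbol_unit_elt)
    moreover have "(\<Sum>n<B. t ^ n / fact n * symbol (if q = r then smul (contraction_coeff (block_degree q) m1 m2 n1 n) (unit_elt p s (m1 + m2 + n1 + block_degree q - n) n2) else 0) P Q x y) = 0"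
      using False by (intro sum.neutral) (auto simp: symbol_smul symbol_unit_elt)
    ultimately show ?thesis by simp
  qed
  moreover have 2: "(\<Sum>n<B. t ^ n / fact n * symbol (if p = s then smul (?k * (- 1) ^ block_degree p * contraction_coeff (block_degree p) m2 m1 n2 n)
         (unit_elt r q n1 (m1 + m2 + n2 + block_degree p - n)) else 0) P Q x y)
     = wprod koszul_sign (- t - x - y) (symbol (unit_elt r s n1 n2)) (symbol (unit_elt p q m1 m2)) P Q x y"
  proof (cases "p = s \<and> P = r \<and> Q = q")
    case True
    let ?R = "?k * (- 1) ^ block_degree p * (x ^ n1 / fact n1) * (y ^ m2 / fact m2 * ((- t - y) ^ m1 / fact m1) * ((t + y) ^ (n2 + block_degree p) / fact n2))"
    \<comment> \<open>After the replacement the inner arguments are t+y and -t-y. The sign (-1)^d of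
      the product formula is what separates c(-t-y) from c(t+y).\<close>
    have e1: "- (- t - x - y) - x = t + y" and e2: "- t - x - y + x = - t - y"
      by simp_all
    have m: "(- t - y) ^ i = (- 1) ^ i * (t + y) ^ i" for i
      by (simp add: power_mult_distrib[symmetric])
    have "wprod koszul_sign (- t - x - y) (symbol (unit_elt r s n1 n2)) (symbol (unit_elt p q m1 m2)) P Q x y =
      (\<Sum>S = 1..K. if S = p then ?R else 0)"
      unfolding wprod_def e1 e2 m[of "block_degree _"]
      by (rule sum.cong) (use True in \<open>auto simp: symbol_unit_elt power_add koszul_sign_def mult.commute mult.left_commute\<close>)
    also have "\<dots> = ?R"
      using I(1) by simp
    finally have R: "wprod koszul_sign (- t - x - y) (symbol (unit_elt r s n1 n2)) (symbol (unit_elt p q m1 m2)) P Q x y = ?R" .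
    have "m1 + m2 + n2 + block_degree p = m2 + m1 + n2 + block_degree p" by simp
    then show ?thesis using True
      unfolding R contraction_coeff_series[OF even_degree_le B1(2), symmetric]
      by (simp only: symbol_smul symbol_unit_elt simp_thms if_True sum_distrib_left mult_ac)
  next
    case False
    then have "wprod koszul_sign (- t - x - y) (symbol (unit_elt r s n1 n2)) (symbol (unit_elt p q m1 m2)) P Q x y = 0"
      unfolding wprod_def by (intro sum.neutral) (auto simp: symbol_unit_elt)
    moreover have "(\<Sum>n<B. t ^ n / fact n * symbol (if p = s then smul (?k * (- 1) ^ block_degree p * contraction_coeff (block_degree p) m2 m1 n2 n)
         (unit_elt r q n1 (m1 + m2 + n2 + block_degree p - n)) else 0) P Q x y) = 0"
      using False by (intro sum.neutral) (auto simp: symbol_smul symbol_unit_elt)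
    ultimately show ?thesis by simp
  qed
  ultimately show ?thesis
    unfolding nY_unit_elt[OF I] symbol_minus right_diff_distrib sum_subtractf by simp
qed

lemma wprod_add: "wprod w t (\<lambda>P Q x y. a P Q x y + a' P Q x y) b P Q x y = wprod w t a b P Q x y + wprod w t a' b P Q x y"
  "wprod w t a (\<lambda>P Q x y. b P Q x y + b' P Q x y) P Q x y = wprod w t a b P Q x y + wprod w t a b' P Q x y"
  by (simp_all add: wprod_def algebra_simps sum.distrib)

lemma wprod_scale: "wprod w t (\<lambda>P Q x y. c * a P Q x y) b P Q x y = c * wprod w t a b P Q x y"
  "wprod w t a (\<lambda>P Q x y. c * b P Q x y) P Q x y = c * wprod w t a b P Q x y"
  by (simp_all add: wprod_def algebra_simps sum_distrib_left)

lemma wprod_zero [simp]: "wprod w t (\<lambda>P Q x y. 0) b P Q x y = 0" "wprod w t a (\<lambda>P Q x y. 0) P Q x y = 0"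
  by (simp_all add: wprod_def)

lemma symbol_add': "symbol (f + g) = (\<lambda>P Q x y. symbol f P Q x y + symbol g P Q x y)"
  and symbol_smul': "symbol (smul c f) = (\<lambda>P Q x y. c * symbol f P Q x y)"
  and symbol_zero': "symbol 0 = (\<lambda>P Q x y. 0)"
  by (simp_all add: fun_eq_iff symbol_add symbol_smul)

lemma lambda_series_scale: "(\<And>z. lookup H z = smul c (lookup G z)) \<Longrightarrow> lambda_series t H P Q x y = c * lambda_series t G P Q x y"
proof -
  assume *: "\<And>z. lookup H z = smul c (lookup G z)"
  have "keys H \<subseteq> keys G" using * by (auto simp: in_keys_iff)
  then have "lambda_series t H P Q x y = (\<Sum>z\<in>keys G. t ^ nat (- z - 1) / fact (nat (- z - 1)) * symbol (lookup H z) P Q x y)"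
    unfolding lambda_series_def
    by (intro sum_keys_superset[where h = "\<lambda>z u. t ^ nat (- z - 1) / fact (nat (- z - 1)) * symbol u P Q x y"]) simp_all
  then show ?thesis by (simp add: * symbol_smul lambda_series_def sum_distrib_left algebra_simps)
qed

lemma lambda_series_formula:
  assumes "f \<in> block_span" "g \<in> block_span"
  shows "lambda_series t (Yplus K f g) P Q x y = lprod t (symbol f) (symbol g) P Q x y - wprod koszul_sign (- t - x - y) (symbol g) (symbol f) P Q x y"
proof -
  have *: "lambda_series t (Yplus K (unit_elt p q m1 m2) g) P Q x y = lprod t (symbol (unit_elt p q m1 m2)) (symbol g) P Q x y
      - wprod koszul_sign (- t - x - y) (symbol g) (symbol (unit_elt p q m1 m2)) P Q x y" if I: "p \<in> {1..K}" "q \<in> {1..K}" for p q m1 m2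
    using assms(2) unfolding block_span_def
  proof (induction rule: RA.span_induct_alt)
    case base
    then show ?case by (simp add: symbol_zero')
  next
    case (step c u v)
    then obtain r s n1 n2 where u: "u = unit_elt r s n1 n2" "r \<in> {1..K}" "s \<in> {1..K}" by blast
    show ?case
      unfolding Yplus_add_right lambda_series_add symbol_add' symbol_smul' wprod_add wprod_scale step.IH
        lambda_series_scale[OF lookup_Yplus_smul_right] u(1) lambda_series_unit_elt[OF I u(2,3)]
      by (simp add: algebra_simps)
  qed
  show ?thesis
    using assms(1) unfolding block_span_def
  proof (induction rule: RA.span_induct_alt)
    case base
    then show ?case by (simp add: symbol_zero')
  next
    case (step c u v)
    then obtain p q m1 m2 where u: "u = unit_elt p q m1 m2" "p \<in> {1..K}" "q \<in> {1..K}" by blast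
    show ?case
      unfolding Yplus_add_left lambda_series_add symbol_add' symbol_smul' wprod_add wprod_scale step.IH
        lambda_series_scale[OF lookup_Yplus_smul_left] u(1) *[OF u(2,3)]
      by (simp add: algebra_simps)
  qed
qed

end

section \<open>The conformal superalgebra identities\<close>

lemma triangle_sum:
  fixes F :: "nat \<Rightarrow> nat \<Rightarrow> 'a::comm_monoid_add"
  assumes "\<And>i j. i + j \<ge> N \<Longrightarrow> F i j = 0"
  shows "(\<Sum>k<N. \<Sum>i\<le>k. F i (k - i)) = (\<Sum>i<N. \<Sum>j<N. F i j)"
proof -
  have "(\<Sum>i<N. \<Sum>j<N. F i j) = (\<Sum>(i, j)\<in>{..<N} \<times> {..<N}. F i j)"
    by (simp add: sum.cartesian_product)
  also have "\<dots> = (\<Sum>(i, j)\<in>{(i, j). i + j < N}. F i j)"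
  proof (rule sum.mono_neutral_right)
    show "\<forall>z\<in>{..<N} \<times> {..<N} - {(i, j). i + j < N}. (case z of (i, j) \<Rightarrow> F i j) = 0"
    proof
      fix z assume "z \<in> {..<N} \<times> {..<N} - {(i, j). i + j < N}"
      then have "fst z + snd z \<ge> N" by (auto simp: not_less)
      then show "(case z of (i, j) \<Rightarrow> F i j) = 0" by (simp add: assms split_def)
    qed
  qed auto
  finally show ?thesis by (simp add: sum.triangle_reindex)
qed

lemma koszul_add_left: "koszul (i + j) k = koszul i k * (koszul j k :: 'a::comm_ring_1)"
  by (cases i; cases j; cases k) (simp_all add: koszul_bit)

lemma koszul_add_right: "koszul k (i + j) = koszul k i * (koszul k j :: 'a::comm_ring_1)"
  by (cases i; cases j; cases k) (simp_all add: koszul_bit)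

lemma koszul_commute: "koszul i j = koszul j i"
  by (simp add: koszul_bit)

lemma koszul_cases: "koszul i j = (1 :: 'a::comm_ring_1) \<or> koszul i j = (- 1 :: 'a)"
  by (simp add: koszul_bit)

lemma minus_diff_add_commute: "- a - (b + c) = - b - (a + c)" for a b c :: "'a::ab_group_add"
  by simp

context orthosymplectic
begin

abbreviation Rd where "Rd \<equiv> (Rdagger l1 l2 :: bit \<Rightarrow> 'a RA set)"

definition Tall :: "'a RA set" where
  "Tall = {T p q m n | p q m n. p \<in> {1..K} \<and> q \<in> {1..K}}"

lemma Tall_eq: "Tall = Tset 0 \<union> Tset 1"
proof -
  have "block p + block q = 0 \<or> block p + block q = 1" for p q by (cases "block p + block q") auto
  then show ?thesis unfolding Tall_def Tset_def by blast
qed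

lemma whole_eq: "whole Rd = RA.span Tall"
  unfolding Tall_eq RA.span_Un whole_def Rdagger_eq ..

lemma unit_elt_in_block_span: "p \<in> {1..K} \<Longrightarrow> q \<in> {1..K} \<Longrightarrow> unit_elt p q m n \<in> block_span"
  unfolding block_span_def by (rule RA.span_base) blast

lemma subspace_block_span: "RA.subspace block_span"
  unfolding block_span_def by (rule RA.subspace_span)

lemma T_in_block_span: "p \<in> {1..K} \<Longrightarrow> q \<in> {1..K} \<Longrightarrow> T p q m n \<in> block_span"
  unfolding T_def
  by (intro RA.subspace_add[OF subspace_block_span] RA.subspace_scale[OF subspace_block_span] unit_elt_in_block_span dual_in)

lemma whole_block_span: "whole Rd \<subseteq> block_span"
  unfolding whole_eq
  by (rule RA.span_minimal[OF _ subspace_block_span]) (unfold Tall_def, use T_in_block_span in blast)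

lemma subspace_Rd: "RA.subspace (Rd i)"
  unfolding Rdagger_eq by (rule RA.subspace_span)

lemma Rd_whole: "f \<in> Rd i \<Longrightarrow> f \<in> whole Rd"
  unfolding whole_eq Rdagger_eq Tall_eq
  by (cases i) (use RA.span_mono[of "Tset 0" "Tset 0 \<union> Tset 1"] RA.span_mono[of "Tset 1" "Tset 0 \<union> Tset 1"] in auto)

lemma Rd_block_span: "f \<in> Rd i \<Longrightarrow> f \<in> block_span"
  using Rd_whole whole_block_span by blast

lemma symbol_T: "symbol (T p q m n) P Q x y = (if P = p \<and> Q = q then x ^ m / fact m * (y ^ n / fact n) else 0)
   + sigma p q * (if P = dual q \<and> Q = dual p then x ^ n / fact n * (y ^ m / fact m) else 0)"
  by (simp add: T_def symbol_add symbol_smul symbol_unit_elt)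

lemma symbol_homogeneous:
  assumes "f \<in> Rd i" "block P + block Q \<noteq> i"
  shows "symbol f P Q x y = 0"
  using assms(1) unfolding Rdagger_eq
proof (induction rule: RA.span_induct_alt)
  case (step c u v)
  then obtain p q m n where u: "u = T p q m n" "p \<in> {1..K}" "q \<in> {1..K}" "block p + block q = i"
    unfolding Tset_def by blast
  have "block (dual q) + block (dual p) = i" using u by (simp only: block_dual add.commute)
  then have "\<not> (P = p \<and> Q = q)" "\<not> (P = dual q \<and> Q = dual p)" using u(4) assms(2) by blast+
  then have "symbol u P Q x y = 0" by (simp only: u(1) symbol_T if_False mult_zero_right add_0)
  then show ?case using step by (simp add: symbol_add symbol_smul)
qed simp

lemma block_span_support:
  assumes "f \<in> block_span" "lookup f (i, j, m, n) p q \<noteq> 0"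
  shows "p \<in> {1..K} \<and> q \<in> {1..K} \<and> i = block p \<and> j = block q"
proof (rule ccontr)
  assume neg: "\<not> ?thesis"
  have "lookup f (i, j, m, n) p q = 0"
    using assms(1) unfolding block_span_def
  proof (induction rule: RA.span_induct_alt)
    case (step c u v)
    then obtain p' q' m' n' where u: "u = unit_elt p' q' m' n'" "p' \<in> {1..K}" "q' \<in> {1..K}" by blast
    have "lookup u (i, j, m, n) p q = 0"
      using neg u(2,3) unfolding u(1) unit_elt_def elt_def lookup_single by (auto simp: when_def E_def)
    then show ?case using step by (simp add: lookup_add lookup_smul)
  qed simp
  then show False using assms(2) by simp
qed

text \<open>One cut-off serves all x and y, so that \<open>symbol\<close> is a polynomial in both
  and coefficients can be compared first in x and then in y.\<close>

lemma symbol_bound: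
  "\<exists>B0. \<forall>x y. \<forall>B\<ge>B0. symbol f P Q x y = (\<Sum>m<B. x ^ m / fact m * (\<Sum>n<B. y ^ n / fact n * lookup f (block P, block Q, m, n) P Q))"
proof -
  let ?h = "\<lambda>(i :: bit, j :: bit, m :: nat, n :: nat). m + n"
  have "finite (?h ` keys f)" by simp
  then obtain B0 where B0: "\<forall>m\<in>?h ` keys f. m < B0"
    using finite_nat_set_iff_bounded by blast
  have "symbol f P Q x y = (\<Sum>m<B. x ^ m / fact m * (\<Sum>n<B. y ^ n / fact n * lookup f (block P, block Q, m, n) P Q))"
    if "B \<ge> B0" for B x y
  proof -
    let ?A = "UNIV \<times> UNIV \<times> {..<B} \<times> {..<B} :: (bit \<times> bit \<times> nat \<times> nat) set"
    have univ: "(UNIV :: bit set) = {0, 1}"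
      using bit_not_one_iff by blast
    then have fin: "finite (UNIV :: bit set)" by (metis finite.emptyI finite.insertI)
    have "keys f \<subseteq> ?A"
    proof
      fix z assume z: "z \<in> keys f"
      obtain i j m n where zz: "z = (i, j, m, n)" by (metis prod_cases4)
      have "m + n < B0" using B0 z zz by force
      then show "z \<in> ?A" using zz that by auto
    qed
    then have "symbol f P Q x y = (\<Sum>z\<in>?A. symbol_term P Q x y z (lookup f z))"
      using fin by (intro symbol_superset) auto
    also have "\<dots> = (\<Sum>z\<in>{block P} \<times> {block Q} \<times> {..<B} \<times> {..<B}. symbol_term P Q x y z (lookup f z))"
      using fin by (intro sum.mono_neutral_right) (auto simp: symbol_term_def split: if_splits)
    also have "\<dots> = (\<Sum>z\<in>{..<B} \<times> {..<B}. symbol_term P Q x y (block P, block Q, z) (lookup f (block P, block Q, z)))"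
      by (rule sum.reindex_bij_witness[of _ "\<lambda>z. (block P, block Q, z)" "\<lambda>(i, j, z). z"]) auto
    also have "\<dots> = (\<Sum>m<B. \<Sum>n<B. symbol_term P Q x y (block P, block Q, m, n) (lookup f (block P, block Q, m, n)))"
      by (simp add: sum.cartesian_product split_def)
    also have "\<dots> = (\<Sum>m<B. x ^ m / fact m * (\<Sum>n<B. y ^ n / fact n * lookup f (block P, block Q, m, n) P Q))"
      by (simp add: symbol_term_def sum_distrib_left mult_ac)
    finally show ?thesis .
  qed
  then show ?thesis by blast
qed

lemma symbol_coeff_zero:
  assumes "\<And>x y. symbol f P Q x y = 0"
  shows "lookup f (block P, block Q, m, n) P Q = 0"
proof -
  obtain B0 where B0: "\<And>x y B. B \<ge> B0 \<Longrightarrow>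
      symbol f P Q x y = (\<Sum>m<B. x ^ m / fact m * (\<Sum>n<B. y ^ n / fact n * lookup f (block P, block Q, m, n) P Q))"
    using symbol_bound[of f P Q] by blast
  define B where "B = B0 + m + n + 1"
  have *: "(\<Sum>m<B. x ^ m / fact m * (\<Sum>n<B. y ^ n / fact n * lookup f (block P, block Q, m, n) P Q)) =
      (\<Sum>m<B. x ^ m / fact m * 0)" for x y
    using B0[of B x y] assms by (simp add: B_def)
  have "(\<Sum>n<B. y ^ n / fact n * lookup f (block P, block Q, m, n) P Q) = 0" for y
    by (rule exp_coeff_eq[where a = "\<lambda>m. \<Sum>n<B. y ^ n / fact n * lookup f (block P, block Q, m, n) P Q" and B = B, OF *])
      (simp add: B_def)
  then have **: "(\<Sum>n<B. y ^ n / fact n * lookup f (block P, block Q, m, n) P Q) = (\<Sum>n<B. y ^ n / fact n * 0)" for y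
    by simp
  show ?thesis
    by (rule exp_coeff_eq[where a = "\<lambda>n. lookup f (block P, block Q, m, n) P Q" and B = B, OF **]) (simp add: B_def)
qed

text \<open>By \<open>block_span_support\<close> a nonzero entry of an element of
  \<open>block_span\<close> sits in the summand given by its blocks, exactly where
  \<open>symbol\<close> looks. Hence identities between elements of R^dagger may be checked on
  symbols.\<close>

lemma symbol_eqI:
  assumes "f \<in> block_span" "g \<in> block_span" "\<And>P Q x y. symbol f P Q x y = symbol g P Q x y"
  shows "f = g"
proof -
  have d: "f - g \<in> block_span" using assms RA.subspace_diff[OF subspace_block_span] by blast
  have "lookup (f - g) (i, j, m, n) P Q = 0" for i j m n P Q
  proof (rule ccontr)
    assume neg: "lookup (f - g) (i, j, m, n) P Q \<noteq> 0"
    then have ij: "i = block P" "j = block Q" using block_span_support[OF d] by blast+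
    have "lookup (f - g) (block P, block Q, m, n) P Q = 0"
      by (rule symbol_coeff_zero) (simp add: symbol_minus assms(3))
    then show False using neg ij by simp
  qed
  then have "lookup (f - g) z = 0" for z
    by (cases z) (auto simp: fun_eq_iff)
  then have "f - g = 0" by (intro poly_mapping_eqI) simp
  then show ?thesis by simp
qed

text \<open>In each of the four contractions the two contracted legs lie in the same block and
  cancel in the sum of parities.\<close>

lemma nY_closed:
  assumes "u \<in> Rd i" "v \<in> Rd j"
  shows "nY K u n v \<in> Rd (i + j)"
proof -
  note sub = subspace_Rd[of "i + j"]
  have TT: "nY K (T p q m1 m2) n (T r s n1 n2) \<in> Rd (i + j)"
    if I: "p \<in> {1..K}" "q \<in> {1..K}" "r \<in> {1..K}" "s \<in> {1..K}" and b: "block p + block q = i" "block r + block s = j"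
    for p q r s m1 m2 n1 n2
  proof -
    have X: "T p' q' m' n' \<in> Rd (i + j)" if "p' \<in> {1..K}" "q' \<in> {1..K}" "block p' + block q' = i + j" for p' q' m' n'
      unfolding Rdagger_eq using that by (intro RA.span_base T_in_Tset)
    have b': "(a :: bit) + a' + (a' + c) = a + c" for a a' c
      by (cases a; cases a'; cases c) simp_all
    have "if q = r then block p + block s = i + j else True"
      using b b'[of "block p" "block q" "block s"] by auto
    moreover have "if q = dual s then block p + block (dual r) = i + j else True"
      using b b'[of "block p" "block q" "block r"] I by (auto simp: add.commute[of "block r"] simp del: add_bit_eq_xor)
    moreover have "if dual p = r then block (dual q) + block s = i + j else True"
      using b b'[of "block q" "block p" "block s"] I by (auto simp: add.commute[of "block p"] simp del: add_bit_eq_xor)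
    moreover have "if p = s then block (dual q) + block (dual r) = i + j else True"
      using b b'[of "block q" "block p" "block r"] I by (auto simp: add.commute simp del: add_bit_eq_xor)
    ultimately show ?thesis
      unfolding nY_T[OF I]
      by (intro RA.subspace_add[OF sub]; cases "q = r"; cases "q = dual s"; cases "dual p = r"; cases "p = s";
        simp only: if_True if_False refl RA.subspace_0[OF sub]; intro RA.subspace_scale[OF sub] X dual_in I; simp)
  qed
  have *: "nY K (T p q m1 m2) n v \<in> Rd (i + j)"
    if I: "p \<in> {1..K}" "q \<in> {1..K}" and b: "block p + block q = i" for p q m1 m2
    using assms(2) unfolding Rdagger_eq[of j]
  proof (induction rule: RA.span_induct_alt)
    case base
    then show ?case using RA.subspace_0[OF sub] by simp
  next
    case (step c x y)
    then obtain r s n1 n2 where x: "x = T r s n1 n2" "r \<in> {1..K}" "s \<in> {1..K}" "block r + block s = j"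
      unfolding Tset_def by blast
    show ?case
      unfolding nY_add_right nY_smul_right x(1)
      by (intro RA.subspace_add[OF sub] RA.subspace_scale[OF sub] step.IH TT I x b)
  qed
  show ?thesis
    using assms(1) unfolding Rdagger_eq[of i]
  proof (induction rule: RA.span_induct_alt)
    case base
    then show ?case using RA.subspace_0[OF sub] by simp
  next
    case (step c x y)
    then obtain p q m1 m2 where x: "x = T p q m1 m2" "p \<in> {1..K}" "q \<in> {1..K}" "block p + block q = i"
      unfolding Tset_def by blast
    show ?case
      unfolding nY_add_left nY_smul_left x(1)
      by (intro RA.subspace_add[OF sub] RA.subspace_scale[OF sub] step.IH * x)
  qed
qed

lemma der_T: "der (T p q m n) = smul (of_nat (m + 1)) (T p q (m + 1) n) + smul (of_nat (n + 1)) (T p q m (n + 1))"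
  unfolding T_def der_add der_smul unit_elt_def der_elt
  by (simp add: RA.scale_right_distrib mult.commute add_ac)

lemma der_closed: "u \<in> Rd i \<Longrightarrow> der u \<in> Rd i"
  unfolding Rdagger_eq
proof (induction rule: RA.span_induct_alt)
  case base
  then show ?case by (simp add: RA.span_zero)
next
  case (step c x y)
  then obtain p q m n where x: "x = T p q m n" "p \<in> {1..K}" "q \<in> {1..K}" "block p + block q = i"
    unfolding Tset_def by blast
  show ?case
    unfolding der_add der_smul x(1) der_T
    by (intro RA.span_add RA.span_scale RA.span_base[OF T_in_Tset] x step.IH)
qed

lemma symbol_der: "f \<in> block_span \<Longrightarrow> symbol (der f) P Q x y = (x + y) * symbol f P Q x y"
  unfolding block_span_def
proof (induction rule: RA.span_induct_alt)
  case base
  then show ?case by simp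
next
  case (step c u v)
  then obtain p q m n where u: "u = unit_elt p q m n" by blast
  have f: "of_nat (m + 1) * (a ^ (m + 1) / fact (m + 1)) = a * (a ^ m / (fact m :: 'a))" for m a
    by (simp add: field_simps del: of_nat_Suc)
  have "symbol (der u) P Q x y = of_nat (m + 1) * symbol (unit_elt p q (m + 1) n) P Q x y + of_nat (n + 1) * symbol (unit_elt p q m (n + 1)) P Q x y"
    unfolding u unit_elt_def der_elt by (simp only: symbol_add symbol_smul)
  also have "\<dots> = (if P = p \<and> Q = q then of_nat (m + 1) * (x ^ (m + 1) / fact (m + 1)) * (y ^ n / fact n)
      + (x ^ m / fact m) * (of_nat (n + 1) * (y ^ (n + 1) / fact (n + 1))) else 0)"
    unfolding symbol_unit_elt by (simp add: mult.left_commute del: of_nat_Suc fact_Suc power_Suc)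
  also have "\<dots> = (x + y) * symbol u P Q x y"
    unfolding f u symbol_unit_elt by (simp add: algebra_simps)
  finally show ?case using step.IH by (simp add: der_add der_smul symbol_add symbol_smul algebra_simps)
qed

section \<open>The Jacobi identity for symbols\<close>

definition lbracket :: "'a \<Rightarrow> 'a \<Rightarrow> (nat \<Rightarrow> nat \<Rightarrow> 'a \<Rightarrow> 'a \<Rightarrow> 'a) \<Rightarrow> (nat \<Rightarrow> nat \<Rightarrow> 'a \<Rightarrow> 'a \<Rightarrow> 'a)
    \<Rightarrow> nat \<Rightarrow> nat \<Rightarrow> 'a \<Rightarrow> 'a \<Rightarrow> 'a" where
  "lbracket k t a b = (\<lambda>P Q x y. lprod t a b P Q x y - k * lprod (- t - x - y) b a P Q x y)"

text \<open>In a nonzero summand the middle index S satisfies block P + block S = j and block S +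
  block Q = i. So the sign read off from the indices is the constant \<open>koszul i j\<close> and
  can be taken out of the sum.\<close>

lemma lambda_series_lbracket:
  assumes "u \<in> Rd i" "v \<in> Rd j"
  shows "lambda_series t (Yplus K u v) = lbracket (koszul i j) t (symbol u) (symbol v)"
proof (intro ext)
  fix P Q x y
  have "wprod koszul_sign t' (symbol v) (symbol u) P Q x y = koszul i j * lprod t' (symbol v) (symbol u) P Q x y" for t'
    unfolding wprod_def sum_distrib_left
  proof (rule sum.cong)
    fix S assume "S \<in> {1..K}"
    show "koszul_sign P S Q * (symbol v P S x (- t' - x) * symbol u S Q (t' + x) y * (t' + x) ^ block_degree S) =
       koszul i j * (1 * (symbol v P S x (- t' - x) * symbol u S Q (t' + x) y * (t' + x) ^ block_degree S))"
      using symbol_homogeneous[OF assms(1), of S Q] symbol_homogeneous[OF assms(2), of P S]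
      unfolding koszul_sign_def by (cases "block S + block Q = i \<and> block P + block S = j") auto
  qed simp
  then show "lambda_series t (Yplus K u v) P Q x y = lbracket (koszul i j) t (symbol u) (symbol v) P Q x y"
    unfolding lbracket_def lambda_series_formula[OF Rd_block_span[OF assms(1)] Rd_block_span[OF assms(2)]] by simp
qed

text \<open>Both ways of nesting evaluate the three factors at the same points, so associativity
  amounts to exchanging the sums over the two inner indices. The five variants differ in the order
  of the factors and in the parameters; with the roles of (U, t) and (V, s) exchanged they cover all
  six orders that occur in the Jacobi identity.\<close>

lemma lprod_assoc: "lprod t U (\<lambda>P Q x y. lprod s V W P Q x y) P Q x y = lprod (t + s) (\<lambda>P Q x y. lprod t U V P Q x y) W P Q x y"
  unfolding wprod_def sum_distrib_left sum_distrib_right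
  by (subst sum.swap, intro sum.cong refl) (simp add: algebra_simps minus_diff_add_commute)

lemma lprod_assoc2: "lprod t U (\<lambda>P Q x y. lprod (- s - x - y) W V P Q x y) P Q x y =
    lprod (- s - x - y) (\<lambda>P Q x y. lprod t U W P Q x y) V P Q x y"
  unfolding wprod_def sum_distrib_left sum_distrib_right
  by (subst sum.swap, intro sum.cong refl) (simp add: algebra_simps minus_diff_add_commute)

lemma lprod_assoc3: "lprod (t + s) (\<lambda>P Q x y. lprod (- t - x - y) V U P Q x y) W P Q x y =
    lprod s V (\<lambda>P Q x y. lprod t U W P Q x y) P Q x y"
  unfolding wprod_def sum_distrib_left sum_distrib_right
  by (subst sum.swap, intro sum.cong refl) (simp add: algebra_simps minus_diff_add_commute)

lemma lprod_assoc4: "lprod (- t - x - y) (\<lambda>P Q x y. lprod (- s - x - y) W V P Q x y) U P Q x y =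
    lprod (- (t + s) - x - y) W (\<lambda>P Q x y. lprod (- t - x - y) V U P Q x y) P Q x y"
  unfolding wprod_def sum_distrib_left sum_distrib_right
  by (subst sum.swap, intro sum.cong refl) (simp add: algebra_simps minus_diff_add_commute)

lemma lprod_assoc5: "lprod (- s - x - y) (\<lambda>P Q x y. lprod (- t - x - y) W U P Q x y) V P Q x y =
    lprod (- (t + s) - x - y) W (\<lambda>P Q x y. lprod t U V P Q x y) P Q x y"
  unfolding wprod_def sum_distrib_left sum_distrib_right
  by (subst sum.swap, intro sum.cong refl) (simp add: algebra_simps minus_diff_add_commute)

lemma wprod_diff: "wprod w t (\<lambda>P Q x y. a P Q x y - c * a' P Q x y) b P Q x y = wprod w t a b P Q x y - c * wprod w t a' b P Q x y"
  "wprod w t a (\<lambda>P Q x y. b P Q x y - c * b' P Q x y) P Q x y = wprod w t a b P Q x y - c * wprod w t a b' P Q x y"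
  by (simp_all add: wprod_def algebra_simps sum_subtractf sum_distrib_left)

text \<open>Expansion gives four orders per double bracket. The orders UWV and VWU cancel on the
  left, the others match those on the right. All signs are built from three Koszul signs, each of
  which is 1 or -1.\<close>

lemma lbracket_Jacobi:
  "lbracket (koszul i (j + k)) t U (lbracket (koszul j k) s V W) P Q x y
   - koszul i j * lbracket (koszul j (i + k)) s V (lbracket (koszul i k) t U W) P Q x y
   = lbracket (koszul (i + j) k) (t + s) (lbracket (koszul i j) t U V) W P Q x y"
proof -
  note A = lprod_assoc[where t = t and s = s and U = U and V = V and W = W]
    lprod_assoc[where t = s and s = t and U = V and V = U and W = W]
    lprod_assoc2[where t = t and s = s and U = U and V = V and W = W]
    lprod_assoc2[where t = s and s = t and U = V and V = U and W = W]
    lprod_assoc3[where t = t and s = s and U = U and V = V and W = W]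
    lprod_assoc4[where t = t and s = s and U = U and V = V and W = W]
    lprod_assoc5[where t = t and s = s and U = U and V = V and W = W]
  show ?thesis
    unfolding lbracket_def wprod_diff A
    unfolding koszul_add_left koszul_add_right koszul_commute[of j i]
    using koszul_cases[of i j, where 'a = 'a] koszul_cases[of i k, where 'a = 'a] koszul_cases[of j k, where 'a = 'a]
    by (elim disjE) (simp_all add: algebra_simps)
qed


section \<open>Derivation, skew-symmetry and commutator formula for the products\<close>

lemma wprod_sum: "wprod w t (\<lambda>P Q x y. \<Sum>n\<in>A. c n * a n P Q x y) b P Q x y = (\<Sum>n\<in>A. c n * wprod w t (a n) b P Q x y)"
  "wprod w t b (\<lambda>P Q x y. \<Sum>n\<in>A. c n * a n P Q x y) P Q x y = (\<Sum>n\<in>A. c n * wprod w t b (a n) P Q x y)"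
proof -
  show "wprod w t (\<lambda>P Q x y. \<Sum>n\<in>A. c n * a n P Q x y) b P Q x y = (\<Sum>n\<in>A. c n * wprod w t (a n) b P Q x y)"
    unfolding wprod_def sum_distrib_left sum_distrib_right
    by (subst sum.swap, intro sum.cong refl) (simp add: mult_ac)
  show "wprod w t b (\<lambda>P Q x y. \<Sum>n\<in>A. c n * a n P Q x y) P Q x y = (\<Sum>n\<in>A. c n * wprod w t b (a n) P Q x y)"
    unfolding wprod_def sum_distrib_left sum_distrib_right
    by (subst sum.swap, intro sum.cong refl) (simp add: mult_ac)
qed

lemma lbracket_sum: "lbracket k t (\<lambda>P Q x y. \<Sum>n\<in>A. c n * a n P Q x y) b P Q x y = (\<Sum>n\<in>A. c n * lbracket k t (a n) b P Q x y)"
  "lbracket k t b (\<lambda>P Q x y. \<Sum>n\<in>A. c n * a n P Q x y) P Q x y = (\<Sum>n\<in>A. c n * lbracket k t b (a n) P Q x y)"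
  by (simp_all add: lbracket_def wprod_sum right_diff_distrib sum_subtractf sum_distrib_left mult.left_commute)

lemma lbracket_series:
  assumes "u \<in> Rd i" "v \<in> Rd j" "\<And>n. n \<ge> B \<Longrightarrow> nY K u n v = 0"
  shows "(\<Sum>n<B. t ^ n / fact n * symbol (nY K u n v) P Q x y) = lbracket (koszul i j) t (symbol u) (symbol v) P Q x y"
proof -
  have "lambda_series t (Yplus K u v) P Q x y = (\<Sum>n<B. t ^ n / fact n * symbol (nY K u n v) P Q x y)"
    by (rule lambda_series_nY) (rule assms(3))
  then show ?thesis by (simp only: lambda_series_lbracket[OF assms(1,2)])
qed

lemma subspace_whole: "RA.subspace (whole Rd)"
  unfolding whole_eq by (rule RA.subspace_span)

lemma whole_cases:
  assumes "f \<in> whole Rd"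
  obtains f0 f1 where "f0 \<in> Rd 0" "f1 \<in> Rd 1" "f = f0 + f1"
  using assms unfolding whole_def by blast

lemma nY_whole:
  assumes "u \<in> whole Rd" "v \<in> whole Rd"
  shows "nY K u n v \<in> whole Rd"
proof -
  obtain u0 u1 where u: "u0 \<in> Rd 0" "u1 \<in> Rd 1" "u = u0 + u1" using whole_cases[OF assms(1)] .
  obtain v0 v1 where v: "v0 \<in> Rd 0" "v1 \<in> Rd 1" "v = v0 + v1" using whole_cases[OF assms(2)] .
  show ?thesis
    unfolding u(3) v(3) nY_add_left nY_add_right
    by (intro RA.subspace_add[OF subspace_whole] Rd_whole[OF nY_closed]; rule u(1,2) v(1,2))
qed

lemma der_whole: "u \<in> whole Rd \<Longrightarrow> der u \<in> whole Rd"
proof -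
  assume "u \<in> whole Rd"
  then obtain u0 u1 where u: "u0 \<in> Rd 0" "u1 \<in> Rd 1" "u = u0 + u1" using whole_cases by blast
  show ?thesis
    unfolding u(3) der_add
    by (intro RA.subspace_add[OF subspace_whole] Rd_whole[OF der_closed]; rule u(1,2))
qed

text \<open>The factor x+y of \<open>der u\<close> is evaluated at (x, -t-x) in the direct term and
  at (-t-y, y) in the commuted one, and is -t in both. Multiplication by -t shifts the index of the
  product. For n = 0 the truncated n - 1 does no harm, as its coefficient is 0.\<close>

lemma nY_der:
  assumes u: "u \<in> whole Rd" and v: "v \<in> whole Rd"
  shows "nY K (der u) n v = smul (- of_nat n) (nY K u (n - 1) v)"
proof (rule symbol_eqI)
  note uV = subsetD[OF whole_block_span u] and vV = subsetD[OF whole_block_span v]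
  note duV = subsetD[OF whole_block_span der_whole[OF u]]
  show "nY K (der u) n v \<in> block_span"
    by (intro subsetD[OF whole_block_span] nY_whole der_whole u v)
  show "smul (- of_nat n) (nY K u (n - 1) v) \<in> block_span"
    by (intro subsetD[OF whole_block_span] RA.subspace_scale[OF subspace_whole] nY_whole u v)
  fix P Q x y
  obtain B1 where B1: "\<And>n. n \<ge> B1 \<Longrightarrow> nY K (der u) n v = 0" using nY_bound by blast
  obtain B2 where B2: "\<And>n. n \<ge> B2 \<Longrightarrow> nY K u n v = 0" using nY_bound by blast
  define B where "B = B1 + B2 + n"
  \<comment> \<open>Multiplication by t raises the degree, so the series of \<open>der u\<close>
    gets one more term than that of u.\<close>
  have b1: "m \<ge> Suc B \<Longrightarrow> nY K (der u) m v = 0" for m using B1 by (simp add: B_def)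
  have b2: "m \<ge> B \<Longrightarrow> nY K u m v = 0" for m using B2 by (simp add: B_def)
  have "(\<Sum>m<Suc B. t ^ m / fact m * symbol (nY K (der u) m v) P Q x y)
      = (\<Sum>m<Suc B. t ^ m / fact m * (- of_nat m * symbol (nY K u (m - 1) v) P Q x y))" for t
  proof -
    have "(\<Sum>m<Suc B. t ^ m / fact m * symbol (nY K (der u) m v) P Q x y) = lambda_series t (Yplus K (der u) v) P Q x y"
      by (rule lambda_series_nY[OF b1, symmetric])
    also have "\<dots> = - t * lambda_series t (Yplus K u v) P Q x y"
      unfolding lambda_series_formula[OF duV vV] lambda_series_formula[OF uV vV] wprod_def symbol_der[OF uV] right_diff_distrib sum_distrib_left
      by (intro arg_cong2[where f = "(-)"] sum.cong refl) (simp_all add: mult_ac)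
    also have "lambda_series t (Yplus K u v) P Q x y = (\<Sum>m<B. t ^ m / fact m * symbol (nY K u m v) P Q x y)"
      by (rule lambda_series_nY[OF b2])
    also have "- t * (\<Sum>m<B. t ^ m / fact m * symbol (nY K u m v) P Q x y) =
       (\<Sum>m<B. t ^ Suc m / fact (Suc m) * (- of_nat (Suc m) * symbol (nY K u (Suc m - 1) v) P Q x y))"
      unfolding sum_distrib_left
    proof (rule sum.cong)
      fix m
      have "t ^ Suc m / fact (Suc m) * (- of_nat (Suc m)) = - t * (t ^ m / fact m)"
        by (simp add: field_simps del: of_nat_Suc)
      then show "- t * (t ^ m / fact m * symbol (nY K u m v) P Q x y) =
         t ^ Suc m / fact (Suc m) * (- of_nat (Suc m) * symbol (nY K u (Suc m - 1) v) P Q x y)"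
        by (metis diff_Suc_1 mult.assoc)
    qed simp
    also have "\<dots> = (\<Sum>m<Suc B. t ^ m / fact m * (- of_nat m * symbol (nY K u (m - 1) v) P Q x y))"
      by (subst sum.lessThan_Suc_shift) (simp del: of_nat_Suc fact_Suc power_Suc)
    finally show ?thesis .
  qed
  then have "symbol (nY K (der u) n v) P Q x y = - of_nat n * symbol (nY K u (n - 1) v) P Q x y"
    by (rule exp_coeff_eq) (simp add: B_def)
  then show "symbol (nY K (der u) n v) P Q x y = symbol (smul (- of_nat n) (nY K u (n - 1) v)) P Q x y"
    by (simp only: symbol_smul)
qed

lemma symbol_der_pow: "f \<in> whole Rd \<Longrightarrow> (der ^^ k) f \<in> whole Rd \<and> symbol ((der ^^ k) f) P Q x y = (x + y) ^ k * symbol f P Q x y"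
  by (induction k) (use whole_block_span in \<open>auto simp: der_whole symbol_der[OF subsetD[OF whole_block_span]] mult_ac\<close>)

lemma der_pow_zero [simp]: "(der ^^ k) 0 = 0"
  by (induction k) simp_all

lemma lbracket_skew: "lbracket k t a b P Q x y = - k * lbracket k (- t - x - y) b a P Q x y" if "k * k = 1"
proof -
  have 1: "- (- t - x - y) - x - y = t" by simp
  have "k * (k * lprod t a b P Q x y) = lprod t a b P Q x y" using that by (metis mult.assoc mult_1)
  then show ?thesis unfolding lbracket_def 1 by (simp add: right_diff_distrib)
qed

lemma koszul_sq: "koszul i j * koszul i j = (1 :: 'a)"
  by (simp add: koszul_bit)

text \<open>On symbols skew-symmetry replaces t by -t-x-y. Expanding the powers of -(t + (x+y)) by
  the binomial theorem separates t^m from (x+y)^k, and the latter is the action of the k-th power of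
  the derivation. The additional sign in the exponent m+k+1 is the minus sign of
  \<open>lbracket_skew\<close>.\<close>

lemma nY_skew:
  assumes u: "u \<in> Rd i" and v: "v \<in> Rd j"
  shows "nY K u m v = smul (koszul i j)
     (\<Sum>k | nY K v (m + k) u \<noteq> 0. smul ((- 1) ^ (m + k + 1) / fact k) ((der ^^ k) (nY K v (m + k) u)))"
proof -
  obtain B1 where B1: "\<And>n. n \<ge> B1 \<Longrightarrow> nY K u n v = 0" using nY_bound by blast
  obtain B2 where B2: "\<And>n. n \<ge> B2 \<Longrightarrow> nY K v n u = 0" using nY_bound by blast
  define B where "B = B1 + B2 + m + 1"
  have b1: "n \<ge> B \<Longrightarrow> nY K u n v = 0" for n using B1 by (simp add: B_def)
  have b2: "n \<ge> B \<Longrightarrow> nY K v n u = 0" for n using B2 by (simp add: B_def)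
  define rhs where "rhs m = smul (koszul i j)
     (\<Sum>k<B. smul ((- 1) ^ (m + k + 1) / fact k) ((der ^^ k) (nY K v (m + k) u)))" for m
  have vu: "nY K v n u \<in> whole Rd" for n
    by (rule nY_whole[OF Rd_whole[OF v] Rd_whole[OF u]])
  have "(\<Sum>k | nY K v (m + k) u \<noteq> 0. smul ((- 1) ^ (m + k + 1) / fact k) ((der ^^ k) (nY K v (m + k) u)))
     = (\<Sum>k<B. smul ((- 1) ^ (m + k + 1) / fact k) ((der ^^ k) (nY K v (m + k) u)))"
  proof (rule sum.mono_neutral_left)
    show "{k. nY K v (m + k) u \<noteq> 0} \<subseteq> {..<B}"
    proof
      fix k assume "k \<in> {k. nY K v (m + k) u \<noteq> 0}"
      then have "\<not> m + k \<ge> B" using b2 by blast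
      then show "k \<in> {..<B}" by simp
    qed
  qed auto
  then have goal: "smul (koszul i j)
     (\<Sum>k | nY K v (m + k) u \<noteq> 0. smul ((- 1) ^ (m + k + 1) / fact k) ((der ^^ k) (nY K v (m + k) u))) = rhs m"
    by (simp only: rhs_def)
  show ?thesis
    unfolding goal
  proof (rule symbol_eqI)
    show "nY K u m v \<in> block_span" by (rule Rd_block_span[OF nY_closed[OF u v]])
    show "rhs m \<in> block_span"
      unfolding rhs_def
      by (intro subsetD[OF whole_block_span] RA.subspace_scale[OF subspace_whole] RA.subspace_sum[OF subspace_whole]
         symbol_der_pow[THEN conjunct1] vu)
    fix P Q x y
    have rhs: "symbol (rhs n) P Q x y = koszul i j *
        (\<Sum>k<B. (- 1) ^ (n + k + 1) / fact k * ((x + y) ^ k * symbol (nY K v (n + k) u) P Q x y))" for n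
      unfolding rhs_def symbol_smul symbol_sum using symbol_der_pow[OF vu] by simp
    have "(\<Sum>n<B. t ^ n / fact n * symbol (nY K u n v) P Q x y) = (\<Sum>n<B. t ^ n / fact n * symbol (rhs n) P Q x y)" for t
    proof -
      let ?F = "\<lambda>n k. t ^ n / fact n * ((x + y) ^ k / fact k) * ((- 1) ^ (n + k) * symbol (nY K v (n + k) u) P Q x y)"
      have "(\<Sum>n<B. t ^ n / fact n * symbol (nY K u n v) P Q x y) = lbracket (koszul i j) t (symbol u) (symbol v) P Q x y"
        by (rule lbracket_series[OF u v b1])
      also have "\<dots> = - koszul i j * lbracket (koszul j i) (- t - x - y) (symbol v) (symbol u) P Q x y"
        unfolding koszul_commute[of j i] by (rule lbracket_skew[OF koszul_sq])
      also have "lbracket (koszul j i) (- t - x - y) (symbol v) (symbol u) P Q x y =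
          (\<Sum>n<B. (- t - x - y) ^ n / fact n * symbol (nY K v n u) P Q x y)"
        by (rule lbracket_series[OF v u b2, symmetric])
      also have "\<dots> = (\<Sum>n<B. \<Sum>i\<le>n. ?F i (n - i))"
      proof (rule sum.cong)
        fix n
        have "- t - x - y = (- 1) * (t + (x + y))" by simp
        then have "(- t - x - y) ^ n = (- 1) ^ n * (t + (x + y)) ^ n"
          by (metis power_mult_distrib)
        then have "(- t - x - y) ^ n / fact n = (- 1) ^ n * (\<Sum>i\<le>n. t ^ i / fact i * ((x + y) ^ (n - i) / fact (n - i)))"
          unfolding exp_binomial by simp
        then show "(- t - x - y) ^ n / fact n * symbol (nY K v n u) P Q x y = (\<Sum>i\<le>n. ?F i (n - i))"
          by (simp add: sum_distrib_left sum_distrib_right mult_ac)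
      qed simp
      also have "\<dots> = (\<Sum>n<B. \<Sum>k<B. ?F n k)"
        by (rule triangle_sum) (simp add: b2)
      also have "- koszul i j * \<dots> = (\<Sum>n<B. t ^ n / fact n * symbol (rhs n) P Q x y)"
        unfolding rhs sum_distrib_left
        by (intro sum.cong refl) (simp add: mult_ac)
      finally show ?thesis .
    qed
    then show "symbol (nY K u m v) P Q x y = symbol (rhs m) P Q x y"
      by (rule exp_coeff_eq) (simp add: B_def)
  qed
qed

text \<open>Only finitely many n give a nonzero inner product; the sum of their individual bounds
  dominates each of them.\<close>

lemma nY_nY_bound: "\<exists>B. \<forall>m n. m \<ge> B \<or> n \<ge> B \<longrightarrow> nY K u m (nY K v n w) = 0"
proof -
  obtain B1 where B1: "\<And>n. n \<ge> B1 \<Longrightarrow> nY K v n w = 0" using nY_bound by blast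
  have "\<forall>n. \<exists>b. \<forall>m\<ge>b. nY K u m (nY K v n w) = 0" using nY_bound by blast
  from choice[OF this] obtain b where b: "\<And>n m. m \<ge> b n \<Longrightarrow> nY K u m (nY K v n w) = 0" by blast
  define B where "B = B1 + (\<Sum>n<B1. b n)"
  have "nY K u m (nY K v n w) = 0" if "m \<ge> B \<or> n \<ge> B" for m n
  proof (cases "n \<ge> B1")
    case True
    then show ?thesis using B1 by simp
  next
    case False
    then have "b n \<le> (\<Sum>n<B1. b n)" by (intro member_le_sum) auto
    then have "m \<ge> b n" using that False by (auto simp: B_def)
    then show ?thesis by (rule b)
  qed
  then show ?thesis by blast
qed

lemma nY_nY_bound_left: "\<exists>B. \<forall>l r. l \<ge> B \<or> r \<ge> B \<longrightarrow> nY K (nY K u l v) r w = 0"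
proof -
  obtain B1 where B1: "\<And>n. n \<ge> B1 \<Longrightarrow> nY K u n v = 0" using nY_bound by blast
  have "\<forall>n. \<exists>b. \<forall>m\<ge>b. nY K (nY K u n v) m w = 0" using nY_bound by blast
  from choice[OF this] obtain b where b: "\<And>n m. m \<ge> b n \<Longrightarrow> nY K (nY K u n v) m w = 0" by blast
  define B where "B = B1 + (\<Sum>n<B1. b n)"
  have "nY K (nY K u n v) m w = 0" if "n \<ge> B \<or> m \<ge> B" for m n
  proof (cases "n \<ge> B1")
    case True
    then show ?thesis using B1 by simp
  next
    case False
    then have "b n \<le> (\<Sum>n<B1. b n)" by (intro member_le_sum) auto
    then have "m \<ge> b n" using that False by (auto simp: B_def)
    then show ?thesis by (rule b)
  qed
  then show ?thesis by blast
qed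

text \<open>Expand (t+s)^r into t^i s^n and collect the powers t^(l+i). The divided powers of t
  multiply with the factor binom(l+i, l), which is the binomial of the commutator formula.\<close>

lemma commutator_reindex:
  fixes g :: "nat \<Rightarrow> nat \<Rightarrow> 'b::field_char_0"
  assumes g: "\<And>l r. l \<ge> B \<or> r \<ge> B \<Longrightarrow> g l r = 0" and N: "N \<ge> 2 * B"
  shows "(\<Sum>l<N. t ^ l / fact l * (\<Sum>r<N. (t + s) ^ r / fact r * g l r)) =
    (\<Sum>m<N. t ^ m / fact m * (\<Sum>n<N. s ^ n / fact n * (\<Sum>l\<le>m. of_nat (m choose l) * g l (m - l + n))))"
proof -
  have "(\<Sum>r<N. (t + s) ^ r / fact r * g l r) = (\<Sum>i<N. \<Sum>n<N. t ^ i / fact i * (s ^ n / fact n) * g l (i + n))" for l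
  proof -
    have "(\<Sum>r<N. (t + s) ^ r / fact r * g l r) = (\<Sum>r<N. \<Sum>i\<le>r. t ^ i / fact i * (s ^ (r - i) / fact (r - i)) * g l (i + (r - i)))"
      by (intro sum.cong refl) (simp add: exp_binomial[symmetric] sum_distrib_right)
    also have "\<dots> = (\<Sum>i<N. \<Sum>n<N. t ^ i / fact i * (s ^ n / fact n) * g l (i + n))"
      by (rule triangle_sum) (use g N in simp)
    finally show ?thesis .
  qed
  then have "(\<Sum>l<N. t ^ l / fact l * (\<Sum>r<N. (t + s) ^ r / fact r * g l r)) =
     (\<Sum>l<N. \<Sum>i<N. t ^ l / fact l * (t ^ i / fact i) * (\<Sum>n<N. s ^ n / fact n * g l (i + n)))"
    by (simp add: sum_distrib_left mult.assoc)
  also have "\<dots> = (\<Sum>m<N. \<Sum>l\<le>m. t ^ l / fact l * (t ^ (m - l) / fact (m - l)) * (\<Sum>n<N. s ^ n / fact n * g l (m - l + n)))"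
  proof (rule triangle_sum[symmetric])
    fix l i assume "l + i \<ge> N"
    \<comment> \<open>This is the reason for N being at least 2 B: beyond the triangle one of the
      two indices reaches B, and the term vanishes.\<close>
    then have "l \<ge> B \<or> i \<ge> B" using N by auto
    then have "g l (i + n) = 0" for n using g by (auto simp: trans_le_add1)
    then show "t ^ l / fact l * (t ^ i / fact i) * (\<Sum>n<N. s ^ n / fact n * g l (i + n)) = 0" by simp
  qed
  also have "\<dots> = (\<Sum>m<N. t ^ m / fact m * (\<Sum>n<N. s ^ n / fact n * (\<Sum>l\<le>m. of_nat (m choose l) * g l (m - l + n))))"
  proof (intro sum.cong refl)
    fix m
    have c: "t ^ l / fact l * (t ^ (m - l) / fact (m - l)) = t ^ m / fact m * of_nat (m choose l)" if "l \<le> m" for l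
      using that by (simp add: binomial_fact power_add[symmetric])
    have "(\<Sum>l\<le>m. t ^ l / fact l * (t ^ (m - l) / fact (m - l)) * (\<Sum>n<N. s ^ n / fact n * g l (m - l + n))) =
       (\<Sum>l\<le>m. t ^ m / fact m * of_nat (m choose l) * (\<Sum>n<N. s ^ n / fact n * g l (m - l + n)))"
      by (intro sum.cong refl) (simp only: c atMost_iff)
    also have "\<dots> = t ^ m / fact m * (\<Sum>l\<le>m. \<Sum>n<N. s ^ n / fact n * (of_nat (m choose l) * g l (m - l + n)))"
      by (simp add: sum_distrib_left mult_ac)
    also have "\<dots> = t ^ m / fact m * (\<Sum>n<N. s ^ n / fact n * (\<Sum>l\<le>m. of_nat (m choose l) * g l (m - l + n)))"
      by (subst sum.swap) (simp add: sum_distrib_left)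
    finally show "(\<Sum>l\<le>m. t ^ l / fact l * (t ^ (m - l) / fact (m - l)) * (\<Sum>n<N. s ^ n / fact n * g l (m - l + n))) =
      t ^ m / fact m * (\<Sum>n<N. s ^ n / fact n * (\<Sum>l\<le>m. of_nat (m choose l) * g l (m - l + n)))" .
  qed
  finally show ?thesis .
qed

text \<open>This is the coefficient of t^m s^n in the Jacobi identity of the lambda-brackets with
  parameters t, s and t+s. The bound N is large enough for every inner and outer series, so each
  bracket is a finite sum.\<close>

lemma nY_commutator_homogeneous:
  assumes u: "u \<in> Rd i" and v: "v \<in> Rd j" and w: "w \<in> Rd k"
  shows "nY K u m (nY K v n w) - smul (koszul i j) (nY K v n (nY K u m w)) =
     (\<Sum>l\<le>m. smul (of_nat (m choose l)) (nY K (nY K u l v) (m - l + n) w))"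
proof -
  obtain B1 where B1: "\<And>m n. m \<ge> B1 \<or> n \<ge> B1 \<Longrightarrow> nY K u m (nY K v n w) = 0" using nY_nY_bound by blast
  obtain B2 where B2: "\<And>m n. m \<ge> B2 \<or> n \<ge> B2 \<Longrightarrow> nY K v m (nY K u n w) = 0" using nY_nY_bound by blast
  obtain B3 where B3: "\<And>m n. m \<ge> B3 \<or> n \<ge> B3 \<Longrightarrow> nY K (nY K u m v) n w = 0" using nY_nY_bound_left by blast
  obtain C1 where C1: "\<And>n. n \<ge> C1 \<Longrightarrow> nY K v n w = 0" using nY_bound by blast
  obtain C2 where C2: "\<And>n. n \<ge> C2 \<Longrightarrow> nY K u n w = 0" using nY_bound by blast
  obtain C3 where C3: "\<And>n. n \<ge> C3 \<Longrightarrow> nY K u n v = 0" using nY_bound by blast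
  define N where "N = B1 + B2 + 2 * B3 + C1 + C2 + C3 + m + n + 1"
  note vw = nY_closed[OF v w] and uw = nY_closed[OF u w] and uv = nY_closed[OF u v]
  show ?thesis
  proof (rule symbol_eqI)
    show "nY K u m (nY K v n w) - smul (koszul i j) (nY K v n (nY K u m w)) \<in> block_span"
      by (intro RA.subspace_diff[OF subspace_block_span] RA.subspace_scale[OF subspace_block_span] Rd_block_span[OF nY_closed[OF u vw]] Rd_block_span[OF nY_closed[OF v uw]])
    show "(\<Sum>l\<le>m. smul (of_nat (m choose l)) (nY K (nY K u l v) (m - l + n) w)) \<in> block_span"
      by (intro RA.subspace_sum[OF subspace_block_span] RA.subspace_scale[OF subspace_block_span] Rd_block_span[OF nY_closed[OF uv w]])
    fix P Q x y
    let ?a = "\<lambda>m n. symbol (nY K u m (nY K v n w)) P Q x y"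
    let ?b = "\<lambda>m n. symbol (nY K v n (nY K u m w)) P Q x y"
    let ?g = "\<lambda>l r. symbol (nY K (nY K u l v) r w) P Q x y"
    let ?c = "\<lambda>m n. \<Sum>l\<le>m. of_nat (m choose l) * ?g l (m - l + n)"
    have main: "(\<Sum>m<N. t ^ m / fact m * (\<Sum>n<N. s ^ n / fact n * (?a m n - koszul i j * ?b m n))) =
       (\<Sum>m<N. t ^ m / fact m * (\<Sum>n<N. s ^ n / fact n * ?c m n))" for t s
    proof -
      have "(\<Sum>m<N. t ^ m / fact m * (\<Sum>n<N. s ^ n / fact n * ?a m n)) =
          (\<Sum>n<N. s ^ n / fact n * (\<Sum>m<N. t ^ m / fact m * ?a m n))"
        unfolding sum_distrib_left by (subst sum.swap) (simp add: mult_ac)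
      also have "\<dots> = (\<Sum>n<N. s ^ n / fact n * lbracket (koszul i (j + k)) t (symbol u) (symbol (nY K v n w)) P Q x y)"
        by (intro sum.cong refl arg_cong2[where f = "(*)"] lbracket_series[OF u vw] B1) (auto simp: N_def)
      also have "\<dots> = lbracket (koszul i (j + k)) t (symbol u) (\<lambda>P Q x y. \<Sum>n<N. s ^ n / fact n * symbol (nY K v n w) P Q x y) P Q x y"
        by (simp only: lbracket_sum)
      also have "(\<lambda>P Q x y. \<Sum>n<N. s ^ n / fact n * symbol (nY K v n w) P Q x y) = lbracket (koszul j k) s (symbol v) (symbol w)"
        by (intro ext lbracket_series[OF v w] C1) (auto simp: N_def)
      finally have a: "(\<Sum>m<N. t ^ m / fact m * (\<Sum>n<N. s ^ n / fact n * ?a m n)) =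
         lbracket (koszul i (j + k)) t (symbol u) (lbracket (koszul j k) s (symbol v) (symbol w)) P Q x y" .
      have "(\<Sum>m<N. t ^ m / fact m * (\<Sum>n<N. s ^ n / fact n * ?b m n)) =
          (\<Sum>m<N. t ^ m / fact m * lbracket (koszul j (i + k)) s (symbol v) (symbol (nY K u m w)) P Q x y)"
        by (intro sum.cong refl arg_cong2[where f = "(*)"] lbracket_series[OF v uw] B2) (auto simp: N_def)
      also have "\<dots> = lbracket (koszul j (i + k)) s (symbol v) (\<lambda>P Q x y. \<Sum>m<N. t ^ m / fact m * symbol (nY K u m w) P Q x y) P Q x y"
        by (simp only: lbracket_sum)
      also have "(\<lambda>P Q x y. \<Sum>m<N. t ^ m / fact m * symbol (nY K u m w) P Q x y) = lbracket (koszul i k) t (symbol u) (symbol w)"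
        by (intro ext lbracket_series[OF u w] C2) (auto simp: N_def)
      finally have b: "(\<Sum>m<N. t ^ m / fact m * (\<Sum>n<N. s ^ n / fact n * ?b m n)) =
         lbracket (koszul j (i + k)) s (symbol v) (lbracket (koszul i k) t (symbol u) (symbol w)) P Q x y" .
      have "(\<Sum>l<N. t ^ l / fact l * (\<Sum>r<N. (t + s) ^ r / fact r * ?g l r)) =
         (\<Sum>l<N. t ^ l / fact l * lbracket (koszul (i + j) k) (t + s) (symbol (nY K u l v)) (symbol w) P Q x y)"
        by (intro sum.cong refl arg_cong2[where f = "(*)"] lbracket_series[OF uv w] B3) (auto simp: N_def)
      also have "\<dots> = lbracket (koszul (i + j) k) (t + s) (\<lambda>P Q x y. \<Sum>l<N. t ^ l / fact l * symbol (nY K u l v) P Q x y) (symbol w) P Q x y"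
        by (simp only: lbracket_sum)
      also have "(\<lambda>P Q x y. \<Sum>l<N. t ^ l / fact l * symbol (nY K u l v) P Q x y) = lbracket (koszul i j) t (symbol u) (symbol v)"
        by (intro ext lbracket_series[OF u v] C3) (auto simp: N_def)
      finally have c: "(\<Sum>l<N. t ^ l / fact l * (\<Sum>r<N. (t + s) ^ r / fact r * ?g l r)) =
         lbracket (koszul (i + j) k) (t + s) (lbracket (koszul i j) t (symbol u) (symbol v)) (symbol w) P Q x y" .
      have "(\<Sum>m<N. t ^ m / fact m * (\<Sum>n<N. s ^ n / fact n * (?a m n - koszul i j * ?b m n))) =
         (\<Sum>m<N. t ^ m / fact m * (\<Sum>n<N. s ^ n / fact n * ?a m n)) -
         koszul i j * (\<Sum>m<N. t ^ m / fact m * (\<Sum>n<N. s ^ n / fact n * ?b m n))"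
        by (simp add: right_diff_distrib sum_subtractf sum_distrib_left mult_ac)
      also have "\<dots> = (\<Sum>l<N. t ^ l / fact l * (\<Sum>r<N. (t + s) ^ r / fact r * ?g l r))"
        unfolding a b c by (rule lbracket_Jacobi)
      also have "\<dots> = (\<Sum>m<N. t ^ m / fact m * (\<Sum>n<N. s ^ n / fact n * ?c m n))"
        by (rule commutator_reindex[of B3]) (simp_all add: B3 N_def)
      finally show ?thesis .
    qed
    have "(\<Sum>n<N. s ^ n / fact n * (?a m n - koszul i j * ?b m n)) = (\<Sum>n<N. s ^ n / fact n * ?c m n)" for s
      by (rule exp_coeff_eq[where n = m and B = N, OF main]) (simp add: N_def)
    then have "?a m n - koszul i j * ?b m n = ?c m n"
      by (rule exp_coeff_eq) (simp add: N_def)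
    then show "symbol (nY K u m (nY K v n w) - smul (koszul i j) (nY K v n (nY K u m w))) P Q x y =
      symbol (\<Sum>l\<le>m. smul (of_nat (m choose l)) (nY K (nY K u l v) (m - l + n) w)) P Q x y"
      by (simp only: symbol_minus symbol_smul symbol_sum)
  qed
qed

lemma nY_commutator:
  assumes u: "u \<in> Rd i" and v: "v \<in> Rd j" and w: "w \<in> whole Rd"
  shows "nY K u m (nY K v n w) - smul (koszul i j) (nY K v n (nY K u m w)) =
     (\<Sum>l\<le>m. smul (of_nat (m choose l)) (nY K (nY K u l v) (m - l + n) w))"
proof -
  obtain w0 w1 where w': "w0 \<in> Rd 0" "w1 \<in> Rd 1" "w = w0 + w1" using whole_cases[OF w] .
  have "nY K u m (nY K v n w) - smul (koszul i j) (nY K v n (nY K u m w)) =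
     (nY K u m (nY K v n w0) - smul (koszul i j) (nY K v n (nY K u m w0))) +
     (nY K u m (nY K v n w1) - smul (koszul i j) (nY K v n (nY K u m w1)))"
    by (simp only: w'(3) nY_add_right RA.scale_right_distrib add_diff_add)
  also have "\<dots> = (\<Sum>l\<le>m. smul (of_nat (m choose l)) (nY K (nY K u l v) (m - l + n) w))"
    by (simp only: nY_commutator_homogeneous[OF u v w'(1)] nY_commutator_homogeneous[OF u v w'(2)]
      w'(3) nY_add_right RA.scale_right_distrib sum.distrib)
  finally show ?thesis .
qed

lemma binomial_sign:
  assumes "l \<le> m"
  shows "((- of_nat l - 1) gchoose (m - l)) * (- 1) ^ (m - l) = (of_nat (m choose l) :: 'b::field_char_0)"
proof -
  have sq: "(- 1) ^ (m - l) * (- 1) ^ (m - l) = (1 :: 'b)"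
    by (simp only: power_mult_distrib[symmetric]) simp
  have "((- of_nat l - 1) gchoose (m - l)) = (- 1) ^ (m - l) * (of_nat m gchoose (m - l) :: 'b)"
    using assms by (subst gbinomial_negated_upper) (simp add: of_nat_diff)
  also have "of_nat m gchoose (m - l) = (of_nat (m choose l) :: 'b)"
    by (simp only: binomial_gbinomial[symmetric] binomial_symmetric[OF assms, symmetric])
  finally show ?thesis using sq by (simp only: mult.commute mult.left_commute mult_1)
qed

lemma conformal_Rdagger: "conformal_superalgebra smul Rd der (Yplus K)"
proof (intro conformal_superalgebra.intro RA.vector_space_axioms conformal_superalgebra_axioms.intro)
  show "RA.subspace (Rd i)" for i by (rule subspace_Rd)
  show "Rd 0 \<inter> Rd 1 = {0}"
  proof -
    have "f = 0" if "f \<in> Rd 0" "f \<in> Rd 1" for f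
    proof (rule symbol_eqI)
      show "f \<in> block_span" "0 \<in> block_span" using Rd_block_span[OF that(1)] RA.subspace_0[OF subspace_block_span] by simp_all
      fix P Q x y
      show "symbol f P Q x y = symbol 0 P Q x y"
        using symbol_homogeneous[OF that(1), of P Q] symbol_homogeneous[OF that(2), of P Q]
        by (cases "block P + block Q = 0") auto
    qed
    then show ?thesis using RA.subspace_0[OF subspace_Rd] by blast
  qed
  show "u \<in> Rd i \<Longrightarrow> der u \<in> Rd i" for u i by (rule der_closed)
  show "der (u + v) = der u + der v" for u v :: "'a RA" by (rule der_add)
  show "der (smul c u) = smul c (der u)" for u :: "'a RA" and c by (rule der_smul)
  show "Yplus K (u + u') v = Yplus K u v + Yplus K u' v" for u u' v :: "'a RA" by (rule Yplus_add_left)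
  show "Yplus K u (v + v') = Yplus K u v + Yplus K u v'" for u v v' :: "'a RA" by (rule Yplus_add_right)
  show "lookup (Yplus K (smul c u) v) z = smul c (lookup (Yplus K u v) z)" for u v :: "'a RA" and c z
    by (rule lookup_Yplus_smul_left)
  show "lookup (Yplus K u (smul c v)) z = smul c (lookup (Yplus K u v) z)" for u v :: "'a RA" and c z
    by (rule lookup_Yplus_smul_right)
  show "lookup (Yplus K u v) z = 0" if "0 \<le> z" for u v :: "'a RA" and z
    using that by (rule lookup_Yplus_polar)
  have nY_lookup: "lookup (Yplus K u v) z = (if z < 0 then nY K u (nat (- z - 1)) v else 0)" for u v :: "'a RA" and z
    by (simp add: nprod_def lookup_Yplus_polar)
  show "lookup (Yplus K u v) z \<in> Rd (i + j)" if "u \<in> Rd i" "v \<in> Rd j" for u v z i j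
    unfolding nY_lookup using nY_closed[OF that] RA.subspace_0[OF subspace_Rd] by simp
  show "lookup (Yplus K (der u) v) z = smul (of_int (z + 1)) (lookup (Yplus K u v) (z + 1))"
    if "u \<in> whole Rd" "v \<in> whole Rd" for u v z
  \<comment> \<open>At z = -1, where n = 0, both sides vanish: the right one through its factor z+1,
    the left one by \<open>nY_der\<close>. For z at least 0 only polar parts are involved.\<close>
  proof (cases "z < -1")
    case True
    define n where "n = nat (- z - 1)"
    have z: "z = - int n - 1" "n \<ge> 1" using True by (simp_all add: n_def)
    have "nat (- (z + 1) - 1) = n - 1" "z + 1 = - int n" using z by simp_all
    then show ?thesis
      using True nY_der[OF that, of n] by (simp add: nY_lookup n_def[symmetric])
  next
    case False
    then show ?thesis
      using nY_der[OF that, of 0] by (cases "z = -1") (simp_all add: nY_lookup)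
  qed
  show "nY K u m v = smul (koszul i j) (\<Sum>k | nY K v (m + k) u \<noteq> 0.
      smul ((- 1) ^ (m + k + 1) / fact k) ((der ^^ k) (nY K v (m + k) u)))"
    if "u \<in> Rd i" "v \<in> Rd j" for u i v j m
    by (rule nY_skew[OF that])
  show "nY K u m (nY K v n w) - smul (koszul i j) (nY K v n (nY K u m w)) =
      (\<Sum>l\<le>m. smul (((- of_nat l - 1) gchoose (m - l)) * (- 1) ^ (m - l)) (nY K (nY K u l v) (m - l + n) w))"
    if "u \<in> Rd i" "v \<in> Rd j" "w \<in> whole Rd" for u i v j w m n
    unfolding nY_commutator[OF that] by (intro sum.cong refl) (simp add: binomial_sign)
qed


section \<open>Generation by the weight 3/2 subspace\<close>

lemma contraction_coeff_zero: "contraction_coeff 0 0 0 n i = (if i \<le> n then 1 else 0)"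
  by (simp add: contraction_coeff_def)

lemma sigma_same: "block p = 0 \<Longrightarrow> sigma p p = 1" "block p = 1 \<Longrightarrow> sigma p p = - 1"
  by (simp_all add: sigma_def koszul_bit)

lemma sigma_dual_right: "p \<in> {1..K} \<Longrightarrow> block p = 1 \<Longrightarrow> sigma p (dual p) = 1" 
  by (simp add: sigma_def koszul_bit)

lemma sigma_commute: "sigma p q = sigma q p"
  by (simp add: sigma_def koszul_commute mult.commute mult.left_commute)

lemma exists_block0: "\<exists>a. a \<in> {1..K} \<and> block a = 0"
  using l1_pos by (intro exI[of _ 1]) (simp add: block_def)

lemma exists_block1: "\<exists>b. b \<in> {1..K} \<and> block b = 1"
  using l2_pos by (intro exI[of _ "2 * l1 + 1"]) (simp add: block_def)

text \<open>Of three distinct candidates in the first block at most two are excluded by a and its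
  dual.\<close>

lemma exists_other0:
  assumes "l1 \<ge> 2" "a \<in> {1..K}"
  shows "\<exists>b. b \<in> {1..K} \<and> block b = 0 \<and> b \<noteq> a \<and> dual a \<noteq> b"
proof -
  have "\<exists>b\<in>{1, 2, l1 + 1 :: nat}. b \<noteq> a \<and> dual a \<noteq> b"
    using assms by (auto simp: dual_def)
  then obtain b where b: "b \<in> {1, 2, l1 + 1 :: nat}" "b \<noteq> a" "dual a \<noteq> b" by blast
  have "b \<in> {1..K}" "block b = 0" using b(1) assms(1) by (auto simp: block_def)
  then show ?thesis using b by blast
qed

lemma exists_other1:
  assumes "l2 \<ge> 2" "a \<in> {1..K}"
  shows "\<exists>b. b \<in> {1..K} \<and> block b = 1 \<and> b \<noteq> a \<and> dual a \<noteq> b"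
proof -
  have "\<exists>b\<in>{2 * l1 + 1, 2 * l1 + 2, 2 * l1 + l2 + 1}. b \<noteq> a \<and> dual a \<noteq> b"
    using assms l1_pos by (auto simp: dual_def)
  then obtain b where b: "b \<in> {2 * l1 + 1, 2 * l1 + 2, 2 * l1 + l2 + 1}" "b \<noteq> a" "dual a \<noteq> b" by blast
  have "b \<in> {1..K}" "block b = 1" using b(1) assms(1) by (auto simp: block_def)
  then show ?thesis using b by blast
qed

lemma subspace_cancel:
  assumes "RA.subspace W" "smul c x \<in> W" "c \<noteq> 0"
  shows "x \<in> W"
proof -
  have "smul (1 / c) (smul c x) \<in> W" by (rule RA.subspace_scale[OF assms(1,2)])
  then show ?thesis using assms(3) by simp
qed

lemma T_subspace_sym:
  assumes "RA.subspace W" "p \<in> {1..K}" "q \<in> {1..K}" "T p q m n \<in> W"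
  shows "T (dual q) (dual p) n m \<in> W"
  unfolding T_sym[OF assms(2,3)] by (rule RA.subspace_scale[OF assms(1,4)])

lemma single_contraction:
  assumes I: "p \<in> {1..K}" "q \<in> {1..K}" "s \<in> {1..K}" and c: "q \<noteq> dual s" "dual p \<noteq> q" "p \<noteq> s"
  shows "nY K (T p q m1 m2) n (T q s n1 n2) =
    smul (contraction_coeff (block_degree q) m1 m2 n1 n) (T p s (m1 + m2 + n1 + block_degree q - n) n2)"
  using c by (simp only: nY_T[OF I(1,2,2,3)] if_True if_False simp_thms add_0_right)

lemma no_contraction:
  assumes I: "p \<in> {1..K}" "q \<in> {1..K}" "r \<in> {1..K}" "s \<in> {1..K}"
    and c: "q \<noteq> r" "q \<noteq> dual s" "dual p \<noteq> r" "p \<noteq> s"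
  shows "nY K (T p q m1 m2) n (T r s n1 n2) = 0"
  using c by (simp only: nY_T[OF I] if_True if_False simp_thms add_0_right)

text \<open>The bound on n makes the coefficient of the single contraction nonzero, so it can be
  divided out. The resulting exponent is a variable with an equation, so that uses can state it in
  simplified form.\<close>

lemma contraction_in:
  assumes W: "RA.subspace W" and I: "p \<in> {1..K}" "q \<in> {1..K}" "s \<in> {1..K}"
    and c: "q \<noteq> dual s" "dual p \<noteq> q" "p \<noteq> s" and n: "n \<le> m2 + n1 + block_degree q"
    and mem: "nY K (T p q m1 m2) n (T q s n1 n2) \<in> W"
    and m: "m1 + m2 + n1 + block_degree q - n = m"
  shows "T p s m n2 \<in> W"
  using subspace_cancel[OF W mem[unfolded single_contraction[OF I c] m] contraction_coeff_nonzero[OF even_degree_le n]] .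

lemma block_neq: "block p \<noteq> block q \<Longrightarrow> q \<in> {1..K} \<Longrightarrow> p \<noteq> q \<and> p \<noteq> dual q \<and> dual q \<noteq> p \<and> q \<noteq> p"
  using block_dual by metis

lemma block_degree_values: "block p = 0 \<Longrightarrow> block_degree p = 1" "block p = 1 \<Longrightarrow> block_degree p = 0" "even_degree 0 = 1" "even_degree 1 = 0"
  by (simp_all add: even_degree_def)

text \<open>Odd elements with a common leg contract to the even ones with two different indices. A
  product aimed at a diagonal element brings a second diagonal term from the other block. The
  diagonal elements are therefore reached in three rounds \<open>d1\<close>, \<open>d0\<close>,
  \<open>d2\<close>, in each of which that second term is absent or already known.\<close>

lemma odd_imp_all:
  fixes W :: "'a RA set"
  assumes W: "RA.subspace W"
    and act: "\<And>p q m1 m2 n w. p \<in> {1..K} \<Longrightarrow> q \<in> {1..K} \<Longrightarrow> block p \<noteq> block q \<Longrightarrow> w \<in> W \<Longrightarrow> nY K (T p q m1 m2) n w \<in> W"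
    and odd: "\<And>p q m n. p \<in> {1..K} \<Longrightarrow> q \<in> {1..K} \<Longrightarrow> block p \<noteq> block q \<Longrightarrow> T p q m n \<in> W"
  shows "whole Rd \<subseteq> W"
proof -
  have off: "T p q m n \<in> W" if I: "p \<in> {1..K}" "q \<in> {1..K}" and b: "block p = block q" and ne: "p \<noteq> q" for p q m n
  proof -
    obtain r where r: "r \<in> {1..K}" "block r \<noteq> block p"
      using exists_block0 exists_block1 by (metis zero_neq_one)
    have rq: "block r \<noteq> block q" using r(2) b by simp
    have "nY K (T p r m 0) (block_degree r) (T r q 0 n) \<in> W"
      using r(2) rq by (intro act odd I r(1)) metis+
    then show ?thesis
      using block_neq[OF r(2) I(1)] block_neq[OF rq I(2)]
      by (intro contraction_in[OF W I(1) r(1) I(2), of "block_degree r" 0 0 m n m]) (simp_all add: ne)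
  qed
  have prod: "nY K (T p q m 0) n (T q p 0 lprod) =
     smul (contraction_coeff (block_degree q) m 0 0 n) (T p p (m + block_degree q - n) lprod)
     + smul (contraction_coeff (block_degree p) 0 m lprod n) (T (dual q) (dual q) (m + lprod + block_degree p - n) 0)"
    if I: "p \<in> {1..K}" "q \<in> {1..K}" and b: "block p \<noteq> block q" for p q m lprod n
  proof -
    have "q \<noteq> dual p" "dual p \<noteq> q" using block_neq[OF not_sym[OF b] I(1)] by metis+
    then show ?thesis
      using sigma_sigma[of p q] by (simp add: nY_T[OF I I(2,1)] sigma_commute[of q p])
  qed
  have prodW: "nY K (T p q m 0) n (T q p 0 lprod) \<in> W"
    if I: "p \<in> {1..K}" "q \<in> {1..K}" and b: "block p \<noteq> block q" for p q m lprod n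
    by (intro act odd I b not_sym[OF b])
  have d1: "T b b m 0 \<in> W" if b: "b \<in> {1..K}" "block b = 1" for b m
  proof -
    obtain a where a: "a \<in> {1..K}" "block a = 0" using exists_block0 by blast
    note b' = dual_in[OF b(1)]
    have ab: "block a \<noteq> block (dual b)" using a b by simp
    \<comment> \<open>At product index 1 the contraction through the second block, whose degree is
      0, has no power left to lower. The one through the first block still has the additional power,
      so a single term survives.\<close>
    have "contraction_coeff (block_degree (dual b)) 0 0 0 1 = (0 :: 'a)" using b by (simp add: contraction_coeff_zero block_degree_values)
    then have "nY K (T a (dual b) 0 0) 1 (T (dual b) a 0 m) = smul (contraction_coeff 1 0 0 m 1) (T b b m 0)"
      using prod[OF a(1) b' ab, of 0 1 m] b a by (simp add: block_degree_values)
    then have "smul (contraction_coeff 1 0 0 m 1) (T b b m 0) \<in> W" using prodW[OF a(1) b' ab, of 0 1 m] by metis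
    then show ?thesis using subspace_cancel[OF W] contraction_coeff_nonzero[of 1 1 0 m 0] by simp
  qed
  have d0: "T a a m n \<in> W" if a: "a \<in> {1..K}" "block a = 0" for a m n
  proof -
    obtain b where b: "b \<in> {1..K}" "block b = 1" using exists_block1 by blast
    have ab: "block a \<noteq> block b" using a b by simp
    have "T (dual b) (dual b) (m + n + 1) 0 \<in> W"
      by (intro d1 dual_in b(1)) (simp only: block_dual[OF b(1)] b(2))
    then have "smul (contraction_coeff 1 0 m n 0) (T (dual b) (dual b) (m + n + 1) 0) \<in> W" by (rule RA.subspace_scale[OF W])
    moreover have "contraction_coeff 0 m 0 0 0 = (1 :: 'a)" by (simp add: contraction_coeff_def)
    then have "nY K (T a b m 0) 0 (T b a 0 n) = T a a m n + smul (contraction_coeff 1 0 m n 0) (T (dual b) (dual b) (m + n + 1) 0)"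
      using prod[OF a(1) b(1) ab, of m 0 n] b a by (simp add: block_degree_values)
    ultimately have "nY K (T a b m 0) 0 (T b a 0 n) - smul (contraction_coeff 1 0 m n 0) (T (dual b) (dual b) (m + n + 1) 0) \<in> W"
      using prodW[OF a(1) b(1) ab, of m 0 n] by (intro RA.subspace_diff[OF W]) simp_all
    then show ?thesis unfolding \<open>nY K (T a b m 0) 0 (T b a 0 n) = _\<close> by simp
  qed
  have d2: "T b b m n \<in> W" if b: "b \<in> {1..K}" "block b = 1" for b m n
  proof -
    obtain a where a: "a \<in> {1..K}" "block a = 0" using exists_block0 by blast
    have ab: "block b \<noteq> block a" using a b by simp
    have 1: "smul (contraction_coeff 0 0 m n 1) (T (dual a) (dual a) (m + n - 1) 0) \<in> W"
      by (intro RA.subspace_scale[OF W] d0 dual_in a(1)) (simp only: block_dual[OF a(1)] a(2))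
    \<comment> \<open>The truncated exponent m + n - 1 is harmless for m = n = 0, where its
      coefficient is 0.\<close>
    have "nY K (T b a m 0) 1 (T a b 0 n) = smul (contraction_coeff 1 m 0 0 1) (T b b m n) + smul (contraction_coeff 0 0 m n 1) (T (dual a) (dual a) (m + n - 1) 0)"
      using prod[OF b(1) a(1) ab, of m 1 n] b a by (simp add: block_degree_values)
    then have "smul (contraction_coeff 1 m 0 0 1) (T b b m n) + smul (contraction_coeff 0 0 m n 1) (T (dual a) (dual a) (m + n - 1) 0) \<in> W"
      using prodW[OF b(1) a(1) ab, of m 1 n] by metis
    from RA.subspace_diff[OF W this 1] have "smul (contraction_coeff 1 m 0 0 1) (T b b m n) \<in> W" by simp
    then show ?thesis using subspace_cancel[OF W] contraction_coeff_nonzero[of 1 1 0 0 m] by simp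
  qed
  have all: "T p q m n \<in> W" if I: "p \<in> {1..K}" "q \<in> {1..K}" for p q m n
  proof (cases "block p = block q")
    case False
    then show ?thesis using odd[OF I] by blast
  next
    case True
    show ?thesis
    proof (cases "p = q")
      case False
      then show ?thesis using off[OF I True] by blast
    next
      case p: True
      show ?thesis
      proof (cases "block p = 0")
        case True
        then show ?thesis using d0[OF I(1)] p by blast
      next
        case False
        then show ?thesis using d2[OF I(1)] p by simp
      qed
    qed
  qed
  show ?thesis
    unfolding whole_eq by (rule RA.span_minimal[OF _ W]) (unfold Tall_def, use all in blast)
qed

text \<open>Exponents of odd elements are raised by one at a time, in \<open>C\<close> for elements
  T a b m 0 and in \<open>D\<close> for all T b a n m; the symmetry of \<open>T\<close> and
  \<open>odd_imp_all\<close> give the rest. Contraction through the first block raises an exponent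
  by itself, whereas through the second block the acting element has to bring the exponent along, as
  T b c 1 0 does. The case distinctions decide which acting elements are available.\<close>

lemma generation:
  fixes W :: "'a RA set"
  assumes W: "RA.subspace W"
    and closed: "\<And>u v n. u \<in> W \<Longrightarrow> v \<in> W \<Longrightarrow> nY K u n v \<in> W"
    and odd: "\<And>p q. p \<in> {1..K} \<Longrightarrow> q \<in> {1..K} \<Longrightarrow> block p \<noteq> block q \<Longrightarrow> T p q 0 0 \<in> W"
    and extra: "l1 \<ge> 2 \<or> l2 \<ge> 2 \<or> l1 = 1 \<and> l2 = 1 \<and> T 3 3 0 1 \<in> W"
  shows "whole Rd \<subseteq> W"
proof -
  note cin = contraction_in[OF W]
  have A: "T b b 1 0 + T a a 0 0 \<in> W"
    if a: "a \<in> {1..K}" "block a = 0" and b: "b \<in> {1..K}" "block b = 1" for a b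
  proof -
    note a' = dual_in[OF a(1)]
    have ba: "block b \<noteq> block (dual a)" using a b by simp
    have ne: "dual a \<noteq> dual b" "dual b \<noteq> dual a" using block_neq[OF ba[symmetric] b(1)] by metis+
    have "nY K (T b (dual a) 0 0) 0 (T (dual a) b 0 0) = T b b 1 0 + T a a 0 0"
      using ne a b sigma_sigma[of b "dual a"]
      by (simp add: nY_T[OF b(1) a' a' b(1)] sigma_commute[of "dual a" b] block_degree_values contraction_coeff_def)
    moreover have "nY K (T b (dual a) 0 0) 0 (T (dual a) b 0 0) \<in> W"
      by (intro closed odd a' b ba ba[symmetric])
    ultimately show ?thesis by simp
  qed
  have B: "T b c 1 0 \<in> W"
    if b: "b \<in> {1..K}" "block b = 1" and c: "c \<in> {1..K}" "block c = 1" and ne: "b \<noteq> c" for b c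
  proof -
    obtain a where a: "a \<in> {1..K}" "block a = 0" using exists_block0 by blast
    have ac: "block a \<noteq> block c" "block a \<noteq> block b" "block b \<noteq> block a" using a b c by simp_all
    have "nY K (T b a 0 0) 0 (T a c 0 0) \<in> W" by (intro closed odd a b c ac)
    then show ?thesis
      using block_neq[OF ac(1) c(1)] block_neq[OF ac(2) b(1)] a
      by (intro cin[OF b(1) a(1) c(1), of 0 0 0 0]) (simp_all add: ne block_degree_values)
  qed
  have C': "T a b (Suc m) 0 \<in> W"
    if "nY K (T a a 0 0) 0 (T a b m 0) \<in> W" and a: "a \<in> {1..K}" "block a = 0" and b: "b \<in> {1..K}" "block b = 1" for a b m
  proof -
    have ab: "block a \<noteq> block b" using a b by simp
    show ?thesis
      by (rule cin[OF a(1) a(1) b(1) _ dual_neq[OF a(1)] _ _ that(1)])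
        (use block_neq[OF ab b(1)] a in \<open>simp_all add: block_degree_values\<close>)
  qed
  have D': "T b a (Suc n) m \<in> W"
    if mem: "nY K (T b c 1 0) 0 (T c a n m) \<in> W" and a: "a \<in> {1..K}" "block a = 0" and b: "b \<in> {1..K}" "block b = 1"
      and c: "c \<in> {1..K}" "block c = 1" and ne: "dual b \<noteq> c" for a b c n m
  proof -
    have ca: "block c \<noteq> block a" "block b \<noteq> block a" using a b c by simp_all
    show ?thesis
      by (rule cin[OF b(1) c(1) a(1) _ ne _ _ mem])
        (use block_neq[OF ca(1) a(1)] block_neq[OF ca(2) a(1)] c in \<open>simp_all add: block_degree_values\<close>)
  qed
  \<comment> \<open>With l1 = l2 = 1 the second block is {3, 4}, and 3 and 4 are dual. The
    additional generator and its flip provide a diagonal element for each of the two.\<close>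
  have small: "T b b 1 0 \<in> W \<or> T b b 0 1 \<in> W" "\<exists>c. c \<in> {1..K} \<and> block c = 1 \<and> T c c 1 0 \<in> W"
    if s: "\<not> l1 \<ge> 2" "\<not> l2 \<ge> 2" and b: "b \<in> {1..K}" "block b = 1" for b
  proof -
    have l: "l1 = 1" "l2 = 1" and t: "T 3 3 0 1 \<in> W" using extra s by blast+
    have d: "dual 3 = 4" "(3 :: nat) \<in> {1..K}" "(4 :: nat) \<in> {1..K}" "block 4 = 1"
      unfolding dual_def block_def unfolding l by simp_all
    have f: "T 4 4 1 0 \<in> W" using T_subspace_sym[OF W d(2,2) t] unfolding d(1) .
    have "b \<le> 4" "\<not> b \<le> 2"
      using b unfolding block_def unfolding l by (simp_all split: if_splits)
    then have "b = 3 \<or> b = 4" by arith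
    then show "T b b 1 0 \<in> W \<or> T b b 0 1 \<in> W" using f t by blast
    show "\<exists>c. c \<in> {1..K} \<and> block c = 1 \<and> T c c 1 0 \<in> W" using f d by blast
  qed
  have C: "\<forall>a b. a \<in> {1..K} \<and> block a = 0 \<and> b \<in> {1..K} \<and> block b = 1 \<longrightarrow> T a b m 0 \<in> W" for m
  proof (induction m)
    case 0
    show ?case using odd by simp
  next
    case (Suc m)
    show ?case
    proof (intro allI impI; elim conjE)
      fix a b assume a: "a \<in> {1..K}" "block a = 0" and b: "b \<in> {1..K}" "block b = 1"
      have ab: "block a \<noteq> block b" "block b \<noteq> block a" using a b by simp_all
      have IH: "T a b m 0 \<in> W" using Suc a b by blast
      show "T a b (Suc m) 0 \<in> W"
      proof (cases "l1 \<ge> 2")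
        case True
        then obtain d where d: "d \<in> {1..K}" "block d = 0" "d \<noteq> a" "dual a \<noteq> d" using exists_other0 a by blast
        have block_degree: "block b \<noteq> block d" "block d \<noteq> block b" using b d by simp_all
        \<comment> \<open>Detour through d: the contraction at b keeps the exponent m, since the
          second block has degree 0, and the contraction at d then raises it to m + 1.\<close>
        have "nY K (T a b m 0) 0 (T b d 0 0) \<in> W" by (intro closed IH odd b d block_degree)
        then have "T a d m 0 \<in> W"
          by (rule cin[OF a(1) b(1) d(1), rotated 4])
            (use block_neq[OF block_degree(1) d(1)] block_neq[OF ab(2) a(1)] d b in \<open>simp_all add: block_degree_values\<close>)
        then have "nY K (T a d m 0) 0 (T d b 0 0) \<in> W" by (intro closed odd b d block_degree)
        then show ?thesis
          by (rule cin[OF a(1) d(1) b(1) _ d(4), rotated 3])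
            (use block_neq[OF block_degree(2) b(1)] block_neq[OF ab(1) b(1)] d in \<open>simp_all add: block_degree_values\<close>)
      next
        case l1: False
        have "nY K (T a a 0 0) 0 (T a b m 0) \<in> W"
        proof (cases "l2 \<ge> 2")
          case True
          then obtain c where c: "c \<in> {1..K}" "block c = 1" "c \<noteq> b" "dual b \<noteq> c" using exists_other1 b by blast
          have ca: "block c \<noteq> block a" using a c by simp
          \<comment> \<open>As c avoids b and its dual, the sum provided by \<open>A\<close> acts
            here like T a a 0 0 alone.\<close>
          have "nY K (T c c 1 0) 0 (T a b m 0) = 0"
            using c block_neq[OF ca a(1)] b(1) by (intro no_contraction a b) (auto simp: dual_eq_iff)
          then have "nY K (T a a 0 0) 0 (T a b m 0) = nY K (T c c 1 0 + T a a 0 0) 0 (T a b m 0)"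
            by (simp add: nY_add_left)
          also have "\<dots> \<in> W" by (intro closed A IH a c)
          finally show ?thesis .
        next
          case False
          then obtain c where c: "c \<in> {1..K}" "block c = 1" "T c c 1 0 \<in> W" using small(2)[OF l1 _ b] by blast
          have "(T c c 1 0 + T a a 0 0) - T c c 1 0 \<in> W" by (intro RA.subspace_diff[OF W] A a c)
          then have "T a a 0 0 \<in> W" by simp
          then show ?thesis by (intro closed IH)
        qed
        then show ?thesis by (rule C'[OF _ a b])
      qed
    qed
  qed
  have D: "\<forall>a b. a \<in> {1..K} \<and> block a = 0 \<and> b \<in> {1..K} \<and> block b = 1 \<longrightarrow> T b a n m \<in> W" for n m
  proof (induction n)
    case 0
    show ?case
    proof (intro allI impI; elim conjE)
      fix a b assume a: "a \<in> {1..K}" "block a = 0" and b: "b \<in> {1..K}" "block b = 1"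
      have "T (dual a) (dual b) m 0 \<in> W"
        using C[of m] dual_in[OF a(1)] dual_in[OF b(1)] block_dual[OF a(1)] block_dual[OF b(1)] a(2) b(2) by metis
      from T_subspace_sym[OF W dual_in[OF a(1)] dual_in[OF b(1)] this]
      show "T b a 0 m \<in> W" unfolding dual_dual[OF a(1)] dual_dual[OF b(1)] .
    qed
  next
    case (Suc n)
    show ?case
    proof (intro allI impI; elim conjE)
      fix a b assume a: "a \<in> {1..K}" "block a = 0" and b: "b \<in> {1..K}" "block b = 1"
      have IH: "T c a n m \<in> W" if "c \<in> {1..K}" "block c = 1" for c using Suc a that by blast
      have ba: "block b \<noteq> block a" using a b by simp
      consider (l1) "l1 \<ge> 2" | (l2) "l2 \<ge> 2" | (s) "\<not> l1 \<ge> 2" "\<not> l2 \<ge> 2" by blast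
      then show "T b a (Suc n) m \<in> W"
      proof cases
        case l1
        then obtain d where d: "d \<in> {1..K}" "block d = 0" "d \<noteq> a" "dual a \<noteq> d" using exists_other0 a by blast
        have db: "block d \<noteq> block b" using b d by simp
        have "nY K (T d d 0 0) 0 (T b a n m) = 0"
          using d block_neq[OF db b(1)] a(1) by (intro no_contraction a b) (auto simp: dual_eq_iff)
        then have "nY K (T b b 1 0) 0 (T b a n m) = nY K (T b b 1 0 + T d d 0 0) 0 (T b a n m)"
          by (simp add: nY_add_left)
        also have "\<dots> \<in> W" by (intro closed A IH d b)
        finally show ?thesis by (rule D'[OF _ a b b dual_neq[OF b(1)]])
      next
        case l2
        then obtain c where c: "c \<in> {1..K}" "block c = 1" "c \<noteq> b" "dual b \<noteq> c" using exists_other1 b by blast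
        have "nY K (T b c 1 0) 0 (T c a n m) \<in> W" by (intro closed B IH b c not_sym[OF c(3)])
        then show ?thesis by (rule D'[OF _ a b c(1,2,4)])
      next
        case s
        from small(1)[OF s b] show ?thesis
        proof
          assume "T b b 1 0 \<in> W"
          then have "nY K (T b b 1 0) 0 (T b a n m) \<in> W" by (intro closed IH b)
          then show ?thesis by (rule D'[OF _ a b b dual_neq[OF b(1)]])
        next
          \<comment> \<open>The second exponent of the left factor belongs to the contracted leg and
            is transferred to the first exponent of the product. Thus T b b 0 1 raises it just as T
            b b 1 0 does.\<close>
          assume "T b b 0 1 \<in> W"
          then have "nY K (T b b 0 1) 0 (T b a n m) \<in> W" by (intro closed IH b)
          then show ?thesis
            by (rule cin[OF b(1) b(1) a(1) _ dual_neq[OF b(1)], rotated 3])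
              (use block_neq[OF ba a(1)] b in \<open>simp_all add: block_degree_values\<close>)
        qed
      qed
    qed
  qed
  have all_odd: "T p q m n \<in> W" if I: "p \<in> {1..K}" "q \<in> {1..K}" and b: "block p \<noteq> block q" for p q m n
  proof (cases "block p = 0")
    case True
    then have q: "block q = 1" using b by simp
    have "T (dual q) (dual p) n m \<in> W"
      using D[of n m] True q I dual_in[OF I(1)] dual_in[OF I(2)] block_dual[OF I(1)] block_dual[OF I(2)] by metis
    from T_subspace_sym[OF W dual_in[OF I(2)] dual_in[OF I(1)] this]
    show ?thesis unfolding dual_dual[OF I(1)] dual_dual[OF I(2)] .
  next
    case False
    then have "block p = 1" "block q = 0" using b by simp_all
    then show ?thesis using D[of m n] I by blast
  qed
  show ?thesis
    by (rule odd_imp_all[OF W]) (blast intro: closed all_odd)+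
qed


text \<open>Nested products only have generators as left factors. Closure of their span under all
  products follows once the elements that map W into itself are known to be closed under products.
  They are taken homogeneous because the commutator formula needs parities.\<close>

definition left_stabilizer :: "'a RA set \<Rightarrow> bit \<Rightarrow> 'a RA set" where
  "left_stabilizer W i = {u \<in> Rd i. \<forall>n. \<forall>w\<in>W. nY K u n w \<in> W}"

lemma subspace_left_stabilizer:
  assumes "RA.subspace W"
  shows "RA.subspace (left_stabilizer W i)"
  unfolding left_stabilizer_def
  by (rule RA.subspaceI)
    (auto simp: nY_add_left nY_smul_left RA.subspace_0[OF subspace_Rd] RA.subspace_0[OF assms]
      intro: RA.subspace_add[OF subspace_Rd] RA.subspace_add[OF assms] RA.subspace_scale[OF subspace_Rd] RA.subspace_scale[OF assms])

text \<open>The commutator formula is triangular in \<open>l\<close>, hence can be solved for the products with \<open>u\<^sub>l v\<close>.\<close>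

lemma left_stabilizer_nY:
  assumes W: "RA.subspace W" "W \<subseteq> whole Rd" and u: "u \<in> left_stabilizer W i" and v: "v \<in> left_stabilizer W j"
  shows "nY K u l v \<in> left_stabilizer W (i + j)"
proof -
  have uv: "u \<in> Rd i" "v \<in> Rd j" using u v by (simp_all add: left_stabilizer_def)
  have "\<forall>n. \<forall>w\<in>W. nY K (nY K u l v) n w \<in> W"
  proof (induction l rule: less_induct)
    case (less l)
    show ?case
    proof (intro allI ballI)
      fix n w assume w: "w \<in> W"
      have 1: "nY K u l (nY K v n w) - smul (koszul i j) (nY K v n (nY K u l w)) \<in> W"
        using u v w unfolding left_stabilizer_def
        by (intro RA.subspace_diff[OF W(1)] RA.subspace_scale[OF W(1)]) blast+
      have 2: "nY K u l (nY K v n w) - smul (koszul i j) (nY K v n (nY K u l w)) =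
        (\<Sum>l'<l. smul (of_nat (l choose l')) (nY K (nY K u l' v) (l - l' + n) w)) + nY K (nY K u l v) n w"
        using nY_commutator[OF uv subsetD[OF W(2) w], of l n] by (simp add: lessThan_Suc_atMost[symmetric])
      have 3: "(\<Sum>l'<l. smul (of_nat (l choose l')) (nY K (nY K u l' v) (l - l' + n) w)) \<in> W"
        using less w by (intro RA.subspace_sum[OF W(1)] RA.subspace_scale[OF W(1)]) blast
      show "nY K (nY K u l v) n w \<in> W"
        using RA.subspace_diff[OF W(1) 1[unfolded 2] 3] unfolding add_diff_cancel_left' .
    qed
  qed
  then show ?thesis using nY_closed[OF uv] by (simp add: left_stabilizer_def)
qed

lemma generated_subset:
  assumes "S \<subseteq> whole Rd"
  shows "generated smul (Yplus K) S \<subseteq> whole Rd"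
proof -
  have "w \<in> nested_products (Yplus K) S \<Longrightarrow> w \<in> whole Rd" for w
    by (induction rule: nested_products.induct) (use assms in \<open>auto intro!: nY_whole\<close>)
  then show ?thesis
    unfolding generated_def by (intro RA.span_minimal[OF _ subspace_whole]) blast
qed

text \<open>The stabilizer of the generated subspace contains the homogeneous parts of S by the
  definition of nested products, and it is closed under products. So it contains the generated
  subspace itself. By \<open>hom\<close> the homogeneous parts again lie in S.\<close>

lemma generated_closed:
  assumes S: "S \<subseteq> whole Rd"
    and hom: "\<And>s. s \<in> S \<Longrightarrow> \<exists>s0 s1. s0 \<in> S \<inter> Rd 0 \<and> s1 \<in> S \<inter> Rd 1 \<and> s = s0 + s1"
    and u: "u \<in> generated smul (Yplus K) S" and v: "v \<in> generated smul (Yplus K) S"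
  shows "nY K u n v \<in> generated smul (Yplus K) S"
proof -
  define W where "W = generated smul (Yplus K) S"
  have W: "RA.subspace W" "W \<subseteq> whole Rd"
    using generated_subset[OF S] by (simp_all add: W_def generated_def)
  note subact = subspace_left_stabilizer[OF W(1)]
  have S_stab: "s \<in> left_stabilizer W i" if s: "s \<in> S" "s \<in> Rd i" for s i
  proof -
    have "nY K s n w \<in> W" if "w \<in> W" for n w
      using that unfolding W_def generated_def
    proof (induction rule: RA.span_induct_alt)
      case base
      then show ?case by (simp add: RA.span_zero)
    next
      case (step c x y)
      show ?case
        unfolding nY_add_right nY_smul_right
        by (intro RA.span_add RA.span_scale RA.span_base nested_products.step step s(1))
    qed
    then show ?thesis using s(2) by (simp add: left_stabilizer_def)
  qed
  define A where "A = {a + b | a b. a \<in> left_stabilizer W 0 \<and> b \<in> left_stabilizer W 1}"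
  have A: "RA.subspace A"
    unfolding A_def by (rule RA.subspace_sums[OF subact subact])
  have "x \<in> A" if "x \<in> nested_products (Yplus K) S" for x
    using that
  proof (induction rule: nested_products.induct)
    case (base v)
    then show ?case using hom[OF base] S_stab unfolding A_def by blast
  next
    case (step u w m)
    obtain u0 u1 where u: "u0 \<in> S \<inter> Rd 0" "u1 \<in> S \<inter> Rd 1" "u = u0 + u1" using hom[OF step(1)] by blast
    have u01: "u0 \<in> left_stabilizer W 0" "u1 \<in> left_stabilizer W 1" using u S_stab by blast+
    obtain a b where ab: "a \<in> left_stabilizer W 0" "b \<in> left_stabilizer W 1" "w = a + b" using step(3) unfolding A_def by blast
    have "nY K u m w = (nY K u0 m a + nY K u1 m b) + (nY K u0 m b + nY K u1 m a)"
      unfolding u(3) ab(3) nY_add_left nY_add_right by (simp add: add_ac)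
    moreover have "nY K u0 m a + nY K u1 m b \<in> left_stabilizer W 0"
      using left_stabilizer_nY[OF W u01(1) ab(1), of m] left_stabilizer_nY[OF W u01(2) ab(2), of m]
      by (intro RA.subspace_add[OF subact]) simp_all
    moreover have "nY K u0 m b + nY K u1 m a \<in> left_stabilizer W 1"
      using left_stabilizer_nY[OF W u01(1) ab(2), of m] left_stabilizer_nY[OF W u01(2) ab(1), of m]
      by (intro RA.subspace_add[OF subact]) simp_all
    ultimately show ?case unfolding A_def by blast
  qed
  then have "W \<subseteq> A" unfolding W_def generated_def by (intro RA.span_minimal[OF _ A]) blast
  then obtain a b where "a \<in> left_stabilizer W 0" "b \<in> left_stabilizer W 1" "u = a + b"
    using u unfolding W_def[symmetric] A_def by blast
  then show ?thesis
    using v unfolding W_def[symmetric] left_stabilizer_def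
    by (simp only: nY_add_left) (intro RA.subspace_add[OF W(1)]; blast)
qed

text \<open>Replacing each matrix unit by the corresponding T doubles every element of \<open>R\<^sup>\<dagger>\<close>.\<close>

definition T_expansion_term :: "(bit \<times> bit \<times> nat \<times> nat) \<Rightarrow> 'a mtx \<Rightarrow> 'a RA" where
  "T_expansion_term z u = (case z of (i, j, m, n) \<Rightarrow>
     (\<Sum>p = 1..K. \<Sum>q = 1..K. if i = block p \<and> j = block q then smul (u p q) (T p q m n) else 0))"

lemma T_expansion_term_zero: "T_expansion_term z 0 = 0"
proof (cases z)
  case (fields i j m n)
  show ?thesis
    unfolding fields T_expansion_term_def prod.case by (intro sum.neutral ballI) (simp add: zero_fun_def)
qed

lemma T_expansion_term_add: "T_expansion_term z (u + v) = T_expansion_term z u + T_expansion_term z v"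
proof (cases z)
  case (fields i j m n)
  show ?thesis
    unfolding fields T_expansion_term_def prod.case sum.distrib[symmetric]
    by (intro sum.cong refl) (simp add: RA.scale_left_distrib)
qed

lemma T_expansion_term_scale: "T_expansion_term z (\<lambda>p q. c * u p q) = smul c (T_expansion_term z u)"
proof (cases z)
  case (fields i j m n)
  show ?thesis
    unfolding fields T_expansion_term_def prod.case RA.scale_sum_right
    by (intro sum.cong refl) simp
qed

definition T_expansion :: "'a RA \<Rightarrow> 'a RA" where
  "T_expansion f = (\<Sum>z\<in>keys f. T_expansion_term z (lookup f z))"

lemma T_expansion_add: "T_expansion (f + g) = T_expansion f + T_expansion g"
  unfolding T_expansion_def by (rule sum_keys_add, rule T_expansion_term_zero, rule T_expansion_term_add)

lemma T_expansion_smul: "T_expansion (smul c f) = smul c (T_expansion f)"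
proof -
  have "T_expansion (smul c f) = (\<Sum>z\<in>keys f. T_expansion_term z (lookup (smul c f) z))"
    unfolding T_expansion_def by (rule sum_keys_superset[where h = T_expansion_term, OF finite_keys keys_smul T_expansion_term_zero])
  then show ?thesis by (simp only: lookup_smul T_expansion_term_scale RA.scale_sum_right T_expansion_def)
qed

lemma T_expansion_unit_elt:
  assumes "p \<in> {1..K}" "q \<in> {1..K}"
  shows "T_expansion (unit_elt p q m n) = T p q m n"
proof -
  have "T_expansion (unit_elt p q m n) = (\<Sum>z\<in>{(block p, block q, m, n)}. T_expansion_term z (lookup (unit_elt p q m n) z))"
    unfolding T_expansion_def
    by (rule sum_keys_superset[where h = T_expansion_term, OF _ _ T_expansion_term_zero]) (simp_all add: unit_elt_def elt_def)
  also have "\<dots> = (\<Sum>p' = 1..K. \<Sum>q' = 1..K. if block p = block p' \<and> block q = block q' then smul (E p q p' q') (T p' q' m n) else 0)"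
    by (simp add: unit_elt_def elt_def T_expansion_term_def)
  also have "\<dots> = (\<Sum>p' = 1..K. \<Sum>q' = 1..K. if q' = q then (if p' = p then T p q m n else 0) else 0)"
    by (intro sum.cong refl) (auto simp: E_def)
  also have "\<dots> = T p q m n" using assms by simp
  finally show ?thesis .
qed

lemma T_expansion_whole: "f \<in> whole Rd \<Longrightarrow> T_expansion f = smul 2 f"
  unfolding whole_eq
proof (induction rule: RA.span_induct_alt)
  case base
  then show ?case by (simp add: T_expansion_def)
next
  case (step c u v)
  then obtain p q m n where u: "u = T p q m n" "p \<in> {1..K}" "q \<in> {1..K}" unfolding Tall_def by blast
  have "T_expansion u = T p q m n + smul (sigma p q) (T (dual q) (dual p) n m)"
    unfolding u(1) T_def[of p q] T_expansion_add T_expansion_smul T_expansion_unit_elt[OF u(2,3)] T_expansion_unit_elt[OF dual_in[OF u(3)] dual_in[OF u(2)]] ..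
  also have "\<dots> = smul 2 u"
    unfolding u(1) T_sym[OF u(2,3)] by (simp add: sigma_sigma RA.scale_left_distrib[of 1 1, simplified])
  finally show ?case by (simp add: T_expansion_add T_expansion_smul step RA.scale_right_distrib mult.commute)
qed

section \<open>The subspace of weight 3/2\<close>

lemma weight_eq: "weight i j m n = 3 / 2 \<longleftrightarrow> i \<noteq> j \<and> m = 0 \<and> n = 0"
proof -
  have 1: "(of_nat m + of_nat n + 1 :: rat) \<noteq> 3 / 2"
  proof
    assume "(of_nat m + of_nat n + 1 :: rat) = 3 / 2"
    then have "(of_nat (2 * (m + n)) :: rat) = of_nat 1" by simp
    then have "2 * (m + n) = 1" by (metis of_nat_eq_iff)
    then show False by presburger
  qed
  have 2: "(of_nat m + of_nat n + 2 :: rat) \<noteq> 3 / 2"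
  proof
    assume "(of_nat m + of_nat n + 2 :: rat) = 3 / 2"
    moreover have "(of_nat m :: rat) \<ge> 0" "(of_nat n :: rat) \<ge> 0" by simp_all
    ultimately show False by linarith
  qed
  have 3: "(of_nat m + of_nat n = (0 :: rat)) \<longleftrightarrow> m = 0 \<and> n = 0"
    by (metis of_nat_add of_nat_0_eq_iff add_is_0)
  show ?thesis
    using 1 2 3 by (cases i; cases j) (auto simp: weight_def)
qed

lemma weight_space_keys:
  assumes "f \<in> weight_space k1 k2 (3 / 2)" "lookup f (i, j, m, n) \<noteq> 0"
  shows "i \<noteq> j \<and> m = 0 \<and> n = 0"
proof (rule ccontr)
  assume neg: "\<not> ?thesis"
  have "lookup f (i, j, m, n) = 0"
    using assms(1) unfolding weight_space_def
  proof (induction rule: RA.span_induct_alt)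
    case base
    then show ?case by simp
  next
    case (step c x y)
    then obtain u i' j' m' n' where x: "x = elt u i' j' m' n'" "weight i' j' m' n' = 3 / 2" by blast
    have "(i', j', m', n') \<noteq> (i, j, m, n)" using x(2) neg unfolding weight_eq by blast
    then have "lookup x (i, j, m, n) = 0" unfolding x(1) elt_def by (rule lookup_single_not_eq)
    then show ?case using step.IH by (simp add: lookup_add lookup_smul fun_eq_iff)
  qed
  then show False using assms(2) by simp
qed

lemma T_odd_weight:
  assumes "p \<in> {1..K}" "q \<in> {1..K}" "block p \<noteq> block q"
  shows "T p q 0 0 \<in> weight_space (2 * l1) (2 * l2) (3 / 2)"
proof -
  have "unit_elt p q 0 0 \<in> weight_space (2 * l1) (2 * l2) (3 / 2)"
    if I: "p \<in> {1..K}" "q \<in> {1..K}" and b: "block p \<noteq> block q" for p q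
  proof -
    have "E p q \<in> mat_part (2 * l1) (2 * l2) (block p + block q)"
      unfolding mat_part_def E_def using I b by (auto simp: block_def split: if_splits)
    moreover have "weight (block p) (block q) 0 0 = 3 / 2" unfolding weight_eq using b by blast
    ultimately show ?thesis unfolding weight_space_def unit_elt_def by (intro RA.span_base) blast
  qed
  note this[OF assms] this[OF dual_in[OF assms(2)] dual_in[OF assms(1)]]
  moreover have "block (dual q) \<noteq> block (dual p)" using assms by simp
  ultimately show ?thesis
    unfolding T_def weight_space_def by (intro RA.span_add RA.span_scale)
qed

lemma odd_T_span:
  assumes I: "p \<in> {1..K}" "q \<in> {1..K}" and b: "block p \<noteq> block q"
  shows "T p q 0 0 \<in> RA.span (odd_gens l1 l2 0 0)"
proof (cases "block p = 0")
  case True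
  then have "block q = 1" using b by simp
  then show ?thesis by (intro RA.span_base odd_gensI I True)
next
  case False
  then have *: "block p = 1" "block q = 0" using b by simp_all
  show ?thesis
    by (intro T_span_sym[OF I] RA.span_base odd_gensI dual_in I)
      (simp_all only: block_dual[OF I(1)] block_dual[OF I(2)] *)
qed

text \<open>A representation of f by generators might use other exponents that cancel.
  \<open>T_expansion\<close> takes its coefficients from f itself, which has none outside the
  exponents 0, 0 in the summands [0,1] and [1,0]. As it equals 2 f, only the odd generators with
  exponents 0, 0 are involved.\<close>

lemma weight_odd: "(Rdagger_weight l1 l2 (3 / 2) :: 'a RA set) = RA.span (odd_gens l1 l2 0 0)"
proof
  show "(Rdagger_weight l1 l2 (3 / 2) :: 'a RA set) \<subseteq> RA.span (odd_gens l1 l2 0 0)"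
  proof
    fix f :: "'a RA" assume "f \<in> Rdagger_weight l1 l2 (3 / 2)"
    then have f: "f \<in> whole Rd" "f \<in> weight_space (2 * l1) (2 * l2) (3 / 2)"
      by (simp_all add: Rdagger_weight_def)
    have "T_expansion f \<in> RA.span (odd_gens l1 l2 0 0)"
      unfolding T_expansion_def
    proof (rule RA.span_sum)
      fix z assume z: "z \<in> keys f"
      obtain i j m n where zz: "z = (i, j, m, n)" by (metis prod_cases4)
      have ne: "i \<noteq> j \<and> m = 0 \<and> n = 0"
        using weight_space_keys[OF f(2), of i j m n] z unfolding zz in_keys_iff by blast
      show "T_expansion_term z (lookup f z) \<in> RA.span (odd_gens l1 l2 0 0)"
        unfolding zz T_expansion_term_def prod.case
      proof (intro RA.span_sum)
        fix p q assume "p \<in> {1..K}" "q \<in> {1..K}"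
        then show "(if i = block p \<and> j = block q then smul (lookup f (i, j, m, n) p q) (T p q m n) else 0)
          \<in> RA.span (odd_gens l1 l2 0 0)"
          using ne odd_T_span[of p q] by (cases "i = block p \<and> j = block q") (auto intro: RA.span_scale RA.span_zero)
      qed
    qed
    then show "f \<in> RA.span (odd_gens l1 l2 0 0)"
      unfolding T_expansion_whole[OF f(1)] by (rule subspace_cancel[OF RA.subspace_span]) simp
  qed
  have sub: "RA.subspace (Rdagger_weight l1 l2 (3 / 2) :: 'a RA set)"
    unfolding Rdagger_weight_def weight_space_def
    by (rule RA.subspace_inter[OF subspace_whole RA.subspace_span])
  show "RA.span (odd_gens l1 l2 0 0) \<subseteq> (Rdagger_weight l1 l2 (3 / 2) :: 'a RA set)"
  proof (rule RA.span_minimal[OF _ sub], rule subsetI)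
    fix x :: "'a RA" assume "x \<in> odd_gens l1 l2 0 0"
    then obtain p q where x: "x = T p q 0 0" "p \<in> {1..K}" "q \<in> {1..K}" "block p = 0" "block q = 1"
      unfolding odd_gens_T' by blast
    have "T p q 0 0 \<in> Tall" unfolding Tall_def using x by blast
    then have "x \<in> whole Rd" unfolding whole_eq x(1) by (rule RA.span_base)
    then show "x \<in> Rdagger_weight l1 l2 (3 / 2)"
      unfolding Rdagger_weight_def using T_odd_weight[OF x(2,3)] x by simp
  qed
qed

lemma odd_span_Rd: "RA.span (odd_gens l1 l2 0 0) \<subseteq> Rd 1"
proof -
  have "odd_gens l1 l2 0 0 \<subseteq> Rd 1"
    unfolding Rdagger_def by (simp del: odd_gens_T) (rule subset_trans[OF _ RA.span_superset], blast)
  then show ?thesis by (rule RA.span_minimal[OF _ subspace_Rd])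
qed

lemma generated_whole:
  assumes S: "S \<subseteq> whole Rd" "RA.span (odd_gens l1 l2 0 0) \<subseteq> S"
    and hom: "\<And>s. s \<in> S \<Longrightarrow> \<exists>s0 s1. s0 \<in> S \<inter> Rd 0 \<and> s1 \<in> S \<inter> Rd 1 \<and> s = s0 + s1"
    and extra: "l1 \<ge> 2 \<or> l2 \<ge> 2 \<or> l1 = 1 \<and> l2 = 1 \<and> T 3 3 0 1 \<in> S"
  shows "whole Rd = generated smul (Yplus K) S"
proof
  have SW: "S \<subseteq> generated smul (Yplus K) S"
    unfolding generated_def by (intro subsetI RA.span_base nested_products.base)
  show "whole Rd \<subseteq> generated smul (Yplus K) S"
  proof (rule generation)
    show "RA.subspace (generated smul (Yplus K) S)" unfolding generated_def by (rule RA.subspace_span)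
    show "nY K u n v \<in> generated smul (Yplus K) S"
      if "u \<in> generated smul (Yplus K) S" "v \<in> generated smul (Yplus K) S" for u v n
      by (rule generated_closed[OF S(1) hom that])
    show "T p q 0 0 \<in> generated smul (Yplus K) S" if "p \<in> {1..K}" "q \<in> {1..K}" "block p \<noteq> block q" for p q
      using odd_T_span[OF that] S(2) SW by blast
    show "2 \<le> l1 \<or> 2 \<le> l2 \<or> l1 = 1 \<and> l2 = 1 \<and> T 3 3 0 1 \<in> generated smul (Yplus K) S"
      using extra SW by blast
  qed
  show "generated smul (Yplus K) S \<subseteq> whole Rd" by (rule generated_subset[OF S(1)])
qed


section \<open>Simplicity\<close>

lemma symbol_sym:
  assumes "f \<in> whole Rd" and PQ: "P \<in> {1..K}" "Q \<in> {1..K}"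
  shows "symbol f (dual Q) (dual P) y x = sigma P Q * symbol f P Q x y"
  using assms(1) unfolding whole_eq
proof (induction rule: RA.span_induct_alt)
  case base
  then show ?case by simp
next
  case (step c u v)
  then obtain p q m n where u: "u = T p q m n" "p \<in> {1..K}" "q \<in> {1..K}" unfolding Tall_def by blast
  have c: "dual Q = p \<and> dual P = q \<longleftrightarrow> P = dual q \<and> Q = dual p"
    "dual Q = dual q \<and> dual P = dual p \<longleftrightarrow> P = p \<and> Q = q"
    using PQ u(2,3) dual_dual by metis+
  have bool: "(if c2 then Z else 0) + r * (if c1 then X else 0) = r' * ((if c1 then X else 0) + r * (if c2 then Z else 0))"
    if "c1 \<longrightarrow> r' = r" "c2 \<longrightarrow> r' = r" "r * r = 1" for c1 c2 and r r' X Z :: 'a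
  proof -
    have "r * (r * Z) = Z" using that(3) by (metis mult.assoc mult_1)
    then show ?thesis using that(1,2) by (cases c1; cases c2) (simp_all add: distrib_left)
  qed
  have "symbol u (dual Q) (dual P) y x = sigma P Q * symbol u P Q x y"
    unfolding u(1) symbol_T c mult.commute[of "y ^ m / fact m"] mult.commute[of "y ^ n / fact n"]
    by (rule bool) (use sigma_dual[OF u(2,3)] sigma_sigma in blast)+
  then show ?case using step.IH by (simp add: symbol_add symbol_smul algebra_simps)
qed

lemma symbol_poly: "\<exists>p. \<forall>t. symbol f P Q t y = poly p t"
proof -
  obtain B where B: "\<And>x y. symbol f P Q x y = (\<Sum>m<B. x ^ m / fact m * (\<Sum>n<B. y ^ n / fact n * lookup f (block P, block Q, m, n) P Q))"
    using symbol_bound[of f P Q] by blast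
  show ?thesis
    by (rule exI[of _ "\<Sum>m<B. monom ((\<Sum>n<B. y ^ n / fact n * lookup f (block P, block Q, m, n) P Q) / fact m) m"])
      (simp add: B poly_sum poly_monom mult.commute)
qed

text \<open>Multiplication by a power of t is injective on polynomials, and a nonzero polynomial
  over an infinite field has a point where it does not vanish. The power is the factor c(t) of the
  bracket.\<close>

lemma symbol_nonzero_mult:
  assumes "symbol f P Q x y \<noteq> 0"
  shows "\<exists>t. symbol f P Q t y * t ^ d \<noteq> 0"
proof (rule ccontr)
  assume *: "\<not> ?thesis"
  obtain p where p: "\<And>t. symbol f P Q t y = poly p t" using symbol_poly by blast
  have "poly (p * monom 1 d) = poly 0"
    using * by (auto simp: poly_monom p fun_eq_iff)
  then have "p * monom 1 d = 0" by (simp only: poly_eq_poly_eq_iff)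
  then have "p = 0" by simp
  then show False using assms p by simp
qed

lemma lambda_series_witness:
  assumes "lambda_series t (Yplus K u f) P Q x y \<noteq> 0"
  shows "\<exists>n. symbol (nY K u n f) P Q x y \<noteq> 0"
proof (rule ccontr)
  assume *: "\<not> ?thesis"
  obtain B where B: "\<And>n. n \<ge> B \<Longrightarrow> nY K u n f = 0" using nY_bound by blast
  have "lambda_series t (Yplus K u f) P Q x y = (\<Sum>n<B. t ^ n / fact n * symbol (nY K u n f) P Q x y)"
    by (rule lambda_series_nY) (rule B)
  then show False using * assms by simp
qed

lemma symbol_support:
  assumes "f \<in> block_span" "symbol f P Q x y \<noteq> 0"
  shows "P \<in> {1..K} \<and> Q \<in> {1..K}"
proof (rule ccontr)
  assume "\<not> ?thesis"
  then have z: "lookup f (block P, block Q, m, n) P Q = 0" for m n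
    using block_span_support[OF assms(1)] by blast
  obtain B where "symbol f P Q x y = (\<Sum>m<B. x ^ m / fact m * (\<Sum>n<B. y ^ n / fact n * lookup f (block P, block Q, m, n) P Q))"
    using symbol_bound[of f P Q] by blast
  then show False using assms(2) by (simp add: z)
qed

text \<open>Suppose that the rows of f in the second block vanish. Let (P, Q) be a nonzero entry and
  act by T b P 0 0 with b in the second block. The commuted term contains row b of f and drops out.
  At x = 0 the direct term is the entry (P, Q) at first argument t, times t, which is nonzero for
  some t.\<close>

lemma reduce_to_block1:
  assumes f: "f \<in> whole Rd" "f \<noteq> 0"
    and I: "\<And>u n. u \<in> whole Rd \<Longrightarrow> nY K u n f \<in> I" "f \<in> I"
  shows "\<exists>g\<in>I. \<exists>b Q x y. b \<in> {1..K} \<and> block b = 1 \<and> Q \<in> {1..K} \<and> symbol g b Q x y \<noteq> 0"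
proof -
  have "\<exists>P Q x y. symbol f P Q x y \<noteq> 0"
  proof (rule ccontr)
    assume "\<not> ?thesis"
    then have "f = 0"
      by (intro symbol_eqI) (use f(1) whole_block_span RA.subspace_0[OF subspace_block_span] in auto)
    then show False using f(2) by simp
  qed
  then obtain P Q x y where nz: "symbol f P Q x y \<noteq> 0" by blast
  have PQ: "P \<in> {1..K}" "Q \<in> {1..K}"
    using symbol_support[OF subsetD[OF whole_block_span f(1)] nz] by blast+
  show ?thesis
  proof (cases "\<exists>b S x y. b \<in> {1..K} \<and> block b = 1 \<and> S \<in> {1..K} \<and> symbol f b S x y \<noteq> 0")
    case True
    then show ?thesis using I(2) by blast
  next
    case False
    then have z: "symbol f b S x y = 0" if "b \<in> {1..K}" "block b = 1" "S \<in> {1..K}" for b S x y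
      using that by blast
    have P0: "block P = 0" using z[OF PQ(1) _ PQ(2)] nz by fastforce
    obtain b where b: "b \<in> {1..K}" "block b = 1" using exists_block1 by blast
    have bP: "b \<noteq> P" "b \<noteq> dual P" using block_neq[of b P] b P0 PQ by simp_all
    have uT: "T b P 0 0 \<in> Tall" unfolding Tall_def using b PQ by blast
    then have u: "T b P 0 0 \<in> whole Rd" unfolding whole_eq by (rule RA.span_base)
    obtain t where t: "symbol f P Q t y * t ^ 1 \<noteq> 0" using symbol_nonzero_mult[OF nz] by blast
    have "lambda_series t (Yplus K (T b P 0 0) f) b Q 0 y = lprod t (symbol (T b P 0 0)) (symbol f) b Q 0 y"
    proof -
      have "wprod koszul_sign (- t - 0 - y) (symbol f) (symbol (T b P 0 0)) b Q 0 y = 0"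
        unfolding wprod_def by (rule sum.neutral) (use z b in simp)
      then show ?thesis
        using lambda_series_formula[OF subsetD[OF whole_block_span u] subsetD[OF whole_block_span f(1)], of t b Q 0 y] by simp
    qed
    also have "\<dots> = (\<Sum>S = 1..K. if S = P then symbol f P Q t y * t ^ block_degree P else 0)"
      unfolding wprod_def by (rule sum.cong) (use bP in \<open>auto simp: symbol_T\<close>)
    also have "\<dots> = symbol f P Q t y * t ^ 1" using PQ P0 by (simp add: block_degree_values)
    finally have "lambda_series t (Yplus K (T b P 0 0) f) b Q 0 y \<noteq> 0" using t by simp
    then obtain n where "symbol (nY K (T b P 0 0) n f) b Q 0 y \<noteq> 0" using lambda_series_witness by blast
    then show ?thesis using I(1)[OF u] b PQ by blast
  qed
qed

text \<open>The entry (b, Q) is also the entry (dual Q, dual b), by symmetry. Contracting its leg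
  dual Q with T b (dual Q) 0 0 moves it to (b, dual b). The commuted term hits this entry as well;
  on the diagonal x = y it evaluates f at the same point, and the signs make the two contributions
  add up.\<close>

lemma reduce_to_dual:
  assumes f: "f \<in> whole Rd" and b: "b \<in> {1..K}" "block b = 1" and Q: "Q \<in> {1..K}" and nz: "symbol f b Q x y \<noteq> 0"
    and I: "\<And>u n. u \<in> whole Rd \<Longrightarrow> nY K u n f \<in> I" "f \<in> I"
  shows "\<exists>g\<in>I. \<exists>x y. symbol g b (dual b) x y \<noteq> 0"
proof -
  note Q' = dual_in[OF Q] and b' = dual_in[OF b(1)]
  \<comment> \<open>The Koszul sign and (-1) to the degree of Q cancel; the sign -1 that remains
    comes from eps, which is odd under dual.\<close>
  have sb: "sigma b Q * sigma b (dual Q) * koszul_sign b Q (dual b) * (- 1) ^ block_degree Q = (- 1 :: 'a)"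
    using b Q by (cases "block Q") (simp_all add: sigma_def koszul_sign_def koszul_bit block_degree_values mult_ac)
  have sym: "symbol f b Q x y = sigma b Q * symbol f (dual Q) (dual b) y x" for x y
    using symbol_sym[OF f b(1) Q, of y x] sigma_sigma[of b Q] by (simp add: mult.assoc[symmetric])
  then have "symbol f (dual Q) (dual b) y x \<noteq> 0" using nz by auto
  from symbol_nonzero_mult[OF this] obtain t where t: "symbol f (dual Q) (dual b) t x * t ^ block_degree Q \<noteq> 0" by blast
  have "T b (dual Q) 0 0 \<in> Tall" unfolding Tall_def using b Q' by blast
  then have u: "T b (dual Q) 0 0 \<in> whole Rd" unfolding whole_eq by (rule RA.span_base)
  \<comment> \<open>With this parameter and y = x the argument of f taken from the contracted leg is
    t in both terms.\<close>
  define s where "s = t - x"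
  have st: "s + x = t" and st2: "- (- s - x - x) - x = t" "- s - x - x + x = - t"
    by (simp_all add: s_def)
  let ?h = "symbol f (dual Q) (dual b) t x * t ^ block_degree Q"
  have phu: "symbol (T b (dual Q) 0 0) P S x y = (if P = b \<and> S = dual Q then 1 else 0)
      + sigma b (dual Q) * (if P = Q \<and> S = dual b then 1 else 0)" for P S x y
    by (simp only: symbol_T dual_dual[OF Q] power_0 fact_0 div_by_1 mult_1)
  have ev: "lambda_series s (Yplus K (T b (dual Q) 0 0) f) b (dual b) x x =
     lprod s (symbol (T b (dual Q) 0 0)) (symbol f) b (dual b) x x
     - wprod koszul_sign (- s - x - x) (symbol f) (symbol (T b (dual Q) 0 0)) b (dual b) x x"
    by (rule lambda_series_formula[OF subsetD[OF whole_block_span u] subsetD[OF whole_block_span f]])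
  have "\<exists>c. c \<noteq> 0 \<and> lambda_series s (Yplus K (T b (dual Q) 0 0) f) b (dual b) x x = c * ?h"
  \<comment> \<open>For Q = b both units of T b (dual b) 0 0 coincide. Each contribution is doubled,
    and the constant is 4 instead of 2.\<close>
  proof (cases "Q = b")
    case True
    have bdb: "block_degree b = 0" "block_degree (dual b) = 0" using block_dual[OF b(1)] b(2) by (simp_all add: even_degree_def)
    have sgb: "sigma b (dual b) = (1 :: 'a)" by (rule sigma_dual_right[OF b])
    have f2: "symbol f b b x t = - symbol f (dual b) (dual b) t x"
      using sym[of x t] sigma_same(2)[OF b(2)] True by simp
    have ksb: "koszul_sign b b (dual b) = 1"
      unfolding koszul_sign_def block_dual[OF b(1)] b(2) by (simp add: koszul_bit)
    have 1: "lprod s (symbol (T b (dual Q) 0 0)) (symbol f) b (dual b) x x = (\<Sum>S = 1..K. if S = dual b then 2 * ?h else 0)"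
      unfolding wprod_def st phu
    proof (rule sum.cong)
      fix S assume "S \<in> {1..K}"
      show "1 * (((if b = b \<and> S = dual Q then 1 else 0) + sigma b (dual Q) * (if b = Q \<and> S = dual b then 1 else 0))
          * symbol f S (dual b) t x * t ^ block_degree S) = (if S = dual b then 2 * ?h else 0)"
        unfolding True by (cases "S = dual b") (simp_all only: sgb bdb simp_thms if_True if_False, simp_all)
    qed simp
    have 2: "wprod koszul_sign (- s - x - x) (symbol f) (symbol (T b (dual Q) 0 0)) b (dual b) x x =
        (\<Sum>S = 1..K. if S = b then - 2 * ?h else 0)"
      unfolding wprod_def st2 phu
    proof (rule sum.cong)
      fix S assume "S \<in> {1..K}"
      show "koszul_sign b S (dual b) * (symbol f b S x t * ((if S = b \<and> dual b = dual Q then 1 else 0) +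
           sigma b (dual Q) * (if S = Q \<and> dual b = dual b then 1 else 0)) * (- t) ^ block_degree S) = (if S = b then - 2 * ?h else 0)"
        unfolding True by (cases "S = b") (simp_all only: sgb bdb f2 ksb simp_thms if_True if_False, simp_all)
    qed simp
    show ?thesis
      unfolding ev 1 2 sum.delta[OF finite_atLeastAtMost] using b(1) b' by (intro exI[of _ 4]) simp
  next
    case False
    have ne: "dual b \<noteq> dual Q" using False dual_inj[OF b(1) Q] by metis
    have 1: "lprod s (symbol (T b (dual Q) 0 0)) (symbol f) b (dual b) x x = (\<Sum>S = 1..K. if S = dual Q then ?h else 0)"
      unfolding wprod_def st phu
      by (rule sum.cong) (use False Q in auto)
    have 2: "wprod koszul_sign (- s - x - x) (symbol f) (symbol (T b (dual Q) 0 0)) b (dual b) x x =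
        (\<Sum>S = 1..K. if S = Q then - ?h else 0)"
      unfolding wprod_def st2 phu
    proof (rule sum.cong)
      fix S assume "S \<in> {1..K}"
      have m: "(- t) ^ block_degree Q = (- 1) ^ block_degree Q * t ^ block_degree Q"
        by (simp add: power_mult_distrib[symmetric])
      have "koszul_sign b Q (dual b) * (symbol f b Q x t * sigma b (dual Q) * (- t) ^ block_degree Q) =
         (sigma b Q * sigma b (dual Q) * koszul_sign b Q (dual b) * (- 1) ^ block_degree Q) * ?h"
        unfolding m sym[of x t] by (simp only: mult_ac)
      then have "koszul_sign b Q (dual b) * (symbol f b Q x t * sigma b (dual Q) * (- t) ^ block_degree Q) = - ?h"
        unfolding sb by simp
      then show "koszul_sign b S (dual b) * (symbol f b S x t * ((if S = b \<and> dual b = dual Q then 1 else 0) +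
           sigma b (dual Q) * (if S = Q \<and> dual b = dual b then 1 else 0)) * (- t) ^ block_degree S) = (if S = Q then - ?h else 0)"
        using ne by (cases "S = Q") simp_all
    qed simp
    show ?thesis
      unfolding ev 1 2 sum.delta[OF finite_atLeastAtMost] using Q Q' by (intro exI[of _ 2]) simp
  qed
  then have "lambda_series s (Yplus K (T b (dual Q) 0 0) f) b (dual b) x x \<noteq> 0" using t by auto
  then obtain n where "symbol (nY K (T b (dual Q) 0 0) n f) b (dual b) x x \<noteq> 0" using lambda_series_witness by blast
  then show ?thesis using I(1)[OF u] by blast
qed

text \<open>One action of T (dual b) b 0 0 turns a row leg b into dual b, or a column leg dual b
  into b, and lowers its exponent. The new legs do not contract again, so two actions keep only what
  comes from the entry (b, dual b), lowered by i and j.\<close>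

definition lower :: "nat \<Rightarrow> nat \<Rightarrow> nat \<Rightarrow> 'a RA \<Rightarrow> 'a RA" where
  "lower b i j h = nY K (T (dual b) b 0 0) j (nY K (T (dual b) b 0 0) i h)"

text \<open>The factor 2 is due to the two equal units in T (dual b) b 0 0. Exponents drop by
  exactly i with coefficient 1, because the second block has degree 0.\<close>

lemma lower_once:
  assumes b: "b \<in> {1..K}" "block b = 1" and r: "r \<in> {1..K}" "s \<in> {1..K}"
  shows "nY K (T (dual b) b 0 0) i (T r s n1 n2) =
    smul (if r = b \<and> i \<le> n1 then 2 else 0) (T (dual b) s (n1 - i) n2) +
    smul (if s = dual b \<and> i \<le> n2 then 2 * sigma r s else 0) (T (dual b) (dual r) (n2 - i) n1)"
proof -
  have s1: "sigma (dual b) b = (1 :: 'a)" using sigma_dual_right[OF b] by (simp add: sigma_commute)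
  have c: "b = dual s \<longleftrightarrow> s = dual b" using b r by auto
  have tw: "smul a x + smul a x = smul (2 * a) x" for a and x :: "'a RA"
    by (simp add: RA.scale_left_distrib[symmetric])
  show ?thesis
    unfolding nY_T[OF dual_in[OF b(1)] b(1) r] dual_dual[OF b(1)] block_dual[OF b(1)] s1 c
    by (cases "r = b"; cases "s = dual b") (simp_all add: b block_degree_values contraction_coeff_zero tw add_ac)
qed

lemma lower_T:
  assumes b: "b \<in> {1..K}" "block b = 1" and r: "r \<in> {1..K}" "s \<in> {1..K}"
  shows "lower b i j (T r s n1 n2) = (if r = b \<and> s = dual b then
     smul (- 4) ((if i \<le> n1 \<and> j \<le> n2 then T (dual b) b (n2 - j) (n1 - i) else 0)
       + (if i \<le> n2 \<and> j \<le> n1 then T (dual b) b (n1 - j) (n2 - i) else 0)) else 0)"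
proof -
  note b' = dual_in[OF b(1)]
  have ne: "dual b \<noteq> b" by (rule dual_neq[OF b(1)])
  have sg1: "sigma (dual b) (dual b) = (- 1 :: 'a)" "sigma b (dual b) = (1 :: 'a)"
    using sigma_same(2)[of "dual b"] sigma_dual_right[OF b] b by simp_all
  have dr: "dual r = dual b \<longleftrightarrow> r = b" by (rule dual_inj[OF r(1) b(1)])
  show ?thesis
    unfolding lower_def lower_once[OF b r] nY_add_right nY_smul_right
      lower_once[OF b b' r(2)] lower_once[OF b b' dual_in[OF r(1)]] dr
    by (cases "r = b"; cases "s = dual b")
      (simp_all add: ne sg1 dual_dual[OF b(1)] RA.scale_right_distrib)
qed

text \<open>\<open>lowering_sum\<close> expresses \<open>lower\<close> through the coefficients at the entry (b, dual b) only.\<close>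

definition lowering_term :: "nat \<Rightarrow> nat \<Rightarrow> nat \<Rightarrow> (bit \<times> bit \<times> nat \<times> nat) \<Rightarrow> 'a mtx \<Rightarrow> 'a RA" where
  "lowering_term b i j z u = (case z of (i', j', n1, n2) \<Rightarrow>
     if i' = 1 \<and> j' = 1 \<and> i \<le> n1 \<and> j \<le> n2 then smul (- 4 * u b (dual b)) (T (dual b) b (n2 - j) (n1 - i)) else 0)"

lemma lowering_term_zero: "lowering_term b i j z 0 = 0"
  by (cases z) (simp add: lowering_term_def zero_fun_def)

lemma lowering_term_add: "lowering_term b i j z (u + v) = lowering_term b i j z u + lowering_term b i j z v"
  by (cases z) (simp add: lowering_term_def distrib_left RA.scale_left_distrib RA.scale_left_diff_distrib)

lemma lowering_term_scale: "lowering_term b i j z (\<lambda>p q. c * u p q) = smul c (lowering_term b i j z u)"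
  by (cases z) (simp add: lowering_term_def mult.left_commute)

definition lowering_sum :: "nat \<Rightarrow> nat \<Rightarrow> nat \<Rightarrow> 'a RA \<Rightarrow> 'a RA" where
  "lowering_sum b i j f = (\<Sum>z\<in>keys f. lowering_term b i j z (lookup f z))"

lemma lowering_sum_add: "lowering_sum b i j (f + g) = lowering_sum b i j f + lowering_sum b i j g"
  unfolding lowering_sum_def by (rule sum_keys_add, rule lowering_term_zero, rule lowering_term_add)

lemma lowering_sum_smul: "lowering_sum b i j (smul c f) = smul c (lowering_sum b i j f)"
proof -
  have "lowering_sum b i j (smul c f) = (\<Sum>z\<in>keys f. lowering_term b i j z (lookup (smul c f) z))"
    unfolding lowering_sum_def by (rule sum_keys_superset[where h = "lowering_term b i j", OF finite_keys keys_smul lowering_term_zero])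
  then show ?thesis by (simp only: lookup_smul lowering_term_scale RA.scale_sum_right lowering_sum_def)
qed

lemma lowering_sum_unit_elt:
  assumes b: "b \<in> {1..K}" "block b = 1"
  shows "lowering_sum b i j (unit_elt r s n1 n2) = (if r = b \<and> s = dual b \<and> i \<le> n1 \<and> j \<le> n2
     then smul (- 4) (T (dual b) b (n2 - j) (n1 - i)) else 0)"
proof -
  have "lowering_sum b i j (unit_elt r s n1 n2) = (\<Sum>z\<in>{(block r, block s, n1, n2)}. lowering_term b i j z (lookup (unit_elt r s n1 n2) z))"
    unfolding lowering_sum_def
    by (rule sum_keys_superset[where h = "lowering_term b i j", OF _ _ lowering_term_zero]) (simp_all add: unit_elt_def elt_def)
  also have "\<dots> = lowering_term b i j (block r, block s, n1, n2) (E r s)" by (simp add: unit_elt_def elt_def)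
  also have "\<dots> = (if r = b \<and> s = dual b \<and> i \<le> n1 \<and> j \<le> n2
     then smul (- 4) (T (dual b) b (n2 - j) (n1 - i)) else 0)"
    unfolding lowering_term_def prod.case E_def using b block_dual[OF b(1)] by (cases "r = b \<and> s = dual b") auto
  finally show ?thesis .
qed

text \<open>Both sides are linear, so they are compared on \<open>T\<close>. The two terms in
  \<open>lower_T\<close> come from the two units of T b (dual b) m n, which both lie at (b, dual b)
  with exponents exchanged.\<close>

lemma lower_eq_lowering_sum:
  assumes b: "b \<in> {1..K}" "block b = 1" and f: "f \<in> whole Rd"
  shows "lower b i j f = lowering_sum b i j f"
  using f unfolding whole_eq
proof (induction rule: RA.span_induct_alt)
  case base
  then show ?case by (simp add: lower_def lowering_sum_def)
next
  case (step c u v)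
  then obtain r s m n where u: "u = T r s m n" "r \<in> {1..K}" "s \<in> {1..K}" unfolding Tall_def by blast
  have c: "dual s = b \<and> dual r = dual b \<longleftrightarrow> r = b \<and> s = dual b"
    using b(1) u(2,3) dual_dual by metis
  have "lower b i j u = lowering_sum b i j u"
  proof (cases "r = b \<and> s = dual b")
    case True
    then have "sigma r s = (1 :: 'a)" using sigma_dual_right[OF b] by simp
    then have "lowering_sum b i j u = (if i \<le> m \<and> j \<le> n then smul (- 4) (T (dual b) b (n - j) (m - i)) else 0) +
       (if i \<le> n \<and> j \<le> m then smul (- 4) (T (dual b) b (m - j) (n - i)) else 0)"
      unfolding u(1) T_def[of r s] lowering_sum_add lowering_sum_smul lowering_sum_unit_elt[OF b] using True c by simp
    then show ?thesis
      unfolding u(1) lower_T[OF b u(2,3)] using True by (simp add: RA.scale_right_distrib)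
  next
    case False
    then have "\<not> (dual s = b \<and> dual r = dual b)" using c by blast
    then have "lowering_sum b i j u = 0" 
      unfolding u(1) T_def[of r s] lowering_sum_add lowering_sum_smul lowering_sum_unit_elt[OF b] using False by auto
    moreover have "lower b i j u = 0"
      unfolding u(1) lower_T[OF b u(2,3)] by (simp only: False if_False)
    ultimately show ?thesis by simp
  qed
  then show ?case
    using step.IH by (simp add: lower_def nY_add_right nY_smul_right lowering_sum_add lowering_sum_smul)
qed

lemma extract_current:
  assumes f: "f \<in> whole Rd" and b: "b \<in> {1..K}" "block b = 1" and nz: "symbol f b (dual b) x y \<noteq> 0"
  shows "\<exists>i j c. c \<noteq> 0 \<and> lower b i j f = smul c (T (dual b) b 0 0)"
proof -
  define N where "N = {(m, n). lookup f (1, 1, m, n) b (dual b) \<noteq> 0}"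
  have fin: "finite N"
  proof (rule finite_subset)
    show "N \<subseteq> (\<lambda>(i, j, m, n). (m, n)) ` keys f"
    proof
      fix z assume "z \<in> N"
      then have "lookup f (1, 1, fst z, snd z) \<noteq> 0" by (auto simp: N_def)
      then have "(1, 1, fst z, snd z) \<in> keys f" by (simp add: in_keys_iff)
      then show "z \<in> (\<lambda>(i, j, m, n). (m, n)) ` keys f" by force
    qed
  qed simp
  have "N \<noteq> {}"
  proof
    assume "N = {}"
    then have "lookup f (1, 1, m, n) b (dual b) = 0" for m n by (auto simp: N_def)
    then have "symbol f b (dual b) x y = 0"
      using symbol_bound[of f b "dual b"] b by auto
    then show False using nz by simp
  qed
  \<comment> \<open>No exponent pair of maximal total degree is dominated componentwise by another
    one. Lowering by such a pair (i, j) therefore leaves one term, with exponents 0, 0.\<close>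
  define d where "d = Max ((\<lambda>(m, n). m + n) ` N)"
  have "d \<in> (\<lambda>(m, n). m + n) ` N" unfolding d_def using fin \<open>N \<noteq> {}\<close> by (intro Max_in) auto
  then obtain i j where ij: "(i, j) \<in> N" "i + j = d" by auto
  have max: "m + n \<le> i + j" if "(m, n) \<in> N" for m n
    unfolding ij(2) d_def using fin that by (intro Max_ge) force+
  let ?c = "- 4 * lookup f (1, 1, i, j) b (dual b)"
  have "lower b i j f = (\<Sum>z\<in>keys f. lowering_term b i j z (lookup f z))"
    unfolding lower_eq_lowering_sum[OF b f] lowering_sum_def ..
  also have "\<dots> = (\<Sum>z\<in>{(1, 1, i, j)}. lowering_term b i j z (lookup f z))"
  proof (rule sum.mono_neutral_right)
    show "{(1, 1, i, j)} \<subseteq> keys f" using ij(1) by (auto simp: N_def in_keys_iff)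
    show "\<forall>z\<in>keys f - {(1, 1, i, j)}. lowering_term b i j z (lookup f z) = 0"
    proof
      fix z assume z: "z \<in> keys f - {(1, 1, i, j)}"
      obtain i' j' m n where zz: "z = (i', j', m, n)" by (metis prod_cases4)
      show "lowering_term b i j z (lookup f z) = 0"
      proof (cases "i' = 1 \<and> j' = 1 \<and> i \<le> m \<and> j \<le> n")
        case True
        then have "(m, n) \<noteq> (i, j)" using z zz by auto
        then have "(m, n) \<notin> N" using max[of m n] True by auto
        then show ?thesis unfolding zz lowering_term_def N_def using True by simp
      next
        case False
        then show ?thesis unfolding zz lowering_term_def by auto
      qed
    qed
  qed simp
  also have "\<dots> = smul ?c (T (dual b) b 0 0)" by (simp add: lowering_term_def)
  finally have "lower b i j f = smul ?c (T (dual b) b 0 0)" .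
  moreover have "?c \<noteq> 0" using ij(1) by (simp add: N_def)
  ultimately show ?thesis by blast
qed

text \<open>From one element whose indices are dual to each other, the legs are replaced one after
  the other (\<open>s1\<close>, \<open>s2\<close>) until all odd elements with exponents 0, 0 are
  reached. Diagonal elements with free exponents then supply the exponents (\<open>s3\<close>,
  \<open>s4\<close>).\<close>

lemma current_generates:
  fixes I :: "'a RA set"
  assumes I: "RA.subspace I" and act: "\<And>u n w. u \<in> whole Rd \<Longrightarrow> w \<in> I \<Longrightarrow> nY K u n w \<in> I"
    and b: "b \<in> {1..K}" "block b = 1" and mem: "T b (dual b) 0 0 \<in> I"
  shows "whole Rd \<subseteq> I"
proof -
  have actT: "nY K (T p q m1 m2) n w \<in> I" if "p \<in> {1..K}" "q \<in> {1..K}" "w \<in> I" for p q m1 m2 n w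
  proof (rule act[OF _ that(3)])
    have "T p q m1 m2 \<in> Tall" unfolding Tall_def using that by blast
    then show "T p q m1 m2 \<in> whole Rd" unfolding whole_eq by (rule RA.span_base)
  qed
  note cin = contraction_in[OF I]
  note b' = dual_in[OF b(1)]
  have flip: "T p q m n \<in> I" if "p \<in> {1..K}" "q \<in> {1..K}" "T (dual q) (dual p) n m \<in> I" for p q m n
    using T_subspace_sym[OF I dual_in[OF that(2)] dual_in[OF that(1)] that(3)]
    unfolding dual_dual[OF that(1)] dual_dual[OF that(2)] .
  have s1: "T a (dual b) 0 0 \<in> I" if a: "a \<in> {1..K}" "block a = 0" for a
  proof -
    have ab: "block a \<noteq> block b" using a b by simp
    have ne: "dual a \<noteq> b" "a \<noteq> dual b" using block_neq[OF ab b(1)] block_neq[OF ab[symmetric] a(1)] by metis+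
    \<comment> \<open>Two contractions occur here, since b is also the dual of the last index. They
      agree and give the factor 2, so that \<open>contraction_in\<close> does not apply.\<close>
    have "nY K (T a b 0 0) 0 (T b (dual b) 0 0) = smul 2 (T a (dual b) 0 0)"
      unfolding nY_T[OF a(1) b(1) b(1) b'] dual_dual[OF b(1)] sigma_dual_right[OF b]
      using ne b by (simp add: block_degree_values contraction_coeff_zero RA.scale_left_distrib[of 1 1, simplified])
    then have "smul 2 (T a (dual b) 0 0) \<in> I" using actT[OF a(1) b(1) mem, of 0 0 0] by simp
    then show ?thesis by (rule subspace_cancel[OF I]) simp
  qed
  have s2: "T d a 0 0 \<in> I" if a: "a \<in> {1..K}" "block a = 0" and d: "d \<in> {1..K}" "block d = 1" for a d
  proof -
    have a': "dual a \<in> {1..K}" "block (dual a) = 0" using dual_in[OF a(1)] block_dual[OF a(1)] a(2) by simp_all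
    have ad: "block d \<noteq> block a" using a d by simp
    have ba: "block b \<noteq> block a" using a b by simp
    have m: "T b a 0 0 \<in> I" by (rule flip[OF b(1) a(1) s1[OF a']])
    show ?thesis
    proof (cases "dual d = b")
      case False
      show ?thesis
        by (rule cin[OF d(1) b(1) a(1) _ False _ _ actT[OF d(1) b(1) m, of 0 0 0]])
          (use block_neq[OF ba a(1)] block_neq[OF ad a(1)] b in \<open>simp_all add: block_degree_values\<close>)
    next
      case True
      have ne: "b \<noteq> dual a" "d \<noteq> a" using block_neq[OF ba a(1)] block_neq[OF ad a(1)] by blast+
      have block_degree: "dual b = d" using True d by auto
      have "nY K (T d b 0 0) 0 (T b a 0 0) = smul 2 (T d a 0 0)"
        unfolding nY_T[OF d(1) b(1) b(1) a(1)] True block_degree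
        using ne b d sigma_dual_right[OF d] True by (simp add: block_degree_values contraction_coeff_zero RA.scale_left_distrib[of 1 1, simplified])
      then have "smul 2 (T d a 0 0) \<in> I" using actT[OF d(1) b(1) m, of 0 0 0] by simp
      then show ?thesis by (rule subspace_cancel[OF I]) simp
    qed
  qed
  have s3: "T a d m 0 \<in> I" if a: "a \<in> {1..K}" "block a = 0" and d: "d \<in> {1..K}" "block d = 1" for a d m
  proof -
    have ad: "block a \<noteq> block d" using a d by simp
    have t: "T a d 0 0 \<in> I"
      by (rule flip[OF a(1) d(1) s2[OF dual_in[OF a(1)] _ dual_in[OF d(1)]]])
        (simp_all only: block_dual[OF a(1)] block_dual[OF d(1)] a(2) d(2))
    show ?thesis
      \<comment> \<open>Product index 1 compensates the additional power that a contraction through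
        the first block creates.\<close>
      by (rule cin[OF a(1) a(1) d(1) _ dual_neq[OF a(1)] _ _ actT[OF a(1) a(1) t, of m 0 1]])
        (use block_neq[OF ad d(1)] a in \<open>simp_all add: block_degree_values\<close>)
  qed
  have s4: "T d a n m \<in> I" if a: "a \<in> {1..K}" "block a = 0" and d: "d \<in> {1..K}" "block d = 1" for a d n m
  proof -
    have da: "block d \<noteq> block a" using a d by simp
    have t: "T d a 0 m \<in> I"
      by (rule flip[OF d(1) a(1) s3[OF dual_in[OF a(1)] _ dual_in[OF d(1)]]])
        (simp_all only: block_dual[OF a(1)] block_dual[OF d(1)] a(2) d(2))
    show ?thesis
      by (rule cin[OF d(1) d(1) a(1) _ dual_neq[OF d(1)] _ _ actT[OF d(1) d(1) t, of n 0 0]])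
        (use block_neq[OF da a(1)] d in \<open>simp_all add: block_degree_values\<close>)
  qed
  show ?thesis
  proof (rule odd_imp_all[OF I])
    show "nY K (T p q m1 m2) n w \<in> I" if "p \<in> {1..K}" "q \<in> {1..K}" "w \<in> I" for p q m1 m2 n w
      by (rule actT[OF that])
    show "T p q m n \<in> I" if J: "p \<in> {1..K}" "q \<in> {1..K}" and b: "block p \<noteq> block q" for p q m n
    proof (cases "block p = 0")
      case True
      then have "block q = 1" using b by simp
      show ?thesis
        by (rule flip[OF J s4[OF dual_in[OF J(1)] _ dual_in[OF J(2)]]])
          (simp_all only: block_dual[OF J(1)] block_dual[OF J(2)] True \<open>block q = 1\<close>)
    next
      case False
      then have "block p = 1" "block q = 0" using b by simp_all
      then show ?thesis using s4 J by blast
    qed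
  qed
qed

lemma simple_Rdagger: "simple_conformal_superalgebra smul Rd der (Yplus K)"
proof (intro simple_conformal_superalgebra.intro simple_conformal_superalgebra_axioms.intro conformal_Rdagger)
  fix I :: "'a RA set"
  assume "conformal_superalgebra.ideal smul Rd der (Yplus K) I"
  then have I: "RA.subspace I" "I \<subseteq> whole Rd"
    and lk: "\<And>u v z. u \<in> whole Rd \<Longrightarrow> v \<in> I \<Longrightarrow> lookup (Yplus K u v) z \<in> I"
    unfolding conformal_superalgebra.ideal_def[OF conformal_Rdagger] by blast+
  have act: "nY K u n v \<in> I" if "u \<in> whole Rd" "v \<in> I" for u n v
    unfolding nprod_def by (rule lk[OF that])
  show "I = {0} \<or> I = whole Rd"
  proof (cases "I = {0}")
    case False
    then obtain f where f: "f \<in> I" "f \<noteq> 0" using RA.subspace_0[OF I(1)] by blast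
    obtain g b Q x y where g: "g \<in> I" and b: "b \<in> {1..K}" "block b = 1" and Q: "Q \<in> {1..K}" and nz: "symbol g b Q x y \<noteq> 0"
      using reduce_to_block1[OF subsetD[OF I(2) f(1)] f(2) act[OF _ f(1)] f(1)] by blast
    obtain h x y where h: "h \<in> I" and nzh: "symbol h b (dual b) x y \<noteq> 0"
      using reduce_to_dual[OF subsetD[OF I(2) g] b Q nz act[OF _ g] g] by blast
    obtain i j c where c: "c \<noteq> 0" "lower b i j h = smul c (T (dual b) b 0 0)"
      using extract_current[OF subsetD[OF I(2) h] b nzh] by blast
    have "T (dual b) b 0 0 \<in> Tall" unfolding Tall_def using b dual_in[OF b(1)] by blast
    then have "T (dual b) b 0 0 \<in> whole Rd" unfolding whole_eq by (rule RA.span_base)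
    then have "lower b i j h \<in> I" unfolding lower_def by (intro act h)
    then have "T (dual b) b 0 0 \<in> I" unfolding c(2) by (rule subspace_cancel[OF I(1) _ c(1)])
    \<comment> \<open>The extracted element has the shape required by
      \<open>current_generates\<close> with dual b in place of b.\<close>
    then have t: "T (dual b) (dual (dual b)) 0 0 \<in> I" using dual_dual[OF b(1)] by simp
    have "whole Rd \<subseteq> I"
      by (rule current_generates[OF I(1) act dual_in[OF b(1)] _ t]) (simp_all only: block_dual[OF b(1)] b(2))
    then show ?thesis using I(2) by blast
  qed simp
qed

end

theorem theorem4p3:
  fixes l1 l2 k1 k2 k :: nat
    and R :: "bit \<Rightarrow> 'a::field_char_0 RA set"
  assumes "l1 > 0" and "l2 > 0"
    and "k1 = 2 * l1" and "k2 = 2 * l2" and "k = k1 + k2"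
    and "R = Rdagger l1 l2"
  shows "simple_conformal_superalgebra smul R der (Yplus k)
    \<and> (Rdagger_weight l1 l2 (3 / 2) :: 'a RA set) = RA.span (odd_gens l1 l2 0 0)
    \<and> (k > 4 \<longrightarrow> whole R = generated smul (Yplus k) (Rdagger_weight l1 l2 (3 / 2)))
    \<and> (k = 4 \<longrightarrow> whole R = generated smul (Yplus k)
          {x + smul c (elt (E 3 3) 1 1 0 1 - elt (E 4 4) 1 1 1 0) | x c.
             x \<in> Rdagger_weight l1 l2 (3 / 2)})"
proof -
  interpret orthosymplectic l1 l2 "TYPE('a)"
    by standard (use assms(1,2) in simp_all)
  let ?S = "Rdagger_weight l1 l2 (3 / 2) :: 'a RA set"
  have k: "k = 2 * l1 + 2 * l2" using assms(3-5) by simp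
  have S1: "?S \<subseteq> Rd 1" unfolding weight_odd by (rule odd_span_Rd)
  have S0: "0 \<in> ?S" unfolding weight_odd by (rule RA.span_zero)
  have "whole Rd = generated smul (Yplus k) ?S" if "k > 4"
    unfolding k
  proof (rule generated_whole)
    show "?S \<subseteq> whole Rd" using S1 Rd_whole by blast
    show "RA.span (odd_gens l1 l2 0 0) \<subseteq> ?S" unfolding weight_odd ..
    show "2 \<le> l1 \<or> 2 \<le> l2 \<or> l1 = 1 \<and> l2 = 1 \<and> T 3 3 0 1 \<in> ?S"
      \<comment> \<open>2 l1 + 2 l2 > 4 forces one of l1, l2 to be at least 2.\<close>
      using that unfolding k by linarith
    show "\<exists>s0 s1. s0 \<in> ?S \<inter> Rd 0 \<and> s1 \<in> ?S \<inter> Rd 1 \<and> s = s0 + s1" if "s \<in> ?S" for s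
      using that S0 S1 RA.subspace_0[OF subspace_Rd] by (intro exI[of _ 0] exI[of _ s]) auto
  qed
  moreover have "whole Rd = generated smul (Yplus k)
      {x + smul c (elt (E 3 3) 1 1 0 1 - elt (E 4 4) 1 1 1 0) | x c. x \<in> ?S}" (is "_ = generated _ _ ?S'")
    if "k = 4"
  proof -
    have l: "l1 = 1" "l2 = 1" using that assms(1,2) unfolding k by linarith+
    have v: "dual 3 = 4" "block 3 = 1" "block 4 = 1" "(3 :: nat) \<in> {1..K}"
      unfolding dual_def block_def unfolding l by simp_all
    \<comment> \<open>For l1 = l2 = 1 the second block is {3, 4}, so the additional generator is a
      single \<open>T\<close>; the sign -1 is \<open>sigma 3 3\<close>.\<close>
    have T33: "T 3 3 0 1 = elt (E 3 3) 1 1 0 1 - elt (E 4 4) 1 1 1 0"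
      unfolding T_def unit_elt_def v sigma_same(2)[OF v(2)] by simp
    have T0: "T 3 3 0 1 \<in> Rd 0"
      unfolding Rdagger_eq by (intro RA.span_base T_in_Tset v(4)) (simp add: v)
    have mem: "x + smul c (T 3 3 0 1) \<in> ?S'" if "x \<in> ?S" for x c
      unfolding T33 using that by blast
    have SS': "?S \<subseteq> ?S'" using mem[of _ 0] by auto
    show ?thesis
      unfolding k
    proof (rule generated_whole)
      show "?S' \<subseteq> whole Rd"
      proof
        fix s assume "s \<in> ?S'"
        then obtain x c where s: "s = x + smul c (T 3 3 0 1)" "x \<in> ?S" unfolding T33 by blast
        show "s \<in> whole Rd"
          unfolding s(1)
          by (intro RA.subspace_add[OF subspace_whole] RA.subspace_scale[OF subspace_whole]
              Rd_whole[OF T0] Rd_whole[OF subsetD[OF S1 s(2)]])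
      qed
      show "RA.span (odd_gens l1 l2 0 0) \<subseteq> ?S'" using SS' unfolding weight_odd .
      show "2 \<le> l1 \<or> 2 \<le> l2 \<or> l1 = 1 \<and> l2 = 1 \<and> T 3 3 0 1 \<in> ?S'"
        using mem[OF S0, of 1] l by simp
      show "\<exists>s0 s1. s0 \<in> ?S' \<inter> Rd 0 \<and> s1 \<in> ?S' \<inter> Rd 1 \<and> s = s0 + s1" if "s \<in> ?S'" for s
      proof -
        obtain x c where s: "s = x + smul c (T 3 3 0 1)" "x \<in> ?S" using \<open>s \<in> ?S'\<close> unfolding T33 by blast
        have "smul c (T 3 3 0 1) \<in> ?S'" using mem[OF S0, of c] by simp
        moreover have "smul c (T 3 3 0 1) \<in> Rd 0" by (rule RA.subspace_scale[OF subspace_Rd T0])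
        ultimately show ?thesis
          using s SS' S1 by (intro exI[of _ "smul c (T 3 3 0 1)"] exI[of _ x]) (auto simp: add.commute)
      qed
    qed
  qed
  ultimately show ?thesis
    using simple_Rdagger weight_odd unfolding assms(6) k by blast
qed

end
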